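(* For $n\ge 2$ let $r(\Delta_n)$ be the number of chambers in $\Delta_n$ containing a given special vertex and $\omega(\Delta_n)$ the number of vertices in $\Delta_n$ close to a given special vertex in $\Delta_n$, and set $r(\Delta_1) = q+1$. Then for all $n \geq 2$, $$q \cdot r(\Delta_n) = r(\Delta_{n-1})\,\omega(\Delta_n).$$
   Context: $K$ is a (nonarchimedean) local field with discrete valuation $\mathrm{ord}$, valuation ring $\mathcal{O}$, uniformizer $\pi$ and residue field $k \cong \mathbb{F}_q$. Let $V$ be a $2n$-dimensional $K$-vector space with a non-degenerate alternating bilinear form $\langle\cdot,\cdot\rangle$. A lattice in $V$ is a free $\mathcal{O}$-submodule of rank $2n$; $[L]$ is the homothety class $\{\alpha L : \alpha\in K^\times\}$. A lattice $L$ is primitive if $\langle L,L\rangle\subseteq\mathcal{O}$ and $\langle\cdot,\cdot\rangle$ induces a non-degenerate alternating $k$-bilinear form on $L/\pi L$. The affine building $\Delta_n$ of $\mathrm{Sp}_n(K)$ (the symplectic group of $2n\times 2n$ matrices) is the following $n$-dimensional simplicial complex. A vertex is a homothety class of lattices in $V$ having a representative $L$ for which there is a primitive lattice $L_0$ with $\langle L,L\rangle\subseteq\pi\mathcal{O}$ and $\pi L_0\subseteq L\subseteq L_0$. Vertices $t,t'$ are incident if there are $L\in t$, $L'\in t'$ and a primitive lattice $L_0$ with $\langle L,L\rangle\subseteq\pi\mathcal{O}$, $\langle L',L'\rangle\subseteq\pi\mathcal{O}$, and either $\pi L_0\subseteq L\subseteq L'\subseteq L_0$ or $\pi L_0\subseteq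 L'\subseteq L\subseteq L_0$. Simplices are the finite sets of pairwise incident vertices. A chamber (maximal simplex) has $n+1$ vertices $t_0,\dots,t_n$ with representatives $L_i\in t_i$ such that $L_0$ is primitive, $\langle L_i,L_i\rangle\subseteq\pi\mathcal{O}$ for $1\le i\le n$, and $\pi L_0\subsetneq L_1\subsetneq\cdots\subsetneq L_n\subsetneq L_0$. Two chambers are adjacent if they share a codimension-one face. Two vertices $t,t'$ of $\Delta_n$ are close if there are adjacent chambers $C,C'$ in $\Delta_n$ with $t\in C$, $t'\in C'$, but $t,t'\notin C\cap C'$. A basis $\{u_1,\dots,u_n,w_1,\dots,w_n\}$ of $V$ is symplectic if $\langle u_i,w_j\rangle=\delta_{ij}$ and $\langle u_i,u_j\rangle=0=\langle w_i,w_j\rangle$ for all $i,j$. A vertex $t$ of $\Delta_n$ is special (in the usual sense for affine buildings) if and only if there are a symplectic basis of $V$ and integers $a_1,\dots,a_n,\mu$ with $t=[\sum_i \mathcal{O}\pi^{a_i}u_i+\sum_i\mathcal{O}\pi^{\mu-a_i}w_i]$; this may be taken as the definition. The numbers $r(\Delta_n)$ and $\omega(\Delta_n)$ do not depend on the chosen special vertex. *)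

theory Defs
  imports Complex_Main "HOL-Library.Set_Algebras"
begin

(* The value ord 0 is irrelevant (mathematically it is infinity), so every use of ord is
   guarded.  The uniformizer is a parameter; ord_uniformizer also normalises ord to be onto. *)
locale nonarch_local_field =
  fixes ord :: "'k::field \<Rightarrow> int" and \<pi> :: 'k
  assumes ord_mult: "\<lbrakk>x \<noteq> 0; y \<noteq> 0\<rbrakk> \<Longrightarrow> ord (x * y) = ord x + ord y"
    and ord_add: "\<lbrakk>x \<noteq> 0; y \<noteq> 0; x + y \<noteq> 0\<rbrakk> \<Longrightarrow> min (ord x) (ord y) \<le> ord (x + y)"
    and uniformizer_nonzero: "\<pi> \<noteq> 0"
    and ord_uniformizer: "ord \<pi> = 1"
    and complete:
      "\<And>X :: nat \<Rightarrow> 'k. (\<And>N. \<exists>M. \<forall>i\<ge>M. \<forall>j\<ge>M. X i = X j \<or> N \<le> ord (X i - X j)) \<Longrightarrow>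
       \<exists>x. \<forall>N. \<exists>M. \<forall>i\<ge>M. X i = x \<or> N \<le> ord (X i - x)"
    and finite_residue:
      "finite ((\<lambda>x. x +o ((*) \<pi> ` {y. y = 0 \<or> 0 \<le> ord y})) ` {y. y = 0 \<or> 0 \<le> ord y})"
begin

definition valuation_ring :: "'k set"  (\<open>\<O>\<close>) where
  "\<O> = {x. x = 0 \<or> 0 \<le> ord x}"

definition maximal_ideal :: "'k set"  (\<open>\<pi>\<O>\<close>) where
  "\<pi>\<O> = (*) \<pi> ` \<O>"

definition residue_field :: "'k set set" where
  "residue_field = (\<lambda>x. x +o \<pi>\<O>) ` \<O>"

definition q :: nat where
  "q = card residue_field"

end

(* V is a subspace of an ambient vector space rather than a whole type, so that the dimension
   can vary within one theorem. *)
locale symplectic_space = nonarch_local_field ord \<pi> + vector_space scale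
  for ord :: "'k::field \<Rightarrow> int" and \<pi> :: 'k
    and scale :: "'k \<Rightarrow> 'v::ab_group_add \<Rightarrow> 'v"  (infixr \<open>*s\<close> 75) +
  fixes V :: "'v set" and form :: "'v \<Rightarrow> 'v \<Rightarrow> 'k"  (\<open>\<langle>_, _\<rangle>\<close>) and n :: nat
  assumes n_pos: "1 \<le> n"
    and subspace_V: "subspace V"
    and dim_V: "dim V = 2 * n"
    and form_add_left: "\<lbrakk>x \<in> V; y \<in> V; z \<in> V\<rbrakk> \<Longrightarrow> \<langle>x + y, z\<rangle> = \<langle>x, z\<rangle> + \<langle>y, z\<rangle>"
    and form_add_right: "\<lbrakk>x \<in> V; y \<in> V; z \<in> V\<rbrakk> \<Longrightarrow> \<langle>x, y + z\<rangle> = \<langle>x, y\<rangle> + \<langle>x, z\<rangle>"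
    and form_scale_left: "\<lbrakk>x \<in> V; y \<in> V\<rbrakk> \<Longrightarrow> \<langle>c *s x, y\<rangle> = c * \<langle>x, y\<rangle>"
    and form_scale_right: "\<lbrakk>x \<in> V; y \<in> V\<rbrakk> \<Longrightarrow> \<langle>x, c *s y\<rangle> = c * \<langle>x, y\<rangle>"
    and form_alternating: "x \<in> V \<Longrightarrow> \<langle>x, x\<rangle> = 0"
    and form_nondegenerate: "\<lbrakk>x \<in> V; \<And>y. y \<in> V \<Longrightarrow> \<langle>x, y\<rangle> = 0\<rbrakk> \<Longrightarrow> x = 0"
begin

definition \<O>_independent :: "'v set \<Rightarrow> bool" where
  "\<O>_independent S \<longleftrightarrow>
     (\<forall>c. (\<forall>b\<in>S. c b \<in> \<O>) \<and> (\<Sum>b\<in>S. c b *s b) = 0 \<longrightarrow> (\<forall>b\<in>S. c b = 0))"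

definition \<O>_span :: "'v set \<Rightarrow> 'v set" where
  "\<O>_span S = {(\<Sum>b\<in>S. c b *s b) | c. \<forall>b\<in>S. c b \<in> \<O>}"

definition lattice :: "'v set \<Rightarrow> bool" where
  "lattice L \<longleftrightarrow>
     (\<exists>S. S \<subseteq> V \<and> finite S \<and> card S = 2 * n \<and> \<O>_independent S \<and> L = \<O>_span S)"

definition scaled :: "'k \<Rightarrow> 'v set \<Rightarrow> 'v set" where
  "scaled \<alpha> L = (\<lambda>x. \<alpha> *s x) ` L"

definition homothety_class :: "'v set \<Rightarrow> 'v set set" where
  "homothety_class L = {scaled \<alpha> L | \<alpha>. \<alpha> \<noteq> 0}"

definition form_maps_into :: "'v set \<Rightarrow> 'k set \<Rightarrow> bool" where
  "form_maps_into L A \<longleftrightarrow> (\<forall>x\<in>L. \<forall>y\<in>L. \<langle>x, y\<rangle> \<in> A)"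

definition reduction :: "'v set \<Rightarrow> 'v set set" where
  "reduction L = (\<lambda>x. x +o scaled \<pi> L) ` L"

(* The form induced on the quotient of L by its multiple under the uniformizer, with values in
   the residue field.  If the form is integral on L, the union is over equal cosets, and the
   induced form is automatically bilinear and alternating. *)
definition induced_form :: "'v set \<Rightarrow> 'v set \<Rightarrow> 'k set" where
  "induced_form X Y = (\<Union>x\<in>X. \<Union>y\<in>Y. \<langle>x, y\<rangle> +o \<pi>\<O>)"

(* The zero elements of the residue field and of the reduction of L are the trivial cosets. *)
definition primitive :: "'v set \<Rightarrow> bool" where
  "primitive L \<longleftrightarrow> lattice L \<and> form_maps_into L \<O> \<and>
     (\<forall>X\<in>reduction L. (\<forall>Y\<in>reduction L. induced_form X Y = \<pi>\<O>) \<longrightarrow> X = scaled \<pi> L)"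

definition vertices :: "'v set set set" where
  "vertices = {homothety_class L | L. lattice L \<and> form_maps_into L \<pi>\<O> \<and>
     (\<exists>L0. primitive L0 \<and> scaled \<pi> L0 \<subseteq> L \<and> L \<subseteq> L0)}"

definition incident :: "'v set set \<Rightarrow> 'v set set \<Rightarrow> bool" where
  "incident t t' \<longleftrightarrow> t \<in> vertices \<and> t' \<in> vertices \<and>
     (\<exists>L\<in>t. \<exists>L'\<in>t'. \<exists>L0. primitive L0 \<and> form_maps_into L \<pi>\<O> \<and> form_maps_into L' \<pi>\<O> \<and>
        (scaled \<pi> L0 \<subseteq> L \<and> L \<subseteq> L' \<and> L' \<subseteq> L0 \<or> scaled \<pi> L0 \<subseteq> L' \<and> L' \<subseteq> L \<and> L \<subseteq> L0))"

definition simplex :: "'v set set set \<Rightarrow> bool" where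
  "simplex S \<longleftrightarrow> finite S \<and> S \<subseteq> vertices \<and> pairwise incident S"

definition chamber :: "'v set set set \<Rightarrow> bool" where
  "chamber C \<longleftrightarrow> simplex C \<and> (\<forall>S. simplex S \<and> C \<subseteq> S \<longrightarrow> S = C)"

definition adjacent :: "'v set set set \<Rightarrow> 'v set set set \<Rightarrow> bool" where
  "adjacent C C' \<longleftrightarrow> chamber C \<and> chamber C' \<and>
     (\<exists>F. F \<subseteq> C \<and> F \<subseteq> C' \<and> card C = card F + 1 \<and> card C' = card F + 1)"

definition close :: "'v set set \<Rightarrow> 'v set set \<Rightarrow> bool" where
  "close t t' \<longleftrightarrow>
     (\<exists>C C'. adjacent C C' \<and> t \<in> C \<and> t' \<in> C' \<and> t \<notin> C \<inter> C' \<and> t' \<notin> C \<inter> C')"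

definition symplectic_basis :: "(nat \<Rightarrow> 'v) \<Rightarrow> (nat \<Rightarrow> 'v) \<Rightarrow> bool" where
  "symplectic_basis u w \<longleftrightarrow>
     independent (u ` {1..n} \<union> w ` {1..n}) \<and> span (u ` {1..n} \<union> w ` {1..n}) = V \<and>
     (\<forall>i\<in>{1..n}. \<forall>j\<in>{1..n}.
        \<langle>u i, w j\<rangle> = (if i = j then 1 else 0) \<and> \<langle>u i, u j\<rangle> = 0 \<and> \<langle>w i, w j\<rangle> = 0)"

definition special :: "'v set set \<Rightarrow> bool" where
  "special t \<longleftrightarrow> t \<in> vertices \<and>
     (\<exists>u w (a :: nat \<Rightarrow> int) (\<mu> :: int). symplectic_basis u w \<and>
        t = homothety_class
              {(\<Sum>i=1..n. (c i * \<pi> powi a i) *s u i) + (\<Sum>i=1..n. (d i * \<pi> powi (\<mu> - a i)) *s w i)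
               | c d. \<forall>i\<in>{1..n}. c i \<in> \<O> \<and> d i \<in> \<O>})"

(* The value q + 1 in rank 1 is a convention of the statement, not a count. *)
definition r :: "'v set set \<Rightarrow> nat" where
  "r t = (if n = 1 then q + 1 else card {C. chamber C \<and> t \<in> C})"

definition \<omega> :: "'v set set \<Rightarrow> nat" where
  "\<omega> t = card {t'. close t t'}"

end

end

theory Submission
  imports Defs "HOL-Library.FuncSet"
begin

text \<open>Write \<open>L\<^sup>#\<close> for the lattice of all vectors whose pairing with \<open>L\<close> is integral. Every vertex of the
building has exactly one representative \<open>L\<close> with \<open>\<pi>\<^sup>2 L\<^sup># \<subseteq> L \<subseteq> \<pi> L\<^sup>#\<close>
(\<open>vertices_eq\<close>, \<open>normalisation_unique\<close>), and two vertices are incident if and only if these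
representatives are comparable for inclusion (\<open>incident_homothety_class_iff\<close>). The building is therefore
the complex of finite chains in the ordered set of normalised lattices. More generally, with
\<open>dual c L = c L\<^sup>#\<close>, let \<open>normalised c\<close> be the set of lattices with \<open>\<pi> c L\<^sup># \<subseteq> L \<subseteq> c L\<^sup>#\<close>;
the building is the case \<open>c = \<pi>\<close>.

A special vertex is represented by a lattice with \<open>L = \<pi>\<^sup>2 L\<^sup>#\<close> or \<open>L = \<pi> L\<^sup>#\<close>. In the first case
\<open>L\<close> is the least of the normalised lattices comparable to it. In the second case it is the greatest,
but \<open>L \<mapsto> \<pi>\<^sup>2 L\<^sup>#\<close> maps \<open>normalised \<pi>\<close> onto \<open>normalised (\<pi>\<^sup>2)\<close> and reverses inclusions, so that
\<open>L\<close> becomes a least element again. Hence it is enough to count around a lattice \<open>N\<close> with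
\<open>N = \<pi> c N\<^sup>#\<close> in \<open>normalised c\<close>.

The quotient of \<open>c N\<^sup>#\<close> by \<open>N\<close> is a symplectic space of dimension \<open>2n\<close> over the residue field, and the
lattices above \<open>N\<close> in \<open>normalised c\<close> are its isotropic subspaces. Since the form is alternating,
every line is isotropic, and there are \<open>1 + q + \<dots> + q\<^bsup>2n-1\<^esup>\<close> lines. For a line \<open>U\<close> the quotient of
\<open>c U\<^sup>#\<close> by \<open>U\<close> has dimension two less, so the maximal flags are counted by induction
(\<open>card_max_flags_from\<close>), and the number of chambers through \<open>N\<close> is the product of these sums over the
dimensions \<open>2, 4, \<dots>, 2n\<close>.

If a chamber through \<open>N\<close> has \<open>U\<close> as its second member, an adjacent chamber that avoids \<open>N\<close> replaces
\<open>N\<close> by a lattice \<open>M\<close> strictly between \<open>\<pi> c U\<^sup>#\<close> and \<open>U\<close>. These two lattices have a two-dimensional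
quotient, all of whose \<open>q + 1\<close> lines are admissible, and \<open>N\<close> is one of them; so each \<open>U\<close>
contributes \<open>q\<close> lattices. Different \<open>U\<close> contribute different lattices, because two of them meet in
\<open>N\<close>, which does not contain \<open>M\<close>.
Hence the number of close vertices is \<open>q\<close> times the number of lines in dimension \<open>2n\<close>
(\<open>card_exchangeable_bottom\<close>). That number of lines is also the last factor in the number of chambers,
whose remaining factors are the number of chambers for \<open>n - 1\<close>.\<close>

section \<open>Counting\<close>

text \<open>Sets of translates rather than an abstract quotient, so that the residue field of the valuation ring
  is literally an instance.\<close>

definition cosets :: "'a::ab_group_add set \<Rightarrow> 'a set \<Rightarrow> 'a set set" where
  "cosets A B = (\<lambda>x. x +o B) ` A"

definition add_closed :: "'a::ab_group_add set \<Rightarrow> bool" where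
  "add_closed B \<longleftrightarrow> 0 \<in> B \<and> (\<forall>x\<in>B. \<forall>y\<in>B. x + y \<in> B) \<and> (\<forall>x\<in>B. - x \<in> B)"

lemma add_closed_add: "add_closed B \<Longrightarrow> x \<in> B \<Longrightarrow> y \<in> B \<Longrightarrow> x + y \<in> B"
  unfolding add_closed_def by blast

lemma add_closed_diff: "add_closed B \<Longrightarrow> x \<in> B \<Longrightarrow> y \<in> B \<Longrightarrow> x - y \<in> B"
  unfolding add_closed_def by (metis diff_conv_add_uminus)

lemma coset_eq_iff:
  assumes "add_closed B"
  shows "x +o B = y +o B \<longleftrightarrow> x - y \<in> B"
proof
  assume "x +o B = y +o B"
  moreover have "x + 0 \<in> x +o B" using assms unfolding elt_set_plus_def add_closed_def by blast
  ultimately obtain b where "b \<in> B" "x + 0 = y + b" unfolding elt_set_plus_def by blast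
  then show "x - y \<in> B" by simp
next
  have sub: "u +o B \<subseteq> v +o B" if "u - v \<in> B" for u v
  proof
    fix z assume "z \<in> u +o B"
    then obtain b where "b \<in> B" "z = u + b" unfolding elt_set_plus_def by blast
    then have "z = v + ((u - v) + b)" "(u - v) + b \<in> B" using that assms
      unfolding add_closed_def by auto
    then show "z \<in> v +o B" unfolding elt_set_plus_def by blast
  qed
  assume "x - y \<in> B"
  moreover then have "y - x \<in> B" using assms unfolding add_closed_def by (metis minus_diff_eq)
  ultimately show "x +o B = y +o B" using sub by blast
qed

lemma coset_zero: "0 +o B = (B :: 'a::ab_group_add set)"
  by (simp add: elt_set_plus_def)

lemma coset_eq_self: "add_closed B \<Longrightarrow> x +o B = B \<longleftrightarrow> x \<in> B"
  using coset_eq_iff[of B x 0] by (simp add: coset_zero)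

text \<open>Both images are in bijection with the classes of \<open>A\<close> under the same relation. This
  computes the index of a subgroup as the number of values of a map with the right fibres.\<close>

lemma card_image_same_kernel:
  assumes "\<And>x y. x \<in> A \<Longrightarrow> y \<in> A \<Longrightarrow> F x = F y \<longleftrightarrow> G x = G y"
  shows "card (F ` A) = card (G ` A)"
proof -
  define h where "h z = G (SOME x. x \<in> A \<and> F x = z)" for z
  have h: "h (F x) = G x" if "x \<in> A" for x
  proof -
    let ?y = "SOME y. y \<in> A \<and> F y = F x"
    have "?y \<in> A \<and> F ?y = F x" by (rule someI[of _ x]) (use that in simp)
    then show ?thesis unfolding h_def using assms that by blast
  qed
  have "inj_on h (F ` A)" by (rule inj_onI) (use h assms in auto)
  moreover have "h ` F ` A = G ` A" using h by (auto simp: image_iff)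
  ultimately show ?thesis by (metis card_image)
qed

lemma card_cosets_mult:
  assumes "add_closed A" "add_closed B" "add_closed C" "C \<subseteq> B" "B \<subseteq> A"
  shows "card (cosets A C) = card (cosets A B) * card (cosets B C)"
proof -
  \<comment> \<open>a choice of representatives of the cosets of the middle group\<close>
  define s where "s X = (SOME x. x \<in> A \<and> x +o B = X)" for X
  have s: "s X \<in> A" "s X +o B = X" if "X \<in> cosets A B" for X
  proof -
    have "\<exists>x. x \<in> A \<and> x +o B = X" using that unfolding cosets_def by blast
    then have "s X \<in> A \<and> s X +o B = X" unfolding s_def by (rule someI_ex)
    then show "s X \<in> A" "s X +o B = X" by auto
  qed
  have tr: "a +o (b +o C) = (a + b) +o C" for a b
    by (auto simp: elt_set_plus_def add.assoc)
  let ?f = "\<lambda>(X, Y). s X +o Y"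
  have "bij_betw ?f (cosets A B \<times> cosets B C) (cosets A C)"
    unfolding bij_betw_def
  proof
    show "inj_on ?f (cosets A B \<times> cosets B C)"
    proof (rule inj_onI, clarify)
      fix X Y X' Y' assume X: "X \<in> cosets A B" "X' \<in> cosets A B" and Y: "Y \<in> cosets B C" "Y' \<in> cosets B C"
        and eq: "s X +o Y = s X' +o Y'"
      from Y obtain b b' where b: "b \<in> B" "b' \<in> B" "Y = b +o C" "Y' = b' +o C"
        unfolding cosets_def by blast
      have d: "(s X + b) - (s X' + b') \<in> C" using eq b assms(3) by (simp add: tr coset_eq_iff)
      have "s X - s X' = ((s X + b) - (s X' + b')) + (b' - b)" by simp
      also have "\<dots> \<in> B"
        using add_closed_add[OF assms(2)] d assms(4) add_closed_diff[OF assms(2) b(2,1)] by (meson subsetD)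
      finally have "s X +o B = s X' +o B" using coset_eq_iff[OF assms(2)] by blast
      then have "X = X'" using s(2)[OF X(1)] s(2)[OF X(2)] by simp
      then show "X = X' \<and> Y = Y'" using d b assms(3) by (simp add: coset_eq_iff)
    qed
    show "?f ` (cosets A B \<times> cosets B C) = cosets A C"
    proof (intro equalityI subsetI)
      fix Z assume "Z \<in> ?f ` (cosets A B \<times> cosets B C)"
      then obtain X b where "X \<in> cosets A B" "b \<in> B" "Z = s X +o (b +o C)"
        unfolding cosets_def by auto
      then have "s X + b \<in> A" "Z = (s X + b) +o C"
        using s(1)[of X] add_closed_add[OF assms(1)] assms(5) tr by blast+
      then show "Z \<in> cosets A C" unfolding cosets_def by blast
    next
      fix Z assume "Z \<in> cosets A C"
      then obtain a where a: "a \<in> A" "Z = a +o C" unfolding cosets_def by blast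
      let ?X = "a +o B"
      have X: "?X \<in> cosets A B" using a unfolding cosets_def by blast
      have "a - s ?X \<in> B" using s(2)[OF X] coset_eq_iff[OF assms(2), of a "s ?X"] by simp
      moreover have "Z = s ?X +o ((a - s ?X) +o C)" using a tr by simp
      ultimately show "Z \<in> ?f ` (cosets A B \<times> cosets B C)" using X unfolding cosets_def by force
    qed
  qed
  then show ?thesis by (metis bij_betw_same_card card_cartesian_product)
qed

lemma card_cosets_eq_1D:
  assumes "add_closed B" "B \<subseteq> A" "card (cosets A B) = 1"
  shows "A = B"
proof -
  have "0 \<in> A" using assms unfolding add_closed_def by blast
  then have "B \<in> cosets A B" unfolding cosets_def using coset_zero by (metis imageI)
  then have "cosets A B = {B}" using assms(3) by (metis card_1_singletonE singletonD)
  then have "x \<in> B" if "x \<in> A" for x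
    using that assms(1) coset_eq_self[of B x] unfolding cosets_def by blast
  then show ?thesis using assms(2) by blast
qed

lemma geometric_sum_nat: "(\<Sum>j<d. q ^ j) * (q - 1) = q ^ d - (1::nat)" if "q \<ge> 1"
proof (induction d)
  case (Suc d)
  have "q ^ d \<ge> 1" using that by simp
  have "(\<Sum>j<Suc d. q ^ j) * (q - 1) = q ^ d - 1 + q ^ d * (q - 1)" using Suc by (simp add: add_mult_distrib)
  also have "\<dots> = q ^ d - 1 + (q ^ Suc d - q ^ d)" by (simp add: diff_mult_distrib2 mult.commute)
  also have "\<dots> = q ^ Suc d - 1" using \<open>q ^ d \<ge> 1\<close> that
    by (metis Nat.add_diff_assoc add.commute add_diff_inverse_nat le_add_diff_inverse mult_le_mono1 nat_mult_1 not_less power_Suc)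
  finally show ?case .
qed simp

text \<open>The number of complete flags of isotropic subspaces in a symplectic space of dimension
  \<open>2m\<close> over a field with \<open>q\<close> elements; the factor for \<open>i\<close> is
  the number of lines in dimension \<open>2i\<close>.\<close>

definition flag_number :: "nat \<Rightarrow> nat \<Rightarrow> nat" where
  "flag_number q m = (\<Prod>i=1..m. \<Sum>j<2*i. q ^ j)"

section \<open>Cliques\<close>

text \<open>Chambers and closeness depend on the vertices and their incidence only. Stated for an arbitrary
  relation, they can be carried along the bijections from vertices to lattices and from lattices to
  their duals.\<close>

definition clique :: "'a set \<Rightarrow> ('a \<Rightarrow> 'a \<Rightarrow> bool) \<Rightarrow> 'a set \<Rightarrow> bool" where
  "clique P R X \<longleftrightarrow> finite X \<and> X \<subseteq> P \<and> pairwise R X"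

definition max_clique :: "'a set \<Rightarrow> ('a \<Rightarrow> 'a \<Rightarrow> bool) \<Rightarrow> 'a set \<Rightarrow> bool" where
  "max_clique P R X \<longleftrightarrow> clique P R X \<and> (\<forall>Y. clique P R Y \<and> X \<subseteq> Y \<longrightarrow> Y = X)"

text \<open>Closeness of vertices, for an arbitrary incidence relation.\<close>

definition exchangeable :: "'a set \<Rightarrow> ('a \<Rightarrow> 'a \<Rightarrow> bool) \<Rightarrow> 'a \<Rightarrow> 'a \<Rightarrow> bool" where
  "exchangeable P R t t' \<longleftrightarrow> (\<exists>X X'. (max_clique P R X \<and> max_clique P R X' \<and>
     (\<exists>F. F \<subseteq> X \<and> F \<subseteq> X' \<and> card X = card F + 1 \<and> card X' = card F + 1)) \<and>
     t \<in> X \<and> t' \<in> X' \<and> t \<notin> X \<inter> X' \<and> t' \<notin> X \<inter> X')"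

lemma subset_of_image_subset:
  assumes "inj_on f P" "X \<subseteq> P" "Z \<subseteq> P" "f ` X \<subseteq> f ` Z"
  shows "X \<subseteq> Z"
  using assms unfolding inj_on_def by blast

lemma clique_image_iff:
  assumes "inj_on f P" "\<forall>x\<in>P. \<forall>y\<in>P. R' (f x) (f y) \<longleftrightarrow> R x y" "X \<subseteq> P"
  shows "clique (f ` P) R' (f ` X) \<longleftrightarrow> clique P R X"
proof -
  have inj: "inj_on f X" using assms inj_on_subset by blast
  have "pairwise R' (f ` X) \<longleftrightarrow> pairwise R X"
    unfolding pairwise_def using assms(2,3) inj by (auto simp: inj_on_def) (metis subsetD)+
  then show ?thesis using assms(3) finite_image_iff[OF inj] unfolding clique_def by auto
qed

lemma max_clique_image_iff:
  assumes "inj_on f P" "\<forall>x\<in>P. \<forall>y\<in>P. R' (f x) (f y) \<longleftrightarrow> R x y" "X \<subseteq> P"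
  shows "max_clique (f ` P) R' (f ` X) \<longleftrightarrow> max_clique P R X"
proof -
  note ci = clique_image_iff[of f P R' R, OF assms(1,2)]
  have "(\<forall>Y. clique (f ` P) R' Y \<and> f ` X \<subseteq> Y \<longrightarrow> Y = f ` X) \<longleftrightarrow>
        (\<forall>Y. clique P R Y \<and> X \<subseteq> Y \<longrightarrow> Y = X)" (is "?l \<longleftrightarrow> ?r")
  proof
    assume l: ?l
    show ?r
    proof (intro allI impI)
      fix Y assume Y: "clique P R Y \<and> X \<subseteq> Y"
      then have "Y \<subseteq> P" unfolding clique_def by blast
      then have "f ` Y = f ` X" using l Y ci[of Y] by blast
      then show "Y = X" using \<open>Y \<subseteq> P\<close> assms(1,3) inj_on_image_eq_iff by metis
    qed
  next
    assume r: ?r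
    show ?l
    proof (intro allI impI)
      fix Y assume Y: "clique (f ` P) R' Y \<and> f ` X \<subseteq> Y"
      then obtain Z where Z: "Z \<subseteq> P" "Y = f ` Z" unfolding clique_def by (meson subset_imageE)
      then have "X \<subseteq> Z" using Y assms(3) subset_of_image_subset[OF assms(1)] by metis
      then show "Y = f ` X" using r Z Y ci[of Z] by blast
    qed
  qed
  then show ?thesis unfolding max_clique_def using ci[OF assms(3)] by simp
qed

lemma max_clique_image_obtain:
  assumes "inj_on f P" "\<forall>x\<in>P. \<forall>y\<in>P. R' (f x) (f y) \<longleftrightarrow> R x y"
    "max_clique (f ` P) R' Y"
  obtains X where "X \<subseteq> P" "max_clique P R X" "Y = f ` X"
proof -
  from assms(3) obtain X where "X \<subseteq> P" "Y = f ` X"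
    unfolding max_clique_def clique_def by (meson subset_imageE)
  then show ?thesis using that max_clique_image_iff[of f P R' R X] assms by blast
qed

lemma card_max_cliques_image:
  assumes "inj_on f P" "\<forall>x\<in>P. \<forall>y\<in>P. R' (f x) (f y) \<longleftrightarrow> R x y" "t \<in> P"
  shows "card {X. max_clique (f ` P) R' X \<and> f t \<in> X} = card {X. max_clique P R X \<and> t \<in> X}"
proof -
  have sub: "X \<subseteq> P" if "max_clique P R X" for X using that unfolding max_clique_def clique_def by blast
  have mem: "f t \<in> f ` X \<longleftrightarrow> t \<in> X" if "X \<subseteq> P" for X using that assms(1,3) inj_on_image_mem_iff by metis
  have "{X. max_clique (f ` P) R' X \<and> f t \<in> X} = (`) f ` {X. max_clique P R X \<and> t \<in> X}"
  proof (intro equalityI subsetI)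
    fix Y assume Y: "Y \<in> {X. max_clique (f ` P) R' X \<and> f t \<in> X}"
    then obtain X where "X \<subseteq> P" "max_clique P R X" "Y = f ` X"
      using max_clique_image_obtain[of f P R' R Y] assms(1,2) by blast
    then show "Y \<in> (`) f ` {X. max_clique P R X \<and> t \<in> X}" using Y mem by blast
  next
    fix Y assume "Y \<in> (`) f ` {X. max_clique P R X \<and> t \<in> X}"
    then obtain X where X: "max_clique P R X" "t \<in> X" "Y = f ` X" by blast
    then show "Y \<in> {X. max_clique (f ` P) R' X \<and> f t \<in> X}"
      using max_clique_image_iff[of f P R' R X] assms(1,2) sub[OF X(1)] by blast
  qed
  moreover have "inj_on ((`) f) {X. max_clique P R X \<and> t \<in> X}"
    by (rule inj_onI) (use sub assms(1) inj_on_image_eq_iff in \<open>metis (no_types, lifting) mem_Collect_eq\<close>)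
  ultimately show ?thesis by (simp add: card_image)
qed

lemma card_exchangeable_image:
  assumes "inj_on f P" "\<forall>x\<in>P. \<forall>y\<in>P. R' (f x) (f y) \<longleftrightarrow> R x y" "t \<in> P"
  shows "card {t'. exchangeable (f ` P) R' (f t) t'} = card {t'. exchangeable P R t t'}"
proof -
  have sub: "X \<subseteq> P" if "max_clique P R X" for X using that unfolding max_clique_def clique_def by blast
  have fin: "finite X" if "max_clique P R X" for X using that unfolding max_clique_def clique_def by blast
  have mem: "f x \<in> f ` X \<longleftrightarrow> x \<in> X" if "X \<subseteq> P" "x \<in> P" for X x
    using that assms(1) inj_on_image_mem_iff by metis
  have cd: "card (f ` X) = card X" if "X \<subseteq> P" for X
    using that assms(1) by (meson card_image inj_on_subset)
  have inP: "t' \<in> P" if "exchangeable P R t t'" for t'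
    using that sub unfolding exchangeable_def by blast
  have "{t'. exchangeable (f ` P) R' (f t) t'} = f ` {t'. exchangeable P R t t'}"
  proof (intro equalityI subsetI)
    fix z assume "z \<in> {t'. exchangeable (f ` P) R' (f t) t'}"
    then obtain Y Y' F where Y: "max_clique (f ` P) R' Y" "max_clique (f ` P) R' Y'"
      "F \<subseteq> Y" "F \<subseteq> Y'" "card Y = card F + 1" "card Y' = card F + 1"
      "f t \<in> Y" "z \<in> Y'" "f t \<notin> Y \<inter> Y'" "z \<notin> Y \<inter> Y'"
      unfolding exchangeable_def by blast
    obtain X where X: "X \<subseteq> P" "max_clique P R X" "Y = f ` X"
      using max_clique_image_obtain[of f P R' R Y] assms(1,2) Y(1) by blast
    obtain X' where X': "X' \<subseteq> P" "max_clique P R X'" "Y' = f ` X'"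
      using max_clique_image_obtain[of f P R' R Y'] assms(1,2) Y(2) by blast
    obtain G where G: "G \<subseteq> X" "F = f ` G" using Y(3) X(3) by (meson subset_imageE)
    have "G \<subseteq> X'" using G X X' Y(4) subset_of_image_subset[OF assms(1)] by (metis order_trans)
    obtain z' where z': "z' \<in> X'" "z = f z'" using Y(8) X'(3) by blast
    have c: "card X = card G + 1" "card X' = card G + 1"
      using Y(5,6) X(3) X'(3) G cd[OF X(1)] cd[OF X'(1)] cd[of G] X(1) by auto
    have e: "t \<in> X" "t \<notin> X'" "z' \<notin> X"
      using mem[OF X(1)] mem[OF X'(1)] Y(7-10) assms(3) z' X'(1) X(3) X'(3) by auto
    have "exchangeable P R t z'" unfolding exchangeable_def
    proof (rule exI[of _ X], rule exI[of _ X'], intro conjI exI[of _ G])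
    qed (use X(2) X'(2) G(1) \<open>G \<subseteq> X'\<close> z'(1) c e in simp_all)
    then show "z \<in> f ` {t'. exchangeable P R t t'}" using z' by blast
  next
    fix z assume "z \<in> f ` {t'. exchangeable P R t t'}"
    then obtain z' where z': "z = f z'" "exchangeable P R t z'" by blast
    then obtain X X' F where X: "max_clique P R X" "max_clique P R X'"
      "F \<subseteq> X" "F \<subseteq> X'" "card X = card F + 1" "card X' = card F + 1"
      "t \<in> X" "z' \<in> X'" "t \<notin> X \<inter> X'" "z' \<notin> X \<inter> X'"
      unfolding exchangeable_def by blast
    note s = sub[OF X(1)] sub[OF X(2)]
    have m: "max_clique (f ` P) R' (f ` X)" "max_clique (f ` P) R' (f ` X')"
      using max_clique_image_iff[of f P R' R] assms(1,2) s X(1,2) by blast+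
    have P: "z' \<in> P" "F \<subseteq> P" using X s by blast+
    have c: "card (f ` X) = card (f ` F) + 1" "card (f ` X') = card (f ` F) + 1"
      using X(5,6) cd[OF s(1)] cd[OF s(2)] cd[OF P(2)] by simp_all
    have e: "f t \<in> f ` X" "z \<in> f ` X'" "f t \<notin> f ` X'" "z \<notin> f ` X"
      using mem[OF s(1)] mem[OF s(2)] X(7-10) assms(3) P(1) z'(1) by auto
    have F: "f ` F \<subseteq> f ` X" "f ` F \<subseteq> f ` X'" using X(3,4) by auto
    have "exchangeable (f ` P) R' (f t) z" unfolding exchangeable_def
    proof (rule exI[of _ "f ` X"], rule exI[of _ "f ` X'"], intro conjI exI[of _ "f ` F"])
    qed (use m c e F in simp_all)
    then show "z \<in> {t'. exchangeable (f ` P) R' (f t) t'}" by blast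
  qed
  moreover have "inj_on f {t'. exchangeable P R t t'}"
    by (rule inj_on_subset[OF assms(1)]) (use inP in blast)
  ultimately show ?thesis by (simp add: card_image)
qed

section \<open>The valuation ring\<close>

context nonarch_local_field
begin

lemma ord_one: "ord 1 = 0"
  using ord_mult[of 1 1] by simp

lemma ord_minus_one: "ord (- 1) = 0"
  using ord_mult[of "-1" "-1"] ord_one by simp

lemma ord_minus: "ord (- x) = ord x"
  by (cases "x = 0") (use ord_mult[of "-1" x] ord_minus_one in auto)

lemma ord_inverse: "x \<noteq> 0 \<Longrightarrow> ord (inverse x) = - ord x"
  using ord_mult[of x "inverse x"] ord_one by simp

lemma ord_divide: "x \<noteq> 0 \<Longrightarrow> y \<noteq> 0 \<Longrightarrow> ord (x / y) = ord x - ord y"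
  using ord_mult[of x "inverse y"] ord_inverse[of y] by (simp add: field_simps)

lemma ord_power: "x \<noteq> 0 \<Longrightarrow> ord (x ^ k) = int k * ord x"
  by (induction k) (simp_all add: ord_one ord_mult algebra_simps)

lemma valuation_ring_iff: "x \<in> \<O> \<longleftrightarrow> x = 0 \<or> 0 \<le> ord x"
  by (simp add: valuation_ring_def)

lemma zero_O [simp]: "0 \<in> \<O>" and one_O [simp]: "1 \<in> \<O>"
  by (simp_all add: valuation_ring_iff ord_one)

lemma add_O: "x \<in> \<O> \<Longrightarrow> y \<in> \<O> \<Longrightarrow> x + y \<in> \<O>"
  using ord_add[of x y] by (cases "x = 0"; cases "y = 0"; cases "x + y = 0") (auto simp: valuation_ring_iff)

lemma mult_O: "x \<in> \<O> \<Longrightarrow> y \<in> \<O> \<Longrightarrow> x * y \<in> \<O>"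
  using ord_mult[of x y] by (cases "x = 0"; cases "y = 0") (auto simp: valuation_ring_iff)

lemma minus_O: "x \<in> \<O> \<Longrightarrow> - x \<in> \<O>"
  by (simp add: valuation_ring_iff ord_minus)

lemma minus_O_iff: "- x \<in> \<O> \<longleftrightarrow> x \<in> \<O>"
  by (simp add: valuation_ring_iff ord_minus)

lemma diff_O: "x \<in> \<O> \<Longrightarrow> y \<in> \<O> \<Longrightarrow> x - y \<in> \<O>"
  using add_O[of x "- y"] minus_O[of y] by simp

lemma sum_O: "(\<And>i. i \<in> I \<Longrightarrow> f i \<in> \<O>) \<Longrightarrow> (\<Sum>i\<in>I. f i) \<in> \<O>"
  by (induction I rule: infinite_finite_induct) (auto intro: add_O)

lemma uniformizer_O: "\<pi> \<in> \<O>"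
  by (simp add: valuation_ring_iff ord_uniformizer)

lemma maximal_ideal_iff: "x \<in> \<pi>\<O> \<longleftrightarrow> x / \<pi> \<in> \<O>"
proof
  assume "x / \<pi> \<in> \<O>"
  moreover have "x = \<pi> * (x / \<pi>)" using uniformizer_nonzero by simp
  ultimately show "x \<in> \<pi>\<O>" unfolding maximal_ideal_def by blast
qed (use uniformizer_nonzero in \<open>auto simp: maximal_ideal_def\<close>)

lemma maximal_ideal_iff_ord: "x \<in> \<pi>\<O> \<longleftrightarrow> x = 0 \<or> 1 \<le> ord x"
proof (cases "x = 0")
  case False
  then show ?thesis using ord_divide[OF False uniformizer_nonzero] uniformizer_nonzero
    by (auto simp: maximal_ideal_iff valuation_ring_iff ord_uniformizer)
qed (simp add: maximal_ideal_iff)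

text \<open>An integral element outside the maximal ideal has order 0.\<close>

lemma unit_divide_O: "x \<in> \<O> \<Longrightarrow> y \<in> \<O> \<Longrightarrow> y \<notin> \<pi>\<O> \<Longrightarrow> x / y \<in> \<O>"
  using ord_divide[of x y] by (cases "x = 0") (auto simp: valuation_ring_iff maximal_ideal_iff_ord)

lemma clear_denominators: "\<exists>k. \<forall>m\<ge>k. \<pi> ^ m * x \<in> \<O>"
proof (cases "x = 0")
  case False
  have "\<pi> ^ m * x \<in> \<O>" if "m \<ge> nat (- ord x)" for m
    using that ord_mult[of "\<pi> ^ m" x] ord_power[of \<pi> m] False uniformizer_nonzero
    by (auto simp: valuation_ring_iff ord_uniformizer)
  then show ?thesis by blast
qed simp

text \<open>The bounds for the single elements have a common upper bound because the family is finite.\<close>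

lemma clear_denominators_finite:
  assumes "finite I"
  shows "\<exists>k. \<forall>i\<in>I. \<pi> ^ k * f i \<in> \<O>"
proof -
  obtain g where g: "\<And>i m. m \<ge> g i \<Longrightarrow> \<pi> ^ m * f i \<in> \<O>"
    using clear_denominators[of "f _"] by metis
  obtain k where "\<forall>i\<in>I. g i \<le> k" using finite_nat_set_iff_bounded_le[of "g ` I"] assms by auto
  then show ?thesis using g by blast
qed

lemma add_closed_maximal_ideal: "add_closed \<pi>\<O>"
  unfolding add_closed_def using add_O minus_O
  by (simp add: maximal_ideal_iff add_divide_distrib del: minus_divide_left add: minus_divide_left[symmetric])

lemma residue_field_cosets: "residue_field = cosets \<O> \<pi>\<O>"
  by (simp add: residue_field_def cosets_def)

lemma q_eq: "q = card (cosets \<O> \<pi>\<O>)"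
  by (simp add: q_def residue_field_cosets)

lemma finite_residue_field: "finite residue_field"
  using finite_residue by (simp add: residue_field_def maximal_ideal_def valuation_ring_def)

lemma one_not_maximal: "1 \<notin> \<pi>\<O>"
  by (simp add: maximal_ideal_iff_ord ord_one)

lemma q_ge_2: "q \<ge> 2"
proof -
  let ?X = "0 +o \<pi>\<O>" and ?Y = "1 +o \<pi>\<O>"
  have "?X \<in> residue_field" "?Y \<in> residue_field"
    unfolding residue_field_def by (rule imageI, simp)+
  then have "card {?X, ?Y} \<le> card residue_field"
    by (intro card_mono[OF finite_residue_field]) blast
  moreover have "?Y \<noteq> ?X"
    using coset_eq_iff[OF add_closed_maximal_ideal, of 1 0] one_not_maximal by (metis diff_zero)
  then have "card {?X, ?Y} = 2" by (intro card_2_iff[THEN iffD2]) metis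
  ultimately show ?thesis unfolding q_def by linarith
qed

end

section \<open>The form\<close>

context symplectic_space
begin

lemma V_zero [simp]: "0 \<in> V" and V_add: "x \<in> V \<Longrightarrow> y \<in> V \<Longrightarrow> x + y \<in> V"
  and V_scale: "x \<in> V \<Longrightarrow> c *s x \<in> V" and V_diff: "x \<in> V \<Longrightarrow> y \<in> V \<Longrightarrow> x - y \<in> V"
  and V_sum: "(\<And>i. i \<in> I \<Longrightarrow> f i \<in> V) \<Longrightarrow> (\<Sum>i\<in>I. f i) \<in> V"
  using subspace_V subspace_0 subspace_add subspace_scale subspace_diff subspace_sum by blast+

lemma form_zero_left: "y \<in> V \<Longrightarrow> \<langle>0, y\<rangle> = 0"
  using form_scale_left[of 0 y 0] by simp

lemma form_zero_right: "y \<in> V \<Longrightarrow> \<langle>y, 0\<rangle> = 0"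
  using form_scale_right[of y 0 0] by simp

lemma form_diff_left: "x \<in> V \<Longrightarrow> y \<in> V \<Longrightarrow> z \<in> V \<Longrightarrow> \<langle>x - y, z\<rangle> = \<langle>x, z\<rangle> - \<langle>y, z\<rangle>"
  using form_add_left[of "x - y" y z] V_diff by simp

lemma form_sum_left:
  assumes "\<And>i. i \<in> I \<Longrightarrow> f i \<in> V" "y \<in> V"
  shows "\<langle>\<Sum>i\<in>I. f i, y\<rangle> = (\<Sum>i\<in>I. \<langle>f i, y\<rangle>)"
  using assms by (induction I rule: infinite_finite_induct) (auto simp: form_zero_left form_add_left V_sum)

lemma form_swap: "x \<in> V \<Longrightarrow> y \<in> V \<Longrightarrow> \<langle>y, x\<rangle> = - \<langle>x, y\<rangle>"
  using form_alternating[of "x + y"] form_alternating[of x] form_alternating[of y]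
  by (simp add: form_add_left form_add_right V_add add_eq_0_iff2)

text \<open>Double annihilators: by induction on \<open>T\<close>, either the new vector \<open>t\<close> adds
  no condition, or subtracting a multiple of \<open>t\<close> from \<open>b\<close> reduces to the
  smaller set.\<close>

lemma in_span_if_kernel:
  assumes "finite T" "T \<subseteq> V" "b \<in> V" "\<And>y. y \<in> V \<Longrightarrow> \<forall>t\<in>T. \<langle>t, y\<rangle> = 0 \<Longrightarrow> \<langle>b, y\<rangle> = 0"
  shows "b \<in> span T"
  using assms
proof (induction T arbitrary: b rule: finite_induct)
  case empty
  then show ?case using form_nondegenerate[of b] span_zero by auto
next
  case (insert t T)
  show ?case
  proof (cases "\<exists>y0\<in>V. (\<forall>s\<in>T. \<langle>s, y0\<rangle> = 0) \<and> \<langle>t, y0\<rangle> \<noteq> 0")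
    case True
    then obtain y0 where y0: "y0 \<in> V" "\<forall>s\<in>T. \<langle>s, y0\<rangle> = 0" "\<langle>t, y0\<rangle> \<noteq> 0" by blast
    let ?a = "\<langle>b, y0\<rangle> / \<langle>t, y0\<rangle>"
    have t: "t \<in> V" "T \<subseteq> V" using insert.prems by auto
    have "b - ?a *s t \<in> span T"
    proof (rule insert.IH)
      show "T \<subseteq> V" "b - ?a *s t \<in> V" using t insert.prems V_diff V_scale by auto
      fix y assume y: "y \<in> V" "\<forall>s\<in>T. \<langle>s, y\<rangle> = 0"
      let ?c = "\<langle>t, y\<rangle> / \<langle>t, y0\<rangle>"
      have yy: "y - ?c *s y0 \<in> V" using y y0 V_diff V_scale by auto
      have f: "\<langle>s, y - ?c *s y0\<rangle> = \<langle>s, y\<rangle> - ?c * \<langle>s, y0\<rangle>" if "s \<in> V" for s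
        using form_add_right[of s "y - ?c *s y0" "?c *s y0"] form_scale_right[of s y0 ?c] that y y0 yy V_scale
        by simp
      have "\<forall>s\<in>insert t T. \<langle>s, y - ?c *s y0\<rangle> = 0"
        using f t y y0 by auto
      then have "\<langle>b, y - ?c *s y0\<rangle> = 0" using insert.prems(3)[OF yy] by blast
      then have "\<langle>b, y\<rangle> = ?c * \<langle>b, y0\<rangle>" using f[of b] insert.prems by simp
      then show "\<langle>b - ?a *s t, y\<rangle> = 0"
        using form_diff_left[of b "?a *s t" y] form_scale_left[of t y ?a] insert.prems t y V_scale by simp
    qed
    then have "b - ?a *s t \<in> span (insert t T)" using span_mono[of T "insert t T"] by auto
    moreover have "?a *s t \<in> span (insert t T)" using span_scale span_base by auto
    ultimately have "(b - ?a *s t) + ?a *s t \<in> span (insert t T)" by (rule span_add)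
    then show ?thesis by simp
  next
    case False
    have "b \<in> span T"
    proof (rule insert.IH)
      fix y assume y: "y \<in> V" "\<forall>s\<in>T. \<langle>s, y\<rangle> = 0"
      then have "\<forall>s\<in>insert t T. \<langle>s, y\<rangle> = 0" using False by blast
      then show "\<langle>b, y\<rangle> = 0" using insert.prems y by blast
    qed (use insert.prems in auto)
    then show ?thesis using span_mono[of T "insert t T"] by auto
  qed
qed

lemma independent_dual_vector:
  assumes "independent S" "finite S" "S \<subseteq> V" "b \<in> S"
  obtains y where "y \<in> V" "\<forall>s\<in>S. \<langle>s, y\<rangle> = (if s = b then 1 else 0)"
proof -
  have "b \<notin> span (S - {b})" using assms(1,4) unfolding dependent_def by blast
  then obtain y where y: "y \<in> V" "\<forall>s\<in>S - {b}. \<langle>s, y\<rangle> = 0" "\<langle>b, y\<rangle> \<noteq> 0"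
    using in_span_if_kernel[of "S - {b}" b] assms(2-4) by blast
  let ?y = "inverse \<langle>b, y\<rangle> *s y"
  have "\<langle>s, ?y\<rangle> = (if s = b then 1 else 0)" if "s \<in> S" for s
    using form_scale_right[of s y "inverse \<langle>b, y\<rangle>"] that y assms(3) by auto
  then show ?thesis using that[of ?y] y(1) V_scale by blast
qed

text \<open>A vector outside the span would enlarge \<open>S\<close> to an independent set with more elements
  than the dimension.\<close>

lemma span_full_basis:
  assumes "independent S" "S \<subseteq> V" "card S = 2 * n" "finite S"
  shows "span S = V"
proof
  show "span S \<subseteq> V" using assms(2) subspace_V span_minimal by blast
  obtain B where B: "B \<subseteq> V" "independent B" "V \<subseteq> span B" "card B = dim V" using basis_exists by blast
  then have "finite B" using dim_V n_pos by (metis card.infinite mult_eq_0_iff not_one_le_zero zero_neq_numeral)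
  show "V \<subseteq> span S"
  proof
    fix v assume v: "v \<in> V"
    show "v \<in> span S"
    proof (rule ccontr)
      assume "v \<notin> span S"
      then have "independent (insert v S)" "v \<notin> S" using assms(1) independent_insert span_base by auto
      moreover have "insert v S \<subseteq> span B" using v assms(2) B by auto
      ultimately have "card (insert v S) \<le> card B" using independent_span_bound[OF \<open>finite B\<close>] by blast
      then show False using \<open>v \<notin> S\<close> assms(3,4) B(4) dim_V by simp
    qed
  qed
qed

section \<open>Lattices in coordinates\<close>

text \<open>The second family is dual, for the form, to the basis given by the first. Indexing by numbers
  instead of by a set of vectors lets a basis vector be replaced and the roles of the two families be
  exchanged.\<close>

definition dual_families :: "(nat \<Rightarrow> 'v) \<Rightarrow> (nat \<Rightarrow> 'v) \<Rightarrow> bool" where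
  "dual_families e d \<longleftrightarrow> (\<forall>i<2*n. e i \<in> V \<and> d i \<in> V) \<and>
     (\<forall>i<2*n. \<forall>j<2*n. \<langle>e i, d j\<rangle> = (if i = j then 1 else 0))"

definition coordinate_lattice :: "(nat \<Rightarrow> 'v) \<Rightarrow> 'v set" where
  "coordinate_lattice d = {x \<in> V. \<forall>i<2*n. \<langle>x, d i\<rangle> \<in> \<O>}"

lemma dual_families_independent:
  assumes "dual_families e d"
  shows "inj_on e {..<2*n}" "independent (e ` {..<2*n})"
proof -
  show inj: "inj_on e {..<2*n}"
    by (rule inj_onI) (use assms in \<open>unfold dual_families_def, metis lessThan_iff zero_neq_one\<close>)
  show "independent (e ` {..<2*n})"
  proof
    assume "dependent (e ` {..<2*n})"
    then obtain u where u: "\<exists>v\<in>e ` {..<2*n}. u v \<noteq> 0" "(\<Sum>v\<in>e ` {..<2*n}. u v *s v) = 0"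
      using dependent_finite[of "e ` {..<2*n}"] by auto
    then have z: "(\<Sum>i<2*n. u (e i) *s e i) = 0" using sum.reindex[OF inj, of "\<lambda>v. u v *s v"] by simp
    have "u (e j) = 0" if j: "j < 2*n" for j
    proof -
      have "0 = \<langle>\<Sum>i<2*n. u (e i) *s e i, d j\<rangle>" using z form_zero_left assms j unfolding dual_families_def by auto
      also have "\<dots> = (\<Sum>i<2*n. u (e i) * \<langle>e i, d j\<rangle>)"
        using assms j unfolding dual_families_def by (subst form_sum_left) (auto simp: V_scale form_scale_left)
      also have "\<dots> = (\<Sum>i<2*n. if i = j then u (e i) else 0)"
        by (rule sum.cong) (use assms j in \<open>auto simp: dual_families_def\<close>)
      also have "\<dots> = u (e j)" using j by simp
      finally show ?thesis by simp
    qed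
    then show False using u(1) by auto
  qed
qed

lemma form_combination:
  assumes "dual_families e d" "j < 2*n"
  shows "\<langle>\<Sum>i<2*n. c i *s e i, d j\<rangle> = c j"
proof -
  have "\<langle>\<Sum>i<2*n. c i *s e i, d j\<rangle> = (\<Sum>i<2*n. c i * \<langle>e i, d j\<rangle>)"
    using assms unfolding dual_families_def by (subst form_sum_left) (auto simp: V_scale form_scale_left)
  also have "\<dots> = (\<Sum>i<2*n. if i = j then c i else 0)"
    by (rule sum.cong) (use assms in \<open>auto simp: dual_families_def\<close>)
  finally show ?thesis using assms(2) by simp
qed

text \<open>An independent family of the full size spans, and pairing with the dual family reads off the
  coefficients.\<close>

lemma dual_families_expand:
  assumes "dual_families e d" "x \<in> V"
  shows "x = (\<Sum>i<2*n. \<langle>x, d i\<rangle> *s e i)"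
proof -
  note di = dual_families_independent[OF assms(1)]
  have "e ` {..<2*n} \<subseteq> V" using assms(1) unfolding dual_families_def by auto
  moreover have "card (e ` {..<2*n}) = 2 * n" using di(1) by (simp add: card_image)
  ultimately have "x \<in> span (e ` {..<2*n})" using span_full_basis di(2) assms(2) by simp
  then obtain u where "x = (\<Sum>v\<in>e ` {..<2*n}. u v *s v)" using span_finite[of "e ` {..<2*n}"] by auto
  then have x: "x = (\<Sum>i<2*n. u (e i) *s e i)" using sum.reindex[OF di(1), of "\<lambda>v. u v *s v"] by simp
  have "\<langle>x, d j\<rangle> = u (e j)" if "j < 2*n" for j
    using form_combination[OF assms(1) that, of "\<lambda>i. u (e i)"] x by simp
  then have "(\<Sum>i<2*n. \<langle>x, d i\<rangle> *s e i) = (\<Sum>i<2*n. u (e i) *s e i)" by (intro sum.cong) auto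
  then show ?thesis by (rule trans[OF x sym])
qed

lemma coordinate_lattice_eq_span:
  assumes "dual_families e d"
  shows "coordinate_lattice d = {(\<Sum>i<2*n. c i *s e i) | c. \<forall>i<2*n. c i \<in> \<O>}"
proof (intro equalityI subsetI)
  fix x assume "x \<in> coordinate_lattice d"
  then show "x \<in> {(\<Sum>i<2*n. c i *s e i) | c. \<forall>i<2*n. c i \<in> \<O>}"
    using dual_families_expand[OF assms, of x] unfolding coordinate_lattice_def
    by (intro CollectI exI[of _ "\<lambda>i. \<langle>x, d i\<rangle>"]) auto
next
  fix x assume "x \<in> {(\<Sum>i<2*n. c i *s e i) | c. \<forall>i<2*n. c i \<in> \<O>}"
  then obtain c where c: "x = (\<Sum>i<2*n. c i *s e i)" "\<forall>i<2*n. c i \<in> \<O>" by blast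
  have "x \<in> V" unfolding c(1) using assms by (intro V_sum V_scale) (auto simp: dual_families_def)
  then show "x \<in> coordinate_lattice d"
    using form_combination[OF assms, of _ c] c unfolding coordinate_lattice_def by simp
qed

lemma O_independent_imp_independent:
  assumes "\<O>_independent S" "finite S"
  shows "independent S"
proof
  assume "dependent S"
  then obtain u where u: "\<exists>v\<in>S. u v \<noteq> 0" "(\<Sum>v\<in>S. u v *s v) = 0" using dependent_finite[OF assms(2)] by auto
  obtain k where k: "\<forall>v\<in>S. \<pi> ^ k * u v \<in> \<O>" using clear_denominators_finite[OF assms(2)] by blast
  have "(\<Sum>v\<in>S. (\<pi> ^ k * u v) *s v) = \<pi> ^ k *s (\<Sum>v\<in>S. u v *s v)" by (simp add: scale_sum_right)
  also have "\<dots> = 0" using u by simp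
  finally have "\<forall>v\<in>S. \<pi> ^ k * u v = 0" using assms(1)[unfolded \<O>_independent_def] k
    by (elim allE[of _ "\<lambda>v. \<pi> ^ k * u v"]) blast
  then show False using u(1) uniformizer_nonzero by auto
qed

text \<open>By nondegeneracy every basis of a lattice has a dual family. In this description duals, multiples
  and small extensions of lattices are lattices because a new pair of dual families can be written
  down.\<close>

lemma lattice_iff: "lattice L \<longleftrightarrow> (\<exists>e d. dual_families e d \<and> L = coordinate_lattice d)"
proof
  assume "lattice L"
  then obtain S where S: "S \<subseteq> V" "finite S" "card S = 2 * n" "\<O>_independent S" "L = \<O>_span S"
    unfolding lattice_def by blast
  have ind: "independent S" using S O_independent_imp_independent by blast
  obtain e where e: "bij_betw e {..<2*n} S"
    using ex_bij_betw_nat_finite[OF S(2)] S(3) by (metis atLeast0LessThan)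
  have "\<forall>i\<in>{..<2*n}. \<exists>y. y \<in> V \<and> (\<forall>s\<in>S. \<langle>s, y\<rangle> = (if s = e i then 1 else 0))"
    using independent_dual_vector[OF ind S(2,1)] e by (metis bij_betwE)
  then obtain d where d: "\<And>i. i < 2*n \<Longrightarrow> d i \<in> V"
    "\<And>i s. i < 2*n \<Longrightarrow> s \<in> S \<Longrightarrow> \<langle>s, d i\<rangle> = (if s = e i then 1 else 0)"
    by (metis lessThan_iff)
  have eS: "e i \<in> S" if "i < 2*n" for i using e that by (auto dest: bij_betwE)
  have eq: "e i = e j \<longleftrightarrow> i = j" if "i < 2*n" "j < 2*n" for i j
    using e that by (auto simp: bij_betw_def inj_on_def)
  have df: "dual_families e d" unfolding dual_families_def using d eS eq S(1) by auto
  have r: "(\<Sum>b\<in>S. c b *s b) = (\<Sum>i<2*n. c (e i) *s e i)" for c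
    using sum.reindex_bij_betw[OF e, of "\<lambda>b. c b *s b"] by simp
  have "L = {(\<Sum>i<2*n. c i *s e i) | c. \<forall>i<2*n. c i \<in> \<O>}"
  proof (intro equalityI subsetI)
    fix x assume "x \<in> L"
    then obtain c where c: "\<forall>b\<in>S. c b \<in> \<O>" "x = (\<Sum>b\<in>S. c b *s b)" using S(5) unfolding \<O>_span_def by blast
    have "x = (\<Sum>i<2*n. c (e i) *s e i)" using c r by simp
    moreover have "\<forall>i<2*n. c (e i) \<in> \<O>" using c eS by simp
    ultimately show "x \<in> {(\<Sum>i<2*n. c i *s e i) | c. \<forall>i<2*n. c i \<in> \<O>}"
      by (intro CollectI exI[of _ "\<lambda>i. c (e i)"]) auto
  next
    fix x assume "x \<in> {(\<Sum>i<2*n. c i *s e i) | c. \<forall>i<2*n. c i \<in> \<O>}"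
    then obtain c where c: "x = (\<Sum>i<2*n. c i *s e i)" "\<forall>i<2*n. c i \<in> \<O>" by blast
    let ?c = "\<lambda>b. c (the_inv_into {..<2*n} e b)"
    have inv: "the_inv_into {..<2*n} e (e i) = i" if "i < 2*n" for i
      using e that by (intro the_inv_into_f_f) (auto simp: bij_betw_def)
    have "(\<Sum>b\<in>S. ?c b *s b) = x" unfolding r c(1) using inv by (intro sum.cong) auto
    moreover have "\<forall>b\<in>S. ?c b \<in> \<O>" using e inv c(2) by (auto simp: bij_betw_def)
    ultimately show "x \<in> L" unfolding S(5) \<O>_span_def
      by (intro CollectI exI[of _ ?c]) auto
  qed
  then show "\<exists>e d. dual_families e d \<and> L = coordinate_lattice d"
    using df coordinate_lattice_eq_span[OF df] by blast
next
  assume "\<exists>e d. dual_families e d \<and> L = coordinate_lattice d"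
  then obtain e d where df: "dual_families e d" and L: "L = coordinate_lattice d" by blast
  note di = dual_families_independent[OF df]
  let ?S = "e ` {..<2*n}"
  have r: "(\<Sum>b\<in>?S. c b *s b) = (\<Sum>i<2*n. c (e i) *s e i)" for c
    using sum.reindex[OF di(1), of "\<lambda>v. c v *s v"] by simp
  have oi: "\<O>_independent ?S" unfolding \<O>_independent_def
  proof (intro allI impI)
    fix c assume c: "(\<forall>b\<in>?S. c b \<in> \<O>) \<and> (\<Sum>b\<in>?S. c b *s b) = 0"
    then have "\<langle>\<Sum>i<2*n. c (e i) *s e i, d j\<rangle> = 0" if "j < 2*n" for j
      using r form_zero_left df that unfolding dual_families_def by auto
    then show "\<forall>b\<in>?S. c b = 0" using form_combination[OF df, of _ "\<lambda>i. c (e i)"] by auto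
  qed
  have "L = \<O>_span ?S" unfolding L coordinate_lattice_eq_span[OF df] \<O>_span_def r
  proof (intro equalityI subsetI)
    fix x assume "x \<in> {(\<Sum>i<2*n. c i *s e i) | c. \<forall>i<2*n. c i \<in> \<O>}"
    then obtain c where c: "x = (\<Sum>i<2*n. c i *s e i)" "\<forall>i<2*n. c i \<in> \<O>" by blast
    let ?c = "\<lambda>b. c (the_inv_into {..<2*n} e b)"
    have inv: "the_inv_into {..<2*n} e (e i) = i" if "i < 2*n" for i
      using di(1) that by (intro the_inv_into_f_f) auto
    have "x = (\<Sum>i<2*n. ?c (e i) *s e i)" unfolding c(1) using inv by (intro sum.cong) auto
    moreover have "\<forall>b\<in>?S. ?c b \<in> \<O>" using inv c(2) by auto
    ultimately show "x \<in> {(\<Sum>i<2*n. c (e i) *s e i) | c. \<forall>b\<in>?S. c b \<in> \<O>}"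
      by (intro CollectI exI[of _ ?c] conjI)
  next
    fix x assume "x \<in> {(\<Sum>i<2*n. c (e i) *s e i) | c. \<forall>b\<in>?S. c b \<in> \<O>}"
    then obtain c where "x = (\<Sum>i<2*n. c (e i) *s e i)" "\<forall>i<2*n. c (e i) \<in> \<O>" by auto
    then show "x \<in> {(\<Sum>i<2*n. c i *s e i) | c. \<forall>i<2*n. c i \<in> \<O>}"
      by (intro CollectI exI[of _ "\<lambda>i. c (e i)"]) auto
  qed
  moreover have "?S \<subseteq> V" using df unfolding dual_families_def by auto
  moreover have "card ?S = 2 * n" using di(1) by (simp add: card_image)
  ultimately show "lattice L" unfolding lattice_def using oi by blast
qed

lemma form_diff_right: "x \<in> V \<Longrightarrow> y \<in> V \<Longrightarrow> z \<in> V \<Longrightarrow> \<langle>x, y - z\<rangle> = \<langle>x, y\<rangle> - \<langle>x, z\<rangle>"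
  using form_add_right[of x "y - z" z] V_diff by simp

section \<open>Submodules, scaling and duality\<close>

definition submodule :: "'v set \<Rightarrow> bool" where
  "submodule A \<longleftrightarrow> A \<subseteq> V \<and> 0 \<in> A \<and> (\<forall>x\<in>A. \<forall>y\<in>A. x + y \<in> A) \<and> (\<forall>a\<in>\<O>. \<forall>x\<in>A. a *s x \<in> A)"

text \<open>The multiple by \<open>c\<close> of the usual dual lattice. Keeping the factor in the definition
  makes \<open>dual c\<close> an involution on lattices for every nonzero \<open>c\<close>.\<close>

definition dual :: "'k \<Rightarrow> 'v set \<Rightarrow> 'v set" where
  "dual c L = {x \<in> V. \<forall>y\<in>L. \<langle>x, y\<rangle> / c \<in> \<O>}"

definition extend :: "'v set \<Rightarrow> 'v \<Rightarrow> 'v set" where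
  "extend L x = {l + a *s x | l a. l \<in> L \<and> a \<in> \<O>}"

lemma submodule_V: "submodule A \<Longrightarrow> x \<in> A \<Longrightarrow> x \<in> V"
  and submodule_add: "submodule A \<Longrightarrow> x \<in> A \<Longrightarrow> y \<in> A \<Longrightarrow> x + y \<in> A"
  and submodule_scale: "submodule A \<Longrightarrow> a \<in> \<O> \<Longrightarrow> x \<in> A \<Longrightarrow> a *s x \<in> A"
  and submodule_zero: "submodule A \<Longrightarrow> 0 \<in> A"
  unfolding submodule_def by blast+

lemma submodule_uminus: "submodule A \<Longrightarrow> x \<in> A \<Longrightarrow> - x \<in> A"
  using submodule_scale[of A "-1" x] minus_O[of 1] by simp

lemma submodule_diff: "submodule A \<Longrightarrow> x \<in> A \<Longrightarrow> y \<in> A \<Longrightarrow> x - y \<in> A"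
  using submodule_add[of A x "- y"] submodule_uminus[of A y] by simp

lemma submodule_add_closed: "submodule A \<Longrightarrow> add_closed A"
  unfolding add_closed_def using submodule_zero submodule_add submodule_uminus by blast

lemma lattice_submodule:
  assumes "lattice L"
  shows "submodule L"
proof -
  obtain e d where df: "dual_families e d" and L: "L = coordinate_lattice d"
    using assms lattice_iff by blast
  have d: "d i \<in> V" if "i < 2*n" for i using df that unfolding dual_families_def by blast
  show ?thesis unfolding submodule_def L coordinate_lattice_def
    using d by (auto simp: form_zero_left form_add_left form_scale_left V_add V_scale intro: add_O mult_O)
qed

lemma lattice_subset_V: "lattice L \<Longrightarrow> L \<subseteq> V"
  using lattice_submodule[of L] unfolding submodule_def by blast

lemma mem_scaled_iff: "a \<noteq> 0 \<Longrightarrow> x \<in> scaled a A \<longleftrightarrow> inverse a *s x \<in> A"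
proof
  assume a: "a \<noteq> 0" and "inverse a *s x \<in> A"
  then have "a *s (inverse a *s x) \<in> scaled a A" unfolding scaled_def by blast
  then show "x \<in> scaled a A" using a by simp
qed (auto simp: scaled_def)

lemma scaled_scaled: "scaled a (scaled b A) = scaled (a * b) A"
  by (auto simp: scaled_def image_image)

lemma scaled_one: "scaled 1 A = A"
  by (simp add: scaled_def)

lemma scaled_mono: "A \<subseteq> B \<Longrightarrow> scaled a A \<subseteq> scaled a B"
  unfolding scaled_def by blast

lemma scaled_subset_swap: "a \<noteq> 0 \<Longrightarrow> scaled a A \<subseteq> B \<longleftrightarrow> A \<subseteq> scaled (inverse a) B"
  using scaled_mono[of "scaled a A" B "inverse a"] scaled_mono[of A "scaled (inverse a) B" a]
  by (auto simp: scaled_scaled scaled_one)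

lemma scaled_O_subset: "submodule A \<Longrightarrow> a \<in> \<O> \<Longrightarrow> scaled a A \<subseteq> A"
  unfolding scaled_def using submodule_scale by blast

lemma scaled_unit: "submodule A \<Longrightarrow> a \<noteq> 0 \<Longrightarrow> ord a = 0 \<Longrightarrow> scaled a A = A"
  using scaled_O_subset[of A a] scaled_O_subset[of A "inverse a"] scaled_subset_swap[of a A A]
    scaled_subset_swap[of "inverse a" A A] ord_inverse[of a]
  by (auto simp: valuation_ring_iff)

lemma dual_families_scaled:
  "dual_families e d \<Longrightarrow> a \<noteq> 0 \<Longrightarrow> dual_families (\<lambda>i. a *s e i) (\<lambda>i. inverse a *s d i)"
  unfolding dual_families_def by (auto simp: V_scale form_scale_left form_scale_right)

lemma lattice_scaled:
  assumes "lattice L" "a \<noteq> 0"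
  shows "lattice (scaled a L)"
proof -
  obtain e d where df: "dual_families e d" and L: "L = coordinate_lattice d"
    using assms lattice_iff by blast
  have d: "d i \<in> V" if "i < 2*n" for i using df that unfolding dual_families_def by blast
  have V: "inverse a *s x \<in> V \<longleftrightarrow> x \<in> V" for x
    using V_scale[of x "inverse a"] V_scale[of "inverse a *s x" a] assms(2) by auto
  have "scaled a L = coordinate_lattice (\<lambda>i. inverse a *s d i)"
    unfolding L coordinate_lattice_def
    using assms(2) d by (auto simp: mem_scaled_iff V form_scale_left form_scale_right)
  then show ?thesis using lattice_iff dual_families_scaled[OF df assms(2)] by blast
qed

lemma form_in_coordinates:
  assumes "dual_families e d" "x \<in> V" "y \<in> V"
  shows "\<langle>x, y\<rangle> = (\<Sum>i<2*n. \<langle>y, d i\<rangle> * \<langle>x, e i\<rangle>)"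
proof -
  have e: "e i \<in> V" if "i < 2*n" for i using assms(1) that unfolding dual_families_def by blast
  have "\<langle>y, x\<rangle> = \<langle>\<Sum>i<2*n. \<langle>y, d i\<rangle> *s e i, x\<rangle>" using dual_families_expand[OF assms(1,3)] by simp
  also have "\<dots> = (\<Sum>i<2*n. \<langle>y, d i\<rangle> * \<langle>e i, x\<rangle>)"
    using e assms(2) by (subst form_sum_left) (auto simp: V_scale form_scale_left)
  also have "\<dots> = (\<Sum>i<2*n. - (\<langle>y, d i\<rangle> * \<langle>x, e i\<rangle>))"
    by (rule sum.cong) (use form_swap[OF assms(2) e] in auto)
  finally show ?thesis using form_swap[OF assms(3,2)] by (simp add: sum_negf)
qed

lemma coordinate_lattice_basis:
  "dual_families e d \<Longrightarrow> i < 2*n \<Longrightarrow> e i \<in> coordinate_lattice d"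
  unfolding dual_families_def coordinate_lattice_def by auto

text \<open>Up to the factors that \<open>c\<close> requires, the two families exchange their roles; the sign
  comes from the antisymmetry of the form.\<close>

lemma dual_coordinate_lattice:
  assumes df: "dual_families e d" and c: "c \<noteq> 0"
  shows "dual c (coordinate_lattice d) = coordinate_lattice (\<lambda>i. - inverse c *s e i)"
    "dual_families (\<lambda>i. c *s d i) (\<lambda>i. - inverse c *s e i)"
proof -
  have V: "e i \<in> V" "d i \<in> V" if "i < 2*n" for i using df that unfolding dual_families_def by auto
  have v: "\<langle>x, - inverse c *s e i\<rangle> \<in> \<O> \<longleftrightarrow> \<langle>x, e i\<rangle> / c \<in> \<O>" if "x \<in> V" "i < 2*n" for x i
    using form_scale_right[of x "e i" "- inverse c"] that V minus_O_iff[of "\<langle>x, e i\<rangle> / c"]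
    by (simp add: field_simps)
  show "dual c (coordinate_lattice d) = coordinate_lattice (\<lambda>i. - inverse c *s e i)"
  proof (intro equalityI subsetI)
    fix x assume "x \<in> dual c (coordinate_lattice d)"
    then show "x \<in> coordinate_lattice (\<lambda>i. - inverse c *s e i)"
      using coordinate_lattice_basis[OF df] v unfolding dual_def
      by (subst coordinate_lattice_def) blast
  next
    fix x assume "x \<in> coordinate_lattice (\<lambda>i. - inverse c *s e i)"
    then have x: "x \<in> V" "\<And>i. i < 2*n \<Longrightarrow> \<langle>x, e i\<rangle> / c \<in> \<O>"
      using v unfolding coordinate_lattice_def by auto
    have "\<langle>x, y\<rangle> / c \<in> \<O>" if y: "y \<in> coordinate_lattice d" for y
    proof -
      have "\<langle>x, y\<rangle> / c = (\<Sum>i<2*n. \<langle>y, d i\<rangle> * (\<langle>x, e i\<rangle> / c))"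
        using form_in_coordinates[OF df x(1), of y] y unfolding coordinate_lattice_def
        by (simp add: sum_divide_distrib)
      also have "\<dots> \<in> \<O>" using x y unfolding coordinate_lattice_def by (intro sum_O mult_O) auto
      finally show ?thesis .
    qed
    then show "x \<in> dual c (coordinate_lattice d)" using x(1) unfolding dual_def by blast
  qed
  show "dual_families (\<lambda>i. c *s d i) (\<lambda>i. - inverse c *s e i)"
    unfolding dual_families_def
  proof (intro conjI allI impI)
    fix i j assume ij: "i < 2*n" "j < 2*n"
    have "\<langle>c *s d i, - inverse c *s e j\<rangle> = c * (- inverse c * \<langle>d i, e j\<rangle>)"
      by (simp only: form_scale_left[OF V(2)[OF ij(1)] V_scale[OF V(1)[OF ij(2)]]]
          form_scale_right[OF V(2)[OF ij(1)] V(1)[OF ij(2)]])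
    also have "\<dots> = - \<langle>d i, e j\<rangle>" using c by simp
    also have "\<dots> = \<langle>e j, d i\<rangle>" using form_swap[of "d i" "e j"] V ij by simp
    finally show "\<langle>c *s d i, - inverse c *s e j\<rangle> = (if i = j then 1 else 0)"
      using df ij unfolding dual_families_def by auto
  qed (use V V_scale[of _ c] V_scale[of _ "- inverse c"] in auto)
qed

lemma lattice_dual: "lattice L \<Longrightarrow> c \<noteq> 0 \<Longrightarrow> lattice (dual c L)"
  using lattice_iff dual_coordinate_lattice by metis

lemma dual_subset_V: "dual c L \<subseteq> V"
  by (auto simp: dual_def)

lemma dual_antimono: "L \<subseteq> M \<Longrightarrow> dual c M \<subseteq> dual c L"
  by (auto simp: dual_def)

text \<open>Exchanging the roles of the two families twice returns the original lattice, up to a sign.\<close>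

lemma dual_dual:
  assumes "lattice L" "c \<noteq> 0"
  shows "dual c (dual c L) = L"
proof
  obtain e d where df: "dual_families e d" and L: "L = coordinate_lattice d"
    using assms lattice_iff by blast
  have d: "d i \<in> V" if "i < 2*n" for i using df that unfolding dual_families_def by blast
  note 1 = dual_coordinate_lattice[OF df assms(2)]
  note 2 = dual_coordinate_lattice(1)[OF 1(2) assms(2)]
  have "dual c (dual c L) = coordinate_lattice (\<lambda>i. - inverse c *s c *s d i)"
    unfolding L 1(1) 2 ..
  also have "\<dots> = coordinate_lattice (\<lambda>i. (- 1) *s d i)" using assms(2) by simp
  also have "\<dots> = L" unfolding L coordinate_lattice_def
    using d form_scale_right[of _ _ "- 1"] by (auto simp: minus_O_iff)
  finally show "dual c (dual c L) \<subseteq> L" "L \<subseteq> dual c (dual c L)" by auto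
qed

lemma dual_subset_iff:
  "lattice L \<Longrightarrow> lattice M \<Longrightarrow> c \<noteq> 0 \<Longrightarrow> dual c L \<subseteq> dual c M \<longleftrightarrow> M \<subseteq> L"
  using dual_antimono[of M L c] dual_antimono[of "dual c L" "dual c M" c] dual_dual by auto

lemma dual_mult:
  assumes "a \<noteq> 0" "L \<subseteq> V"
  shows "dual (a * c) L = scaled a (dual c L)"
proof -
  have V: "inverse a *s x \<in> V \<longleftrightarrow> x \<in> V" for x
    using V_scale[of x "inverse a"] V_scale[of "inverse a *s x" a] assms(1) by auto
  have "\<langle>inverse a *s x, y\<rangle> / c = \<langle>x, y\<rangle> / (a * c)" if "x \<in> V" "y \<in> L" for x y
    using form_scale_left[of x y "inverse a"] that assms(2) by (auto simp: field_simps)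
  then show ?thesis using assms(1) by (auto simp: mem_scaled_iff dual_def V)
qed

lemma dual_scaled:
  assumes "a \<noteq> 0" "L \<subseteq> V"
  shows "dual c (scaled a L) = scaled (inverse a) (dual c L)"
proof -
  have f: "\<langle>x, a *s y\<rangle> / c = \<langle>a *s x, y\<rangle> / c" if "x \<in> V" "y \<in> L" for x y
    using form_scale_right[of x y a] form_scale_left[of x y a] that assms(2) by auto
  have V: "a *s x \<in> V \<longleftrightarrow> x \<in> V" for x
    using V_scale[of x a] V_scale[of "a *s x" "inverse a"] assms(1) by auto
  have "x \<in> dual c (scaled a L) \<longleftrightarrow> x \<in> V \<and> (\<forall>y\<in>L. \<langle>x, a *s y\<rangle> / c \<in> \<O>)" for x
    unfolding dual_def scaled_def by blast
  moreover have "x \<in> scaled (inverse a) (dual c L) \<longleftrightarrow> x \<in> V \<and> (\<forall>y\<in>L. \<langle>a *s x, y\<rangle> / c \<in> \<O>)" for x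
    using mem_scaled_iff[of "inverse a" x "dual c L"] assms(1) V[of x] by (simp add: dual_def)
  moreover have "(\<forall>y\<in>L. \<langle>x, a *s y\<rangle> / c \<in> \<O>) \<longleftrightarrow> (\<forall>y\<in>L. \<langle>a *s x, y\<rangle> / c \<in> \<O>)" if "x \<in> V" for x
    by (intro ball_cong refl) (simp only: f[OF that])
  ultimately show ?thesis by blast
qed

lemma dual_same_ord:
  assumes "lattice L" "c \<noteq> 0" "c' \<noteq> 0" "ord c = ord c'"
  shows "dual c L = dual c' L"
proof -
  have "dual c L = dual ((c / c') * c') L" using assms by simp
  also have "\<dots> = scaled (c / c') (dual c' L)"
    using assms lattice_subset_V by (intro dual_mult) auto
  also have "\<dots> = dual c' L"
    using assms lattice_submodule[OF lattice_dual] ord_divide by (intro scaled_unit) auto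
  finally show ?thesis .
qed

lemma subset_dual_iff: "A \<subseteq> V \<Longrightarrow> A \<subseteq> dual c B \<longleftrightarrow> (\<forall>x\<in>A. \<forall>y\<in>B. \<langle>x, y\<rangle> / c \<in> \<O>)"
  by (auto simp: dual_def)

text \<open>A basis vector would be a multiple by \<open>a\<close> of a lattice vector, and its coordinate 1
  would lie in the maximal ideal.\<close>

lemma lattice_not_subset_scaled:
  assumes "lattice L" "a \<in> \<pi>\<O>"
  shows "\<not> L \<subseteq> scaled a L"
proof
  assume sub: "L \<subseteq> scaled a L"
  obtain e d where df: "dual_families e d" and L: "L = coordinate_lattice d"
    using assms lattice_iff by blast
  have 0: "(0::nat) < 2 * n" using n_pos by simp
  then obtain y where y: "e 0 = a *s y" "y \<in> L"
    using sub coordinate_lattice_basis[OF df] L unfolding scaled_def by blast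
  have "1 = \<langle>e 0, d 0\<rangle>" using df 0 unfolding dual_families_def by simp
  also have "\<dots> = a * \<langle>y, d 0\<rangle>"
    using y df 0 form_scale_left unfolding dual_families_def L coordinate_lattice_def by simp
  finally have "a * \<langle>y, d 0\<rangle> = 1" by simp
  moreover have "\<langle>y, d 0\<rangle> \<in> \<O>" using y(2) 0 unfolding L coordinate_lattice_def by simp
  then have "a / \<pi> * \<langle>y, d 0\<rangle> \<in> \<O>" using assms(2) mult_O maximal_ideal_iff by blast
  ultimately have "1 \<in> \<pi>\<O>" unfolding maximal_ideal_iff by (simp add: field_simps)
  then show False using one_not_maximal by simp
qed

lemma lattice_absorbs:
  assumes "lattice L" "x \<in> V"
  shows "\<exists>k. \<pi> ^ k *s x \<in> L"
proof -
  obtain e d where df: "dual_families e d" and L: "L = coordinate_lattice d"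
    using assms lattice_iff by blast
  obtain k where "\<forall>i\<in>{..<2*n}. \<pi> ^ k * \<langle>x, d i\<rangle> \<in> \<O>"
    using clear_denominators_finite[of "{..<2*n}" "\<lambda>i. \<langle>x, d i\<rangle>"] by auto
  then have "\<pi> ^ k *s x \<in> L" using assms(2) df V_scale form_scale_left
    unfolding L coordinate_lattice_def dual_families_def by auto
  then show ?thesis by blast
qed

section \<open>One-step extensions and indices\<close>

lemma extend_contains: "submodule B \<Longrightarrow> B \<subseteq> extend B x" "submodule B \<Longrightarrow> x \<in> extend B x"
proof -
  assume B: "submodule B"
  show "B \<subseteq> extend B x"
  proof
    fix l assume "l \<in> B"
    then show "l \<in> extend B x" unfolding extend_def by (intro CollectI exI[of _ l] exI[of _ 0]) simp
  qed
  show "x \<in> extend B x" unfolding extend_def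
    by (intro CollectI exI[of _ 0] exI[of _ 1]) (use B submodule_zero in simp)
qed

lemma extend_least:
  assumes "submodule A" "B \<subseteq> A" "x \<in> A"
  shows "extend B x \<subseteq> A"
  unfolding extend_def using assms submodule_add submodule_scale by blast

lemma submodule_extend:
  assumes "submodule B" "x \<in> V"
  shows "submodule (extend B x)"
  unfolding submodule_def
proof (intro conjI ballI)
  show "extend B x \<subseteq> V" unfolding extend_def using assms submodule_V V_add V_scale by blast
  show "0 \<in> extend B x" using extend_contains(1)[OF assms(1)] submodule_zero[OF assms(1)] by blast
next
  fix y z assume "y \<in> extend B x" "z \<in> extend B x"
  then obtain l a m b where l: "y = l + a *s x" "z = m + b *s x" "l \<in> B" "m \<in> B" "a \<in> \<O>" "b \<in> \<O>"
    unfolding extend_def by blast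
  have "y + z = (l + m) + (a + b) *s x" using l by (simp add: scale_left_distrib)
  then show "y + z \<in> extend B x" unfolding extend_def using l submodule_add[OF assms(1)] add_O by blast
next
  fix c y assume c: "c \<in> \<O>" and "y \<in> extend B x"
  then obtain l a where l: "y = l + a *s x" "l \<in> B" "a \<in> \<O>"
    unfolding extend_def by blast
  have "c *s y = c *s l + (c * a) *s x" using l by (simp add: scale_right_distrib)
  then show "c *s y \<in> extend B x" unfolding extend_def using l c submodule_scale[OF assms(1)] mult_O by blast
qed

lemma maximal_scale_mem:
  assumes "submodule B" "\<pi> *s x \<in> B" "a \<in> \<pi>\<O>"
  shows "a *s x \<in> B"
proof -
  have "a *s x = (a / \<pi>) *s (\<pi> *s x)" using uniformizer_nonzero by simp
  then show ?thesis using assms submodule_scale maximal_ideal_iff by metis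
qed

text \<open>The annihilator of the class of \<open>x\<close> modulo \<open>B\<close> is the maximal ideal: every
  other scalar is a unit.\<close>

lemma scale_mem_iff:
  assumes "submodule B" "\<pi> *s x \<in> B" "x \<notin> B" "a \<in> \<O>"
  shows "a *s x \<in> B \<longleftrightarrow> a \<in> \<pi>\<O>"
proof
  assume ax: "a *s x \<in> B"
  show "a \<in> \<pi>\<O>"
  proof (rule ccontr)
    assume "a \<notin> \<pi>\<O>"
    then have "1 / a \<in> \<O>" "a \<noteq> 0" using unit_divide_O[of 1 a] assms(4) by (auto simp: maximal_ideal_iff)
    then show False using submodule_scale[OF assms(1) _ ax, of "1 / a"] assms(3) by simp
  qed
qed (use maximal_scale_mem assms in blast)

text \<open>A vector outside \<open>B\<close> has a unit as its coefficient at \<open>x\<close>, so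
  \<open>x\<close> can be recovered from it: one-step extensions are lines over the residue field.\<close>

lemma extend_eq:
  assumes "submodule B" "x \<in> V" "\<pi> *s x \<in> B" "y \<in> extend B x" "y \<notin> B"
  shows "extend B y = extend B x"
proof
  have y: "y \<in> V" using assms(4) submodule_extend[OF assms(1,2)] submodule_V by blast
  show "extend B y \<subseteq> extend B x"
    by (rule extend_least[OF submodule_extend[OF assms(1,2)] extend_contains(1)[OF assms(1)] assms(4)])
  obtain l a where l: "y = l + a *s x" "l \<in> B" "a \<in> \<O>" using assms(4) unfolding extend_def by blast
  have "a *s x \<notin> B" using l assms(1,5) submodule_add by blast
  then have "a \<notin> \<pi>\<O>" using maximal_scale_mem assms by blast
  then have a: "1 / a \<in> \<O>" "a \<noteq> 0" using unit_divide_O[of 1 a] l(3) by (auto simp: maximal_ideal_iff)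
  have "y - l \<in> extend B y"
    using submodule_diff[OF submodule_extend[OF assms(1) y]] extend_contains[OF assms(1), of y] l(2) by blast
  then have "(1 / a) *s (y - l) \<in> extend B y"
    using submodule_scale[OF submodule_extend[OF assms(1) y] a(1)] by blast
  moreover have "(1 / a) *s (y - l) = x" using l a by simp
  ultimately have "x \<in> extend B y" by simp
  then show "extend B x \<subseteq> extend B y"
    using extend_least[OF submodule_extend[OF assms(1) y] extend_contains(1)[OF assms(1)]] by blast
qed

text \<open>The cosets are those of the multiples of \<open>x\<close>, and two multiples agree modulo
  \<open>B\<close> exactly if the scalars agree in the residue field.\<close>

lemma card_cosets_extend:
  assumes "submodule B" "x \<in> V" "\<pi> *s x \<in> B" "x \<notin> B"
  shows "card (cosets (extend B x) B) = q"
proof -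
  note ac = submodule_add_closed[OF assms(1)]
  have "cosets (extend B x) B = (\<lambda>a. (a *s x) +o B) ` \<O>"
  proof (intro equalityI subsetI)
    fix X assume "X \<in> cosets (extend B x) B"
    then obtain l a where l: "X = (l + a *s x) +o B" "l \<in> B" "a \<in> \<O>"
      unfolding cosets_def extend_def by blast
    then have "X = (a *s x) +o B" using coset_eq_iff[OF ac] by simp
    then show "X \<in> (\<lambda>a. (a *s x) +o B) ` \<O>" using l by blast
  next
    fix X assume "X \<in> (\<lambda>a. (a *s x) +o B) ` \<O>"
    then obtain a where a: "a \<in> \<O>" "X = (a *s x) +o B" by blast
    then have "a *s x \<in> extend B x"
      using submodule_scale[OF submodule_extend[OF assms(1,2)]] extend_contains(2)[OF assms(1)] by blast
    then show "X \<in> cosets (extend B x) B" using a unfolding cosets_def by blast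
  qed
  then have "card (cosets (extend B x) B) = card ((\<lambda>a. (a *s x) +o B) ` \<O>)" by simp
  also have "\<dots> = card ((\<lambda>a. a +o \<pi>\<O>) ` \<O>)"
  proof (rule card_image_same_kernel)
    fix a b assume "a \<in> \<O>" "b \<in> \<O>"
    then show "(a *s x +o B = b *s x +o B) = (a +o \<pi>\<O> = b +o \<pi>\<O>)"
      using scale_mem_iff[OF assms(1,3,4), of "a - b"] diff_O
      by (simp add: coset_eq_iff[OF ac] coset_eq_iff[OF add_closed_maximal_ideal] scale_left_diff_distrib)
  qed
  finally show ?thesis unfolding q_eq cosets_def .
qed

lemma lattice_extend:
  assumes "lattice L" "x \<in> V" "\<pi> *s x \<in> L" "x \<notin> L"
  shows "lattice (extend L x)"
proof -
  obtain e d where df: "dual_families e d" and L: "L = coordinate_lattice d"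
    using assms lattice_iff by blast
  have V: "e i \<in> V" "d i \<in> V" if "i < 2*n" for i using df that unfolding dual_families_def by auto
  have ed: "\<langle>e i, d j\<rangle> = (if i = j then 1 else 0)" if "i < 2*n" "j < 2*n" for i j
    using df that unfolding dual_families_def by auto
  \<comment> \<open>\<open>x\<close> has a coordinate \<open>c j\<close> of order exactly -1; \<open>x\<close> replaces the basis vector \<open>e j\<close>, and the dual family
      is corrected accordingly\<close>
  define c where "c i = \<langle>x, d i\<rangle>" for i
  obtain j where j: "j < 2*n" "c j \<notin> \<O>" using assms(2,4) unfolding L coordinate_lattice_def c_def by blast
  have pc: "\<pi> * c i \<in> \<O>" if "i < 2*n" for i
    using assms(2,3) form_scale_left[of x "d i" \<pi>] V that unfolding L coordinate_lattice_def c_def by auto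
  have cj: "c j \<noteq> 0" using j(2) by auto
  \<comment> \<open>every coordinate has order at least -1, so division by \<open>c j\<close> keeps all coefficients integral\<close>
  have unit: "\<pi> * c j \<notin> \<pi>\<O>" using j uniformizer_nonzero by (simp add: maximal_ideal_iff)
  have rO: "c i / c j \<in> \<O>" if "i < 2*n" for i
    using unit_divide_O[OF pc[OF that] pc[OF j(1)] unit] uniformizer_nonzero by simp
  have iO: "1 / c j \<in> \<O>"
    using unit_divide_O[OF uniformizer_O pc[OF j(1)] unit] uniformizer_nonzero by simp
  define e' where "e' i = (if i = j then x else e i)" for i
  define d' where "d' i = (if i = j then (1 / c j) *s d j else d i - (c i / c j) *s d j)" for i
  have fj: "\<langle>y, d' j\<rangle> = \<langle>y, d j\<rangle> / c j" if "y \<in> V" for y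
    using form_scale_right[of y "d j"] V j that by (simp add: d'_def)
  have fi: "\<langle>y, d' i\<rangle> = \<langle>y, d i\<rangle> - c i / c j * \<langle>y, d j\<rangle>" if "y \<in> V" "i < 2*n" "i \<noteq> j" for y i
    using form_scale_right[of y "d j" "c i / c j"] form_diff_right[of y "d i" "(c i / c j) *s d j"] V j that V_scale
    by (simp add: d'_def)
  have V': "e' i \<in> V" "d' i \<in> V" if "i < 2*n" for i
    using V that assms(2) V_scale V_diff j(1) by (auto simp: e'_def d'_def)
  have df': "dual_families e' d'" unfolding dual_families_def
  proof (intro conjI allI impI)
    fix i k assume ik: "i < 2*n" "k < 2*n"
    show "\<langle>e' i, d' k\<rangle> = (if i = k then 1 else 0)"
      using fj[OF V'(1)[OF ik(1)]] fi[OF V'(1)[OF ik(1)] ik(2)] ed ik j cj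
      by (cases "k = j"; cases "i = j") (auto simp: e'_def c_def[symmetric])
  qed (use V' in auto)
  have "extend L x = coordinate_lattice d'"
  proof
    have sub: "submodule (coordinate_lattice d')" using lattice_submodule lattice_iff df' by blast
    show "extend L x \<subseteq> coordinate_lattice d'"
    proof (rule extend_least[OF sub])
      show "x \<in> coordinate_lattice d'" using coordinate_lattice_basis[OF df' j(1)] by (simp add: e'_def)
      show "L \<subseteq> coordinate_lattice d'"
      proof
        fix y assume y: "y \<in> L"
        then have yV: "y \<in> V" and yd: "\<And>i. i < 2*n \<Longrightarrow> \<langle>y, d i\<rangle> \<in> \<O>" unfolding L coordinate_lattice_def by auto
        have "\<langle>y, d' i\<rangle> \<in> \<O>" if "i < 2*n" for i
        proof (cases "i = j")
          case True
          then show ?thesis using fj[OF yV] mult_O[OF iO yd[OF j(1)]] by simp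
        next
          case False
          then show ?thesis using fi[OF yV that False] diff_O[OF yd[OF that] mult_O[OF rO[OF that] yd[OF j(1)]]] by simp
        qed
        then show "y \<in> coordinate_lattice d'" using yV unfolding coordinate_lattice_def by blast
      qed
    qed
    show "coordinate_lattice d' \<subseteq> extend L x"
    proof
      fix y assume "y \<in> coordinate_lattice d'"
      then have yV: "y \<in> V" and yd: "\<And>i. i < 2*n \<Longrightarrow> \<langle>y, d' i\<rangle> \<in> \<O>" unfolding coordinate_lattice_def by auto
      define a where "a = \<langle>y, d' j\<rangle>"
      have a: "a \<in> \<O>" using yd j(1) by (simp add: a_def)
      let ?z = "y - a *s x"
      have zV: "?z \<in> V" using yV assms(2) V_diff V_scale by auto
      have z: "\<langle>?z, d i\<rangle> = \<langle>y, d i\<rangle> - a * c i" if "i < 2*n" for i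
        using form_diff_left[of y "a *s x" "d i"] form_scale_left[of x "d i" a] yV assms(2) V that V_scale
        by (simp add: c_def)
      have ac: "a * c j = \<langle>y, d j\<rangle>" using fj[OF yV] cj by (simp add: a_def)
      have "\<langle>?z, d i\<rangle> \<in> \<O>" if "i < 2*n" for i
      proof (cases "i = j")
        case True
        then show ?thesis using z[OF that] ac by simp
      next
        case False
        have "\<langle>?z, d i\<rangle> = \<langle>y, d' i\<rangle>" using z[OF that] fi[OF yV that False] ac[symmetric] cj by simp
        then show ?thesis using yd that by simp
      qed
      then have "?z \<in> L" using zV unfolding L coordinate_lattice_def by blast
      moreover have "y = ?z + a *s x" by simp
      ultimately show "y \<in> extend L x" using a unfolding extend_def by blast
    qed
  qed
  then show ?thesis using lattice_iff df' by blast
qed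

text \<open>The coordinates, reduced to the residue field, identify the quotient with all families of
  \<open>2n\<close> residue classes.\<close>

lemma card_cosets_scaled:
  assumes "lattice L"
  shows "card (cosets L (scaled \<pi> L)) = q ^ (2*n)"
proof -
  obtain e d where df: "dual_families e d" and L: "L = coordinate_lattice d"
    using assms lattice_iff by blast
  have V: "d i \<in> V" if "i < 2*n" for i using df that unfolding dual_families_def by auto
  let ?G = "\<lambda>x. \<lambda>i\<in>{..<2*n}. \<langle>x, d i\<rangle> +o \<pi>\<O>"
  note ac = submodule_add_closed[OF lattice_submodule[OF lattice_scaled[OF assms uniformizer_nonzero]]]
  have "card (cosets L (scaled \<pi> L)) = card (?G ` L)" unfolding cosets_def
  proof (rule card_image_same_kernel)
    fix x y assume xy: "x \<in> L" "y \<in> L"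
    then have xyV: "x \<in> V" "y \<in> V" "x - y \<in> V" "inverse \<pi> *s (x - y) \<in> V"
      using V_diff V_scale unfolding L coordinate_lattice_def by auto
    have "x +o scaled \<pi> L = y +o scaled \<pi> L \<longleftrightarrow> (\<forall>i<2*n. \<langle>inverse \<pi> *s (x - y), d i\<rangle> \<in> \<O>)"
      unfolding coset_eq_iff[OF ac] mem_scaled_iff[OF uniformizer_nonzero]
      using xyV by (simp add: L coordinate_lattice_def)
    also have "\<dots> \<longleftrightarrow> (\<forall>i<2*n. \<langle>x, d i\<rangle> - \<langle>y, d i\<rangle> \<in> \<pi>\<O>)"
      using xyV V form_scale_left form_diff_left by (simp add: maximal_ideal_iff divide_inverse mult.commute)
    also have "\<dots> \<longleftrightarrow> ?G x = ?G y"
      unfolding coset_eq_iff[OF add_closed_maximal_ideal, symmetric] by (auto simp: fun_eq_iff restrict_def)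
    finally show "x +o scaled \<pi> L = y +o scaled \<pi> L \<longleftrightarrow> ?G x = ?G y" .
  qed
  also have "?G ` L = (\<Pi>\<^sub>E i\<in>{..<2*n}. residue_field)"
  proof (intro equalityI subsetI)
    fix g assume "g \<in> ?G ` L"
    then show "g \<in> (\<Pi>\<^sub>E i\<in>{..<2*n}. residue_field)"
      by (auto simp: residue_field_def L coordinate_lattice_def PiE_def)
  next
    fix g assume g: "g \<in> (\<Pi>\<^sub>E i\<in>{..<2*n}. residue_field)"
    then have "\<forall>i\<in>{..<2*n}. \<exists>a\<in>\<O>. g i = a +o \<pi>\<O>" unfolding residue_field_def by (blast dest: PiE_mem)
    then obtain a where a: "\<And>i. i < 2*n \<Longrightarrow> a i \<in> \<O> \<and> g i = a i +o \<pi>\<O>" by (metis lessThan_iff)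
    let ?x = "\<Sum>i<2*n. a i *s e i"
    have "?x \<in> L" unfolding L coordinate_lattice_eq_span[OF df] using a by blast
    moreover have "g = ?G ?x"
      using g a form_combination[OF df, of _ a] by (auto simp: fun_eq_iff PiE_def extensional_def restrict_def)
    ultimately show "g \<in> ?G ` L" by blast
  qed
  also have "card \<dots> = q ^ (2*n)" by (simp add: card_PiE q_def)
  finally show ?thesis .
qed

text \<open>Duality preserves the index of a one-step extension: the dual of the extension is the kernel of a
  nonzero linear functional with values in the residue field, given by pairing with \<open>x\<close>.\<close>

lemma card_cosets_dual_extend:
  assumes "lattice L" "c \<noteq> 0" "x \<in> V" "\<pi> *s x \<in> L" "x \<notin> L"
  shows "card (cosets (dual c L) (dual c (extend L x))) = q"
proof -
  let ?U = "extend L x"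
  note ls = lattice_submodule[OF assms(1)]
  have U: "lattice ?U" using lattice_extend assms by blast
  note ac = submodule_add_closed[OF lattice_submodule[OF lattice_dual[OF U assms(2)]]]
  note sd = lattice_submodule[OF lattice_dual[OF assms(1,2)]]
  let ?v = "\<lambda>y. \<pi> * (\<langle>y, x\<rangle> / c)"
  have vO: "?v y \<in> \<O>" if "y \<in> dual c L" for y
  proof -
    have "\<langle>y, \<pi> *s x\<rangle> / c \<in> \<O>" using that assms(4) unfolding dual_def by blast
    then show ?thesis using form_scale_right[of y x \<pi>] that assms(3) by (simp add: dual_def)
  qed
  have mem: "y \<in> dual c ?U \<longleftrightarrow> ?v y \<in> \<pi>\<O>" if y: "y \<in> dual c L" for y
  proof
    assume "y \<in> dual c ?U"
    then have "\<langle>y, x\<rangle> / c \<in> \<O>" using extend_contains(2)[OF ls] unfolding dual_def by blast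
    then show "?v y \<in> \<pi>\<O>" using uniformizer_nonzero by (simp add: maximal_ideal_iff)
  next
    assume "?v y \<in> \<pi>\<O>"
    then have yx: "\<langle>y, x\<rangle> / c \<in> \<O>" using uniformizer_nonzero by (simp add: maximal_ideal_iff)
    have yV: "y \<in> V" using y by (simp add: dual_def)
    have "\<langle>y, u\<rangle> / c \<in> \<O>" if u: "u \<in> ?U" for u
    proof -
      obtain l a where l: "u = l + a *s x" "l \<in> L" "a \<in> \<O>" using u unfolding extend_def by blast
      have lV: "l \<in> V" using l ls submodule_V by blast
      have "\<langle>y, u\<rangle> / c = \<langle>y, l\<rangle> / c + a * (\<langle>y, x\<rangle> / c)"
        using l yV lV assms(3) V_scale by (simp add: form_add_right form_scale_right add_divide_distrib)
      also have "\<dots> \<in> \<O>" using y l yx unfolding dual_def by (intro add_O mult_O) auto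
      finally show ?thesis .
    qed
    then show "y \<in> dual c ?U" using yV by (simp add: dual_def)
  qed
  \<comment> \<open>biduality supplies a vector on which the functional \<open>?v\<close> is a unit\<close>
  have "x \<notin> dual c (dual c L)" using dual_dual assms by simp
  then obtain y0 where y0: "y0 \<in> dual c L" "\<langle>x, y0\<rangle> / c \<notin> \<O>" using assms(3) unfolding dual_def by blast
  have y0V: "y0 \<in> V" using y0 by (simp add: dual_def)
  have "\<langle>y0, x\<rangle> / c = - (\<langle>x, y0\<rangle> / c)" unfolding form_swap[OF assms(3) y0V] by simp
  then have "\<langle>y0, x\<rangle> / c \<notin> \<O>" using y0(2) minus_O_iff by metis
  then have unit: "?v y0 \<notin> \<pi>\<O>"
    unfolding maximal_ideal_iff nonzero_mult_div_cancel_left[OF uniformizer_nonzero] .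
  have vimg: "?v ` dual c L = \<O>"
  proof (intro equalityI subsetI)
    fix a assume a: "a \<in> \<O>"
    let ?b = "a / ?v y0"
    have "?b \<in> \<O>" using unit_divide_O[OF a vO[OF y0(1)] unit] .
    then have b: "?b *s y0 \<in> dual c L" using submodule_scale[OF sd] y0(1) by blast
    have "?v y0 \<noteq> 0" using unit maximal_ideal_iff[of 0] by (metis div_0 zero_O)
    moreover have "a / u * u = a" if "u \<noteq> 0" for u using that by simp
    ultimately have "?b * ?v y0 = a" by blast
    moreover have "?v (?b *s y0) = ?b * ?v y0" using form_scale_left[OF y0V assms(3), of ?b] by simp
    ultimately have "?v (?b *s y0) = a" by (rule trans[rotated])
    then show "a \<in> ?v ` dual c L" using b by (rule image_eqI[OF sym])
  qed (use vO in blast)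
  have "card (cosets (dual c L) (dual c ?U)) = card ((\<lambda>y. ?v y +o \<pi>\<O>) ` dual c L)"
    unfolding cosets_def
  proof (rule card_image_same_kernel)
    fix y z assume yz: "y \<in> dual c L" "z \<in> dual c L"
    have "y \<in> V" "z \<in> V" using yz by (auto simp: dual_def)
    then have "?v (y - z) = ?v y - ?v z"
      by (simp only: form_diff_left assms(3) right_diff_distrib diff_divide_distrib)
    then show "y +o dual c ?U = z +o dual c ?U \<longleftrightarrow> ?v y +o \<pi>\<O> = ?v z +o \<pi>\<O>"
      using mem[of "y - z"] submodule_diff[OF sd yz]
      by (simp add: coset_eq_iff[OF ac] coset_eq_iff[OF add_closed_maximal_ideal])
  qed
  also have "(\<lambda>y. ?v y +o \<pi>\<O>) ` dual c L = cosets \<O> \<pi>\<O>"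
    unfolding cosets_def vimg[symmetric] by (simp add: image_image)
  finally show ?thesis using q_eq by simp
qed

section \<open>Lines in a quotient\<close>

text \<open>If \<open>A\<close> contains \<open>B\<close> and multiplication by the uniformizer maps
  \<open>A\<close> into \<open>B\<close>, these are the preimages in \<open>A\<close> of the lines of
  the residue space of \<open>A\<close> modulo \<open>B\<close>.\<close>

definition lines :: "'v set \<Rightarrow> 'v set \<Rightarrow> 'v set set" where
  "lines A B = extend B ` (A - B)"

lemma card_lines:
  assumes A: "submodule A" and B: "submodule B" and sub: "B \<subseteq> A" "scaled \<pi> A \<subseteq> B"
    and card: "card (cosets A B) = q ^ d"
  shows "finite (lines A B)" "card (lines A B) = (\<Sum>j<d. q ^ j)"
proof -
  note ac = submodule_add_closed[OF B]
  have qp: "q ^ d > 0" using q_ge_2 by simp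
  have fin: "finite (cosets A B)" using card qp by (intro card_ge_0_finite) simp
  have piA: "\<pi> *s x \<in> B" if "x \<in> A" for x using sub(2) that unfolding scaled_def by blast
  have inV: "x \<in> V" if "x \<in> A" for x using A that submodule_V by blast
  have selfB: "x +o B = B \<longleftrightarrow> x \<in> B" for x using coset_eq_self[OF ac] .
  have bot: "B \<in> cosets U B" if "submodule U" for U
    using submodule_zero[OF that] coset_zero[of B] unfolding cosets_def by (metis imageI)
  have fl: "finite (cosets U B)" "card (cosets U B - {B}) = q - 1" "cosets U B \<subseteq> cosets A B"
    if U: "U \<in> lines A B" for U
  proof -
    obtain x where x: "x \<in> A" "x \<notin> B" "U = extend B x" using U unfolding lines_def by blast
    have "U \<subseteq> A" using extend_least[OF A sub(1) x(1)] x by simp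
    then show s: "cosets U B \<subseteq> cosets A B" unfolding cosets_def by blast
    then show f: "finite (cosets U B)" using fin finite_subset by blast
    have "card (cosets U B) = q" using card_cosets_extend[OF B inV[OF x(1)] piA[OF x(1)] x(2)] x(3) by simp
    then show "card (cosets U B - {B}) = q - 1"
      using bot submodule_extend[OF B inV[OF x(1)]] x(3) f by simp
  qed
  have union: "U = \<Union>(cosets U B)" if U: "U \<in> lines A B" for U
  proof (intro equalityI subsetI)
    obtain x where x: "x \<in> A" "x \<notin> B" "U = extend B x" using U unfolding lines_def by blast
    have sU: "submodule U" "B \<subseteq> U" using submodule_extend[OF B inV[OF x(1)]] extend_contains(1)[OF B] x(3) by auto
    fix y
    show "y \<in> \<Union>(cosets U B)" if "y \<in> U"
    proof -
      have "y \<in> y +o B" unfolding elt_set_plus_def using submodule_zero[OF B] by force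
      then show ?thesis using that unfolding cosets_def by blast
    qed
    show "y \<in> U" if "y \<in> \<Union>(cosets U B)"
      using that sU submodule_add[OF sU(1)] unfolding cosets_def elt_set_plus_def by blast
  qed
  have "lines A B \<subseteq> Union ` Pow (cosets A B)"
  proof
    fix U assume U: "U \<in> lines A B"
    show "U \<in> Union ` Pow (cosets A B)" using image_eqI[of U Union "cosets U B", OF union[OF U]] fl(3)[OF U] by simp
  qed
  then show finl: "finite (lines A B)" using fin by (meson finite_Pow_iff finite_imageI finite_subset)
  \<comment> \<open>each nonzero coset lies on exactly one line, and a line carries \<open>q - 1\<close> of them\<close>
  have un: "cosets A B - {B} = (\<Union>U\<in>lines A B. cosets U B - {B})"
  proof (intro equalityI subsetI)
    fix X assume "X \<in> cosets A B - {B}"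
    then obtain x where x: "x \<in> A" "X = x +o B" "x \<notin> B" using selfB unfolding cosets_def by blast
    then have "X \<in> cosets (extend B x) B - {B}"
      using extend_contains(2)[OF B] selfB unfolding cosets_def by blast
    then show "X \<in> (\<Union>U\<in>lines A B. cosets U B - {B})" using x unfolding lines_def by blast
  qed (use fl(3) in blast)
  have disj: "(cosets U B - {B}) \<inter> (cosets W B - {B}) = {}" if UW: "U \<in> lines A B" "W \<in> lines A B" "U \<noteq> W" for U W
  proof (rule ccontr)
    assume "(cosets U B - {B}) \<inter> (cosets W B - {B}) \<noteq> {}"
    then obtain y z where y: "y \<in> U" "z \<in> W" "y +o B = z +o B" "y +o B \<noteq> B" unfolding cosets_def by blast
    obtain u where u: "u \<in> A" "u \<notin> B" "U = extend B u" using UW(1) unfolding lines_def by blast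
    obtain w where w: "w \<in> A" "w \<notin> B" "W = extend B w" using UW(2) unfolding lines_def by blast
    have yB: "y \<notin> B" using y selfB by blast
    have "y - z \<in> B" using y(3) coset_eq_iff[OF ac] by blast
    then have "z + (y - z) \<in> W"
      using submodule_add[OF submodule_extend[OF B inV[OF w(1)]]] extend_contains(1)[OF B] y(2) w(3) by blast
    then have "y \<in> W" by simp
    then have "extend B y = extend B w"
      using extend_eq[OF B inV[OF w(1)] piA[OF w(1)] _ yB] unfolding w(3) by blast
    moreover have "extend B y = extend B u"
      using extend_eq[OF B inV[OF u(1)] piA[OF u(1)] _ yB] y(1) unfolding u(3) by blast
    ultimately have "U = W" unfolding u(3) w(3) by metis
    then show False using UW(3) by simp
  qed
  have "card (cosets A B - {B}) = (\<Sum>U\<in>lines A B. card (cosets U B - {B}))"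
    unfolding un by (rule card_UN_disjoint) (use finl fl disj in auto)
  also have "\<dots> = card (lines A B) * (q - 1)" using fl(2) by simp
  finally have "card (lines A B) * (q - 1) = q ^ d - 1"
    using card bot[OF A] fin by simp
  then have "card (lines A B) * (q - 1) = (\<Sum>j<d. q ^ j) * (q - 1)"
    using geometric_sum_nat[of q d] q_ge_2 by simp
  then show "card (lines A B) = (\<Sum>j<d. q ^ j)" using q_ge_2 by simp
qed

text \<open>An index equal to \<open>q\<close> means that the quotient is one-dimensional, so that any nonzero
  vector generates it.\<close>

lemma extend_eq_of_index:
  assumes A: "submodule A" and B: "submodule B" and sub: "B \<subseteq> A"
    and card: "card (cosets A B) = q" and x: "x \<in> A" "x \<notin> B" "\<pi> *s x \<in> B"
  shows "extend B x = A"
proof -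
  have xV: "x \<in> V" using A x submodule_V by blast
  note sE = submodule_extend[OF B xV]
  have E: "extend B x \<subseteq> A" "B \<subseteq> extend B x" using extend_least[OF A sub x(1)] extend_contains(1)[OF B] by auto
  have "q = card (cosets A (extend B x)) * q"
    using card_cosets_mult[OF submodule_add_closed[OF A] submodule_add_closed[OF sE] submodule_add_closed[OF B] E(2,1)]
      card card_cosets_extend[OF B xV x(3,2)] by simp
  then have "card (cosets A (extend B x)) = 1" using q_ge_2 by simp
  then show ?thesis using card_cosets_eq_1D[OF submodule_add_closed[OF sE] E(1)] by simp
qed

section \<open>Self-orthogonal lattices\<close>

text \<open>For \<open>L\<close> in this set, the quotient of \<open>dual c L\<close> by \<open>L\<close> is a
  vector space over the residue field on which \<open>\<langle>x, y\<rangle> * \<pi> / c\<close>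
  induces a nondegenerate alternating form, the residual space of \<open>L\<close>. The vertices
  correspond to \<open>c = \<pi>\<close>; the other factors are needed for the reversal of inclusions
  by duality.\<close>

definition normalised :: "'k \<Rightarrow> 'v set set" where
  "normalised c = {L. lattice L \<and> L \<subseteq> dual c L \<and> dual (\<pi> * c) L \<subseteq> L}"

lemma normalised_lattice: "L \<in> normalised c \<Longrightarrow> lattice L"
  and normalised_subset_dual: "L \<in> normalised c \<Longrightarrow> L \<subseteq> dual c L"
  and normalised_dual_subset: "L \<in> normalised c \<Longrightarrow> dual (\<pi> * c) L \<subseteq> L"
  by (auto simp: normalised_def)

lemma dual_uniformizer_mult: "lattice L \<Longrightarrow> dual (\<pi> * c) L = scaled \<pi> (dual c L)"
  using dual_mult[OF uniformizer_nonzero lattice_subset_V] .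

lemma normalised_uniformizer_dual: "L \<in> normalised c \<Longrightarrow> scaled \<pi> (dual c L) \<subseteq> L"
  using normalised_dual_subset dual_uniformizer_mult normalised_lattice by metis

text \<open>The extension is again self-orthogonal because \<open>x\<close> is orthogonal to itself. Both the
  step from \<open>L\<close> to the extension and the step from the dual of the extension to that of
  \<open>L\<close> have index \<open>q\<close>, so the quotient of \<open>dual c L\<close> by
  \<open>L\<close> loses two dimensions.\<close>

lemma self_orthogonal_extend:
  assumes L: "lattice L" "L \<subseteq> dual c L" and c: "c \<noteq> 0"
    and x: "x \<in> dual c L" "x \<notin> L" "\<pi> *s x \<in> L"
  shows "lattice (extend L x)" "extend L x \<subseteq> dual c (extend L x)"
    "card (cosets (dual c L) L) = q ^ 2 * card (cosets (dual c (extend L x)) (extend L x))"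
proof -
  let ?U = "extend L x"
  have xV: "x \<in> V" using x by (simp add: dual_def)
  note sL = lattice_submodule[OF L(1)]
  note sd = lattice_submodule[OF lattice_dual[OF L(1) c]]
  show U: "lattice ?U" using lattice_extend[OF L(1) xV x(3,2)] .
  note sdU = lattice_submodule[OF lattice_dual[OF U c]]
  have "?U \<subseteq> dual c L" using extend_least[OF sd L(2) x(1)] .
  then have "L \<subseteq> dual c ?U" using dual_antimono[of ?U "dual c L" c] dual_dual[OF L(1) c] by simp
  moreover have "x \<in> dual c ?U"
  proof -
    have "\<langle>x, u\<rangle> / c \<in> \<O>" if u: "u \<in> ?U" for u
    proof -
      obtain l a where l: "u = l + a *s x" "l \<in> L" "a \<in> \<O>" using u unfolding extend_def by blast
      have lV: "l \<in> V" using l sL submodule_V by blast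
      have "\<langle>x, u\<rangle> = \<langle>x, l\<rangle>"
        using l(1) lV xV V_scale by (simp add: form_add_right form_scale_right form_alternating)
      then show ?thesis using x(1) l(2) by (simp add: dual_def)
    qed
    then show ?thesis using xV by (simp add: dual_def)
  qed
  ultimately show UU: "?U \<subseteq> dual c ?U" using extend_least[OF sdU] by blast
  have "card (cosets (dual c L) L) = card (cosets (dual c L) ?U) * card (cosets ?U L)"
    using card_cosets_mult[OF submodule_add_closed[OF sd] submodule_add_closed[OF lattice_submodule[OF U]]
        submodule_add_closed[OF sL] extend_contains(1)[OF sL] \<open>?U \<subseteq> dual c L\<close>] .
  also have "card (cosets (dual c L) ?U) = card (cosets (dual c L) (dual c ?U)) * card (cosets (dual c ?U) ?U)"
    using card_cosets_mult[OF submodule_add_closed[OF sd] submodule_add_closed[OF sdU]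
        submodule_add_closed[OF lattice_submodule[OF U]] UU dual_antimono[OF extend_contains(1)[OF sL]]] .
  finally show "card (cosets (dual c L) L) = q ^ 2 * card (cosets (dual c ?U) ?U)"
    using card_cosets_dual_extend[OF L(1) c xV x(3,2)] card_cosets_extend[OF sL xV x(3,2)]
    by (simp add: power2_eq_square)
qed

lemma normalised_extend:
  assumes "L \<in> normalised c" "c \<noteq> 0" "x \<in> dual c L" "x \<notin> L"
  shows "extend L x \<in> normalised c"
proof -
  note L = normalised_lattice[OF assms(1)]
  have "\<pi> *s x \<in> L" using normalised_uniformizer_dual[OF assms(1)] assms(3) unfolding scaled_def by blast
  note U = self_orthogonal_extend[OF L normalised_subset_dual[OF assms(1)] assms(2-4) this]
  have "L \<subseteq> extend L x" using extend_contains(1)[OF lattice_submodule[OF L]] .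
  then have "dual (\<pi> * c) (extend L x) \<subseteq> extend L x"
    using dual_antimono normalised_dual_subset[OF assms(1)] by blast
  then show ?thesis using U unfolding normalised_def by blast
qed

text \<open>The lines in the residual space are the atoms above \<open>L\<close>, and each lowers the dimension
  of the residual space by two.\<close>

lemma normalised_line:
  assumes "L \<in> normalised c" "c \<noteq> 0" "U \<in> lines (dual c L) L"
  shows "U \<in> normalised c" "L \<subset> U" "U \<subseteq> dual c L"
    "card (cosets (dual c L) L) = q ^ 2 * card (cosets (dual c U) U)"
    "card (cosets U L) = q"
    "\<And>M. submodule M \<Longrightarrow> L \<subseteq> M \<Longrightarrow> M \<subseteq> U \<Longrightarrow> M = L \<or> M = U"
proof -
  obtain x where x: "x \<in> dual c L" "x \<notin> L" "U = extend L x" using assms(3) unfolding lines_def by blast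
  note L = normalised_lattice[OF assms(1)]
  note sL = lattice_submodule[OF L]
  have px: "\<pi> *s x \<in> L" using normalised_uniformizer_dual[OF assms(1)] x(1) unfolding scaled_def by blast
  have xV: "x \<in> V" using x by (simp add: dual_def)
  show "U \<in> normalised c" using normalised_extend[OF assms(1,2) x(1,2)] x(3) by simp
  show "L \<subset> U" using extend_contains[OF sL, of x] x by blast
  show "U \<subseteq> dual c L"
    using extend_least[OF lattice_submodule[OF lattice_dual[OF L assms(2)]] normalised_subset_dual[OF assms(1)] x(1)] x(3) by simp
  show "card (cosets (dual c L) L) = q ^ 2 * card (cosets (dual c U) U)"
    using self_orthogonal_extend(3)[OF L normalised_subset_dual[OF assms(1)] assms(2) x(1,2) px] x(3) by simp
  show "card (cosets U L) = q" using card_cosets_extend[OF sL xV px x(2)] x(3) by simp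
  fix M assume M: "submodule M" "L \<subseteq> M" "M \<subseteq> U"
  show "M = L \<or> M = U"
  proof (cases "M = L")
    case False
    then obtain y where y: "y \<in> M" "y \<notin> L" using M by blast
    then have "y \<in> extend L x" using M(3) x(3) by blast
    then have "extend L y = U" using extend_eq[OF sL xV px _ y(2)] x(3) by simp
    then show ?thesis using extend_least[OF M(1,2) y(1)] M(3) by blast
  qed simp
qed

lemma normalised_line_below:
  assumes "L \<in> normalised c" "c \<noteq> 0" "M \<in> normalised c" "L \<subset> M"
  shows "\<exists>U\<in>lines (dual c L) L. U \<subseteq> M"
proof -
  obtain x where x: "x \<in> M" "x \<notin> L" using assms(4) by blast
  have "x \<in> dual c L" using x(1) normalised_subset_dual[OF assms(3)] dual_antimono[of L M c] assms(4) by blast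
  then have "extend L x \<in> lines (dual c L) L" using x(2) unfolding lines_def by blast
  moreover have "extend L x \<subseteq> M"
    using extend_least[OF lattice_submodule[OF normalised_lattice[OF assms(3)]] _ x(1)] assms(4) by blast
  ultimately show ?thesis by blast
qed

lemma normalised_index_pos:
  assumes "L \<in> normalised c" "c \<noteq> 0"
  shows "card (cosets (dual c L) L) > 0"
proof -
  note L = normalised_lattice[OF assms(1)]
  note d = lattice_dual[OF L assms(2)]
  have "card (cosets (dual c L) (scaled \<pi> (dual c L))) = card (cosets (dual c L) L) * card (cosets L (scaled \<pi> (dual c L)))"
    using card_cosets_mult[OF submodule_add_closed[OF lattice_submodule[OF d]] submodule_add_closed[OF lattice_submodule[OF L]]
        submodule_add_closed[OF lattice_submodule[OF lattice_scaled[OF d uniformizer_nonzero]]]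
        normalised_uniformizer_dual[OF assms(1)] normalised_subset_dual[OF assms(1)]] .
  moreover have "card (cosets (dual c L) (scaled \<pi> (dual c L))) > 0" using card_cosets_scaled[OF d] q_ge_2 by simp
  ultimately show ?thesis by (metis gr0I mult_is_0)
qed

text \<open>Adjoining isotropic vectors shrinks the residual space until it is zero, where the lattice equals
  its dual.\<close>

lemma self_dual_above:
  assumes "L \<in> normalised c" "c \<noteq> 0"
  shows "\<exists>X\<in>normalised c. L \<subseteq> X \<and> dual c X = X"
  using assms(1)
proof (induction "card (cosets (dual c L) L)" arbitrary: L rule: less_induct)
  case less
  show ?case
  proof (cases "dual c L = L")
    case False
    then obtain x where x: "x \<in> dual c L" "x \<notin> L" using normalised_subset_dual[OF less.prems] by blast
    then have l: "extend L x \<in> lines (dual c L) L" unfolding lines_def by blast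
    note U = normalised_line[OF less.prems assms(2) l]
    have "1 < q ^ 2" by (rule one_less_power) (use q_ge_2 in auto)
    then have "card (cosets (dual c (extend L x)) (extend L x)) < card (cosets (dual c L) L)"
      using U(4) normalised_index_pos[OF U(1) assms(2)] by simp
    then show ?thesis using less.hyps[OF _ U(1)] U(2) by blast
  qed (use less.prems in blast)
qed

section \<open>Flags\<close>

abbreviation comparable :: "'v set \<Rightarrow> 'v set \<Rightarrow> bool" where
  "comparable L M \<equiv> L \<subseteq> M \<or> M \<subseteq> L"

text \<open>Flags in the residual space of \<open>L\<close>, with \<open>L\<close> as the zero subspace.\<close>

definition flag_from :: "'k \<Rightarrow> 'v set \<Rightarrow> 'v set set \<Rightarrow> bool" where
  "flag_from c L X \<longleftrightarrow> clique (normalised c) comparable X \<and> L \<in> X \<and> (\<forall>Y\<in>X. L \<subseteq> Y)"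

definition max_flag_from :: "'k \<Rightarrow> 'v set \<Rightarrow> 'v set set \<Rightarrow> bool" where
  "max_flag_from c L X \<longleftrightarrow> flag_from c L X \<and> (\<forall>Z. flag_from c L Z \<and> X \<subseteq> Z \<longrightarrow> Z = X)"

lemma cliqueD:
  assumes "clique (normalised c) comparable X"
  shows "finite X" "X \<subseteq> normalised c" "A \<in> X \<Longrightarrow> B \<in> X \<Longrightarrow> comparable A B"
  using assms unfolding clique_def pairwise_def by blast+

lemma clique_insert:
  "clique (normalised c) comparable X \<Longrightarrow> A \<in> normalised c \<Longrightarrow> \<forall>Y\<in>X. comparable A Y \<Longrightarrow> clique (normalised c) comparable (insert A X)"
  unfolding clique_def by (auto simp: pairwise_insert)

lemma clique_subset: "clique (normalised c) comparable X \<Longrightarrow> Y \<subseteq> X \<Longrightarrow> clique (normalised c) comparable Y"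
  unfolding clique_def using finite_subset pairwise_subset by blast

lemma flag_from_remove:
  assumes X: "flag_from c L X" and U: "U \<in> X" "L \<subset> U" and min: "\<And>Y. Y \<in> X \<Longrightarrow> Y \<noteq> L \<Longrightarrow> U \<subseteq> Y"
  shows "flag_from c U (X - {L})"
  using assms clique_subset[of c X "X - {L}"] unfolding flag_from_def by blast

lemma flag_from_insert:
  assumes "L \<in> normalised c" "L \<subseteq> U" "flag_from c U Y"
  shows "flag_from c L (insert L Y)"
  using assms clique_insert[of c Y L] unfolding flag_from_def by blast

text \<open>Nothing fits between \<open>L\<close> and a line, so a larger flag starting at \<open>L\<close>
  would give a larger flag starting at \<open>U\<close>.\<close>

lemma max_flag_from_insert:
  assumes L: "L \<in> normalised c" "c \<noteq> 0" and U: "U \<in> lines (dual c L) L" and Y: "max_flag_from c U Y"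
  shows "max_flag_from c L (insert L Y)"
proof -
  note l = normalised_line[OF L U]
  have fY: "flag_from c U Y" using Y unfolding max_flag_from_def by blast
  have "flag_from c L (insert L Y)" using flag_from_insert[OF L(1) _ fY] l(2) by blast
  moreover have "Z = insert L Y" if Z: "flag_from c L Z" "insert L Y \<subseteq> Z" for Z
  proof -
    have UZ: "U \<in> Z" using fY Z unfolding flag_from_def by blast
    have min: "U \<subseteq> W" if W: "W \<in> Z" "W \<noteq> L" for W
    proof -
      have "comparable U W" using cliqueD(3) Z(1) UZ W(1) unfolding flag_from_def by blast
      moreover have "W \<in> normalised c" "L \<subseteq> W" using Z(1) W cliqueD(2) unfolding flag_from_def by blast+
      ultimately show ?thesis using l(6)[of W] lattice_submodule[OF normalised_lattice] W(2) by blast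
    qed
    have "flag_from c U (Z - {L})" using flag_from_remove[OF Z(1) UZ l(2) min] .
    moreover have "L \<notin> Y" using fY l(2) unfolding flag_from_def by blast
    ultimately have "Z - {L} = Y" using Y Z(2) unfolding max_flag_from_def by blast
    then show ?thesis using Z(2) by blast
  qed
  ultimately show ?thesis unfolding max_flag_from_def by blast
qed

text \<open>A maximal flag in a nonzero residual space contains a line, and what lies above the line is a
  maximal flag there.\<close>

lemma max_flag_from_remove:
  assumes L: "L \<in> normalised c" "c \<noteq> 0" "dual c L \<noteq> L" and X: "max_flag_from c L X"
  obtains U where "U \<in> lines (dual c L) L" "max_flag_from c U (X - {L})"
proof -
  have fX: "flag_from c L X" using X unfolding max_flag_from_def by blast
  then have cX: "clique (normalised c) comparable X" "L \<in> X" "\<And>Y. Y \<in> X \<Longrightarrow> L \<subseteq> Y" unfolding flag_from_def by blast+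
  have maxX: "A \<in> X" if A: "A \<in> normalised c" "L \<subseteq> A" "\<forall>Y\<in>X. comparable A Y" for A
  proof -
    have "flag_from c L (insert A X)" using clique_insert[OF cX(1) A(1,3)] cX A(2) unfolding flag_from_def by blast
    then show ?thesis using X unfolding max_flag_from_def by blast
  qed
  have "X - {L} \<noteq> {}"
  proof
    assume e: "X - {L} = {}"
    obtain x where "x \<in> dual c L" "x \<notin> L" using L(3) normalised_subset_dual[OF L(1)] by blast
    then have U: "extend L x \<in> lines (dual c L) L" unfolding lines_def by blast
    note l = normalised_line[OF L(1,2) U]
    have "extend L x \<in> X" using maxX[OF l(1)] l(2) e by blast
    then show False using e l(2) by blast
  qed
  then obtain W where W: "W \<in> X - {L}" "\<forall>Y\<in>X - {L}. Y \<subseteq> W \<longrightarrow> W = Y"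
    using finite_has_minimal[of "X - {L}"] cliqueD(1)[OF cX(1)] by auto
  have Wmin: "W \<subseteq> Y" if "Y \<in> X" "Y \<noteq> L" for Y
    using W that cliqueD(3)[OF cX(1), of W Y] by blast
  \<comment> \<open>a line below the second member of the flag is comparable to the whole flag, so maximality makes
      it that second member\<close>
  obtain U where U: "U \<in> lines (dual c L) L" "U \<subseteq> W"
    using normalised_line_below[OF L(1,2), of W] W(1) cliqueD(2)[OF cX(1)] cX(3) by blast
  note l = normalised_line[OF L(1,2) U(1)]
  have "U \<in> X"
  proof (rule maxX[OF l(1)])
    show "\<forall>Y\<in>X. comparable U Y"
    proof
      fix Y assume "Y \<in> X"
      then show "comparable U Y" using Wmin[of Y] U(2) l(2) by (cases "Y = L") auto
    qed
  qed (use l(2) in blast)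
  then have "U = W" using W(2) U(2) l(2) by blast
  then have min: "U \<subseteq> Y" if "Y \<in> X" "Y \<noteq> L" for Y using Wmin that by blast
  have "max_flag_from c U (X - {L})" unfolding max_flag_from_def
  proof (intro conjI allI impI)
    show "flag_from c U (X - {L})" using flag_from_remove[OF fX \<open>U \<in> X\<close> l(2) min] .
    fix Z assume Z: "flag_from c U Z \<and> X - {L} \<subseteq> Z"
    then have "flag_from c L (insert L Z)" "X \<subseteq> insert L Z" using flag_from_insert[OF L(1)] l(2) by blast+
    then have "insert L Z = X" using X unfolding max_flag_from_def by blast
    moreover have "L \<notin> Z" using Z l(2) unfolding flag_from_def by blast
    ultimately show "Z = X - {L}" by blast
  qed
  then show ?thesis using that U(1) by blast
qed

lemma flag_number_pos: "flag_number q m > 0"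
  unfolding flag_number_def using q_ge_2
  by (intro prod_pos) (auto intro!: sum_pos2[where i = 0])

text \<open>A maximal flag is the choice of a line \<open>U\<close> followed by a maximal flag in the residual
  space of \<open>U\<close>, which has dimension \<open>2m - 2\<close>.\<close>

lemma card_max_flags_from:
  assumes "L \<in> normalised c" "c \<noteq> 0" "card (cosets (dual c L) L) = q ^ (2 * m)"
  shows "finite {X. max_flag_from c L X} \<and> card {X. max_flag_from c L X} = flag_number q m"
  using assms(1,3)
proof (induction m arbitrary: L)
  case 0
  then have d: "dual c L = L"
    using card_cosets_eq_1D[OF submodule_add_closed[OF lattice_submodule[OF normalised_lattice]] normalised_subset_dual] by simp
  have "X = {L}" if "flag_from c L X" for X
  proof -
    have "Y = L" if Y: "Y \<in> X" for Y
    proof -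
      have "L \<subseteq> Y" "Y \<in> normalised c" using Y \<open>flag_from c L X\<close> cliqueD(2) unfolding flag_from_def by blast+
      then show "Y = L" using normalised_subset_dual[of Y c] dual_antimono[of L Y c] d by blast
    qed
    then show ?thesis using that unfolding flag_from_def by blast
  qed
  moreover have "flag_from c L {L}" using 0 unfolding flag_from_def clique_def by simp
  ultimately have "{X. max_flag_from c L X} = {{L}}" unfolding max_flag_from_def by blast
  then show ?case by (simp add: flag_number_def)
next
  case (Suc m)
  note L = Suc.prems(1)
  note lat = normalised_lattice[OF L]
  note sd = lattice_submodule[OF lattice_dual[OF lat assms(2)]]
  have q1: "q ^ (2 * Suc m) > 1" by (rule one_less_power) (use q_ge_2 in auto)
  have "cosets L L = {L}"
    using coset_eq_self[OF submodule_add_closed[OF lattice_submodule[OF lat]]]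
      submodule_zero[OF lattice_submodule[OF lat]] unfolding cosets_def by auto
  then have ne: "dual c L \<noteq> L" using Suc.prems(2) q1 by auto
  let ?lines = "lines (dual c L) L"
  note cl = card_lines[OF sd lattice_submodule[OF lat] normalised_subset_dual[OF L] normalised_uniformizer_dual[OF L] Suc.prems(2)]
  have IH: "finite {X. max_flag_from c U X}" "card {X. max_flag_from c U X} = flag_number q m" if U: "U \<in> ?lines" for U
  proof -
    note l = normalised_line[OF L assms(2) U]
    have "q ^ 2 * card (cosets (dual c U) U) = q ^ 2 * q ^ (2 * m)"
      unfolding l(4)[symmetric] Suc.prems(2) by (simp add: power2_eq_square)
    moreover have "q ^ 2 \<noteq> 0" using q_ge_2 by simp
    ultimately have "card (cosets (dual c U) U) = q ^ (2 * m)" using mult_left_cancel by blast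
    then show "finite {X. max_flag_from c U X}" "card {X. max_flag_from c U X} = flag_number q m"
      using Suc.IH[OF l(1)] by auto
  qed
  have notin: "L \<notin> Y" "\<forall>W\<in>Y. U \<subseteq> W" "U \<in> Y" if "U \<in> ?lines" "max_flag_from c U Y" for U Y
    using that normalised_line(2)[OF L assms(2)] unfolding max_flag_from_def flag_from_def by blast+
  have eq: "{X. max_flag_from c L X} = (\<Union>U\<in>?lines. insert L ` {X. max_flag_from c U X})"
  proof (intro equalityI subsetI)
    fix X assume X: "X \<in> {X. max_flag_from c L X}"
    then obtain U where "U \<in> ?lines" "max_flag_from c U (X - {L})"
      using max_flag_from_remove[OF L assms(2) ne] by blast
    moreover have "X = insert L (X - {L})" using X unfolding max_flag_from_def flag_from_def by blast
    ultimately show "X \<in> (\<Union>U\<in>?lines. insert L ` {X. max_flag_from c U X})" by blast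
  qed (use max_flag_from_insert[OF L assms(2)] in blast)
  have c1: "card (insert L ` {X. max_flag_from c U X}) = flag_number q m" if U: "U \<in> ?lines" for U
  proof -
    have "inj_on (insert L) {X. max_flag_from c U X}"
      by (rule inj_onI) (use notin(1)[OF U] in \<open>metis insert_ident mem_Collect_eq\<close>)
    then show ?thesis using IH(2)[OF U] by (simp add: card_image)
  qed
  have disj: "insert L ` {X. max_flag_from c U X} \<inter> insert L ` {X. max_flag_from c W X} = {}"
    if UW: "U \<in> ?lines" "W \<in> ?lines" "U \<noteq> W" for U W
  proof (rule ccontr)
    assume "\<not> ?thesis"
    then obtain Y Z where Y: "max_flag_from c U Y" "max_flag_from c W Z" "insert L Y = insert L Z" by blast
    then have "Y = Z" using notin(1)[OF UW(1) Y(1)] notin(1)[OF UW(2) Y(2)] by (simp add: insert_ident)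
    then have "U \<subseteq> W" "W \<subseteq> U"
      using notin(2,3)[OF UW(1) Y(1)] notin(2,3)[OF UW(2) Y(2)] by simp_all
    then have "U = W" by (rule subset_antisym)
    then show False using UW(3) by simp
  qed
  have "finite {X. max_flag_from c L X}" unfolding eq using cl(1) IH(1) by auto
  moreover have "card {X. max_flag_from c L X} = (\<Sum>U\<in>?lines. card (insert L ` {X. max_flag_from c U X}))"
    unfolding eq by (rule card_UN_disjoint) (use cl(1) IH(1) disj in auto)
  then have "card {X. max_flag_from c L X} = card ?lines * flag_number q m" using c1 by simp
  then have "card {X. max_flag_from c L X} = flag_number q (Suc m)"
    using cl(2) by (simp add: flag_number_def mult.commute)
  ultimately show ?case by blast
qed

section \<open>Maximal cliques through a bottom element\<close>

text \<open>Duality turns \<open>Y \<subseteq> N\<close> into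
  \<open>N \<subseteq> dual (\<pi> * c) Y \<subseteq> Y\<close>.\<close>

lemma bottom_below:
  assumes "dual (\<pi> * c) N = N" "Y \<in> normalised c" "comparable N Y"
  shows "N \<subseteq> Y"
  using assms dual_antimono[of Y N "\<pi> * c"] normalised_dual_subset[OF assms(2)] by blast

lemma max_clique_bottom_iff:
  assumes N: "N \<in> normalised c" "dual (\<pi> * c) N = N"
  shows "max_clique (normalised c) comparable X \<and> N \<in> X \<longleftrightarrow> max_flag_from c N X"
proof -
  have "flag_from c N X \<longleftrightarrow> clique (normalised c) comparable X \<and> N \<in> X" for X
    using bottom_below[OF N(2)] cliqueD[of c X] unfolding flag_from_def by blast
  then show ?thesis unfolding max_clique_def max_flag_from_def by blast
qed

text \<open>The dual of \<open>N\<close> for \<open>c\<close> is the multiple of \<open>N\<close> by the inverse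
  of the uniformizer.\<close>

lemma bottom_index:
  assumes N: "N \<in> normalised c" "dual (\<pi> * c) N = N" and c: "c \<noteq> 0"
  shows "card (cosets (dual c N) N) = q ^ (2 * n)"
  using card_cosets_scaled[OF lattice_dual[OF normalised_lattice[OF N(1)] c]]
    dual_uniformizer_mult[OF normalised_lattice[OF N(1)], of c] N(2) by simp

lemma card_max_cliques_bottom:
  assumes N: "N \<in> normalised c" "dual (\<pi> * c) N = N" and c: "c \<noteq> 0"
  shows "card {X. max_clique (normalised c) comparable X \<and> N \<in> X} = flag_number q n"
  using card_max_flags_from[OF N(1) c bottom_index[OF N c]] max_clique_bottom_iff[OF N] by simp

section \<open>Replacing the bottom of a maximal flag\<close>

text \<open>By duality, the index of \<open>N\<close> in \<open>U\<close> equals the index of \<open>B\<close>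
  in \<open>N\<close>.\<close>

lemma middle_interval:
  assumes N: "N \<in> normalised c" "dual (\<pi> * c) N = N" and c: "c \<noteq> 0" and U: "U \<in> lines (dual c N) N"
  defines "B \<equiv> dual (\<pi> * c) U"
  shows "lattice B" "dual (\<pi> * c) B = U" "B \<subseteq> N" "scaled \<pi> U \<subseteq> B"
    "card (cosets N B) = q" "card (cosets U B) = q ^ 2"
proof -
  note l = normalised_line[OF N(1) c U]
  have pc: "\<pi> * c \<noteq> 0" using c uniformizer_nonzero by simp
  note latU = normalised_lattice[OF l(1)] and latN = normalised_lattice[OF N(1)]
  show latB: "lattice B" unfolding B_def by (rule lattice_dual[OF latU pc])
  show "dual (\<pi> * c) B = U" unfolding B_def by (rule dual_dual[OF latU pc])
  show BN: "B \<subseteq> N" using dual_antimono[of N U "\<pi> * c"] l(2) N(2) unfolding B_def by blast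
  show "scaled \<pi> U \<subseteq> B" unfolding B_def dual_uniformizer_mult[OF latU]
    by (rule scaled_mono[OF normalised_subset_dual[OF l(1)]])
  obtain x where x: "x \<in> dual c N" "x \<notin> N" "U = extend N x" using U unfolding lines_def by blast
  have "\<pi> *s x \<in> N" using normalised_uniformizer_dual[OF N(1)] x(1) unfolding scaled_def by blast
  then show nb: "card (cosets N B) = q"
    using card_cosets_dual_extend[OF latN pc, of x] x N(2) unfolding B_def by (simp add: dual_def)
  show "card (cosets U B) = q ^ 2"
    using card_cosets_mult[OF submodule_add_closed[OF lattice_submodule[OF latU]]
        submodule_add_closed[OF lattice_submodule[OF latN]] submodule_add_closed[OF lattice_submodule[OF latB]] BN]
      l(2,5) nb by (simp add: power2_eq_square psubset_imp_subset)
qed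

text \<open>Every line of the two-dimensional space between \<open>dual (\<pi> * c) U\<close> and
  \<open>U\<close> behaves like \<open>N\<close>: it is self-dual for \<open>\<pi> * c\<close>, hence
  a bottom element, and \<open>U\<close> is a line above it. The relation between \<open>N\<close> and
  its replacement is symmetric.\<close>

lemma middle_lattice:
  assumes N: "N \<in> normalised c" "dual (\<pi> * c) N = N" and c: "c \<noteq> 0"
    and U: "U \<in> lines (dual c N) N" and M: "M \<in> lines U (dual (\<pi> * c) U)"
  shows "M \<in> normalised c" "dual (\<pi> * c) M = M" "M \<subset> U" "U \<in> lines (dual c M) M"
    "card (cosets U M) = q"
proof -
  let ?B = "dual (\<pi> * c) U"
  note l = normalised_line[OF N(1) c U]
  note mi = middle_interval[OF N c U]
  note latU = normalised_lattice[OF l(1)]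
  note sU = lattice_submodule[OF latU] and sB = lattice_submodule[OF mi(1)]
  have pc: "\<pi> * c \<noteq> 0" using c uniformizer_nonzero by simp
  have BU: "?B \<subseteq> U" using mi(3) l(2) by blast
  obtain y where y: "y \<in> U" "y \<notin> ?B" "M = extend ?B y" using M unfolding lines_def by blast
  have pi: "\<pi> *s z \<in> ?B" if "z \<in> U" for z using mi(4) that unfolding scaled_def by blast
  have soe: "lattice M" "M \<subseteq> dual (\<pi> * c) M" "card (cosets U ?B) = q ^ 2 * card (cosets (dual (\<pi> * c) M) M)"
    using self_orthogonal_extend[OF mi(1) _ pc, of y] mi(2) BU y pi[OF y(1)] by simp_all
  note sM = lattice_submodule[OF soe(1)]
  \<comment> \<open>\<open>M\<close> is a line in the two-dimensional quotient of \<open>U\<close> by \<open>?B\<close>, hence its own orthogonal complement\<close>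
  have "card (cosets (dual (\<pi> * c) M) M) = 1" using soe(3) mi(6) q_ge_2 by simp
  then show self: "dual (\<pi> * c) M = M"
    using card_cosets_eq_1D[OF submodule_add_closed[OF sM] soe(2)] by simp
  have BM: "?B \<subseteq> M" "M \<subseteq> U" using extend_contains(1)[OF sB] extend_least[OF sU BU y(1)] y(3) by auto
  have "q ^ 2 = card (cosets U M) * q"
    using card_cosets_mult[OF submodule_add_closed[OF sU] submodule_add_closed[OF sM] submodule_add_closed[OF sB] BM]
      mi(6) card_cosets_extend[OF sB submodule_V[OF sU y(1)] pi[OF y(1)] y(2)] y(3) by simp
  then show UM: "card (cosets U M) = q" using q_ge_2 by (simp add: power2_eq_square)
  have UdM: "U \<subseteq> dual c M" using normalised_subset_dual[OF l(1)] dual_antimono[OF BM(2), of c] by blast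
  then show MN: "M \<in> normalised c" using soe(1) BM self unfolding normalised_def by blast
  have "cosets M M = {M}"
    using coset_eq_self[OF submodule_add_closed[OF sM]] submodule_zero[OF sM] unfolding cosets_def by auto
  then have "M \<noteq> U" using UM q_ge_2 by auto
  then show MU: "M \<subset> U" using BM by blast
  then obtain x where x: "x \<in> U" "x \<notin> M" by blast
  have "extend M x = U"
    by (rule extend_eq_of_index[OF sU sM BM(2) UM x]) (use pi[OF x(1)] BM(1) in blast)
  then show "U \<in> lines (dual c M) M" using x UdM unfolding lines_def by blast
qed

lemma bottom_is_middle:
  assumes N: "N \<in> normalised c" "dual (\<pi> * c) N = N" and c: "c \<noteq> 0" and U: "U \<in> lines (dual c N) N"
  shows "N \<in> lines U (dual (\<pi> * c) U)"
proof -
  let ?B = "dual (\<pi> * c) U"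
  note l = normalised_line[OF N(1) c U]
  note mi = middle_interval[OF N c U]
  note sN = lattice_submodule[OF normalised_lattice[OF N(1)]] and sB = lattice_submodule[OF mi(1)]
  have "cosets N N = {N}"
    using coset_eq_self[OF submodule_add_closed[OF sN]] submodule_zero[OF sN] unfolding cosets_def by auto
  then have "?B \<noteq> N" using mi(5) q_ge_2 by auto
  then obtain x where x: "x \<in> N" "x \<notin> ?B" using mi(3) by blast
  have "extend ?B x = N"
    by (rule extend_eq_of_index[OF sN sB mi(3,5) x]) (use mi(4) l(2) x(1) in \<open>auto simp: scaled_def\<close>)
  then show ?thesis using x l(2) unfolding lines_def by blast
qed

text \<open>Duality gives \<open>dual (\<pi> * c) U \<subseteq> M\<close>, so \<open>M\<close> contains one of
  the lines; this line has index \<open>q\<close> in \<open>U\<close>, which leaves no room for a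
  larger proper sublattice.\<close>

lemma middle_between:
  assumes N: "N \<in> normalised c" "dual (\<pi> * c) N = N" and c: "c \<noteq> 0" and U: "U \<in> lines (dual c N) N"
    and M: "M \<in> normalised c" "M \<subset> U" "\<not> M \<subseteq> N"
  shows "M \<in> lines U (dual (\<pi> * c) U)"
proof -
  let ?B = "dual (\<pi> * c) U"
  note l = normalised_line[OF N(1) c U]
  note mi = middle_interval[OF N c U]
  note sM = lattice_submodule[OF normalised_lattice[OF M(1)]]
  have BM: "?B \<subseteq> M" using dual_antimono[of M U "\<pi> * c"] M(2) normalised_dual_subset[OF M(1)] by blast
  obtain y where y: "y \<in> M" "y \<notin> ?B" using M(3) mi(3) by blast
  have E: "extend ?B y \<in> lines U ?B" using y M(2) unfolding lines_def by blast
  note e = middle_lattice[OF N c U E]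
  have "extend ?B y \<subseteq> M" by (rule extend_least[OF sM BM y(1)])
  then have "extend ?B y = M" using normalised_line(6)[OF e(1) c e(4) sM] M(2) by blast
  then show ?thesis using E by simp
qed

lemma max_flag_from_exists:
  assumes N: "N \<in> normalised c" "dual (\<pi> * c) N = N" and c: "c \<noteq> 0" and U: "U \<in> lines (dual c N) N"
  shows "\<exists>X. max_flag_from c U X"
proof -
  note l = normalised_line[OF N(1) c U]
  have "q ^ 2 * card (cosets (dual c U) U) = q ^ 2 * q ^ (2 * (n - 1))"
    unfolding l(4)[symmetric] bottom_index[OF N c] using n_pos by (cases n) (simp_all add: power2_eq_square)
  moreover have "q ^ 2 \<noteq> 0" using q_ge_2 by simp
  ultimately have "card (cosets (dual c U) U) = q ^ (2 * (n - 1))" using mult_left_cancel by blast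
  then have "card {X. max_flag_from c U X} > 0" using card_max_flags_from[OF l(1) c] flag_number_pos by simp
  then show ?thesis by (metis (no_types, lifting) card.empty Collect_empty_eq less_irrefl)
qed

lemma bottom_not_self_dual:
  assumes N: "N \<in> normalised c" "dual (\<pi> * c) N = N" and c: "c \<noteq> 0"
  shows "dual c N \<noteq> N"
  using dual_uniformizer_mult[OF normalised_lattice[OF N(1)], of c] N(2)
    lattice_not_subset_scaled[OF normalised_lattice[OF N(1)], of \<pi>] by (auto simp: maximal_ideal_iff_ord ord_uniformizer)

text \<open>If \<open>M\<close> replaces \<open>N\<close> in a chamber, it is comparable to the second member
  \<open>U\<close> but not to \<open>N\<close>, so it lies strictly below \<open>U\<close>.
  Conversely, any maximal flag above \<open>U\<close> is completed to a chamber both by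
  \<open>N\<close> and by \<open>M\<close>.\<close>

lemma exchangeable_bottom_iff:
  assumes N: "N \<in> normalised c" "dual (\<pi> * c) N = N" and c: "c \<noteq> 0"
  shows "exchangeable (normalised c) comparable N M \<longleftrightarrow>
    (\<exists>U\<in>lines (dual c N) N. M \<in> lines U (dual (\<pi> * c) U) - {N})" (is "?l \<longleftrightarrow> ?r")
proof
  assume ?r
  then obtain U where U: "U \<in> lines (dual c N) N" and M: "M \<in> lines U (dual (\<pi> * c) U)" "M \<noteq> N" by blast
  obtain F where F: "max_flag_from c U F" using max_flag_from_exists[OF N c U] by blast
  then have F': "finite F" "\<And>Y. Y \<in> F \<Longrightarrow> U \<subseteq> Y" using cliqueD(1) unfolding max_flag_from_def flag_from_def by blast+
  note l = normalised_line[OF N(1) c U] and m = middle_lattice[OF N c U M(1)]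
  have "max_flag_from c N (insert N F)" by (rule max_flag_from_insert[OF N(1) c U F])
  then have X: "max_clique (normalised c) comparable (insert N F)" using max_clique_bottom_iff[OF N] by blast
  have "max_flag_from c M (insert M F)" by (rule max_flag_from_insert[OF m(1) c m(4) F])
  then have X': "max_clique (normalised c) comparable (insert M F)" using max_clique_bottom_iff[OF m(1,2)] by blast
  have notin: "N \<notin> F" "M \<notin> F" using F'(2) l(2) m(3) by blast+
  show ?l unfolding exchangeable_def
  proof (rule exI[of _ "insert N F"], rule exI[of _ "insert M F"], intro conjI exI[of _ F])
  qed (use X X' notin M(2) F'(1) in auto)
next
  assume ?l
  then obtain X X' F where X: "max_clique (normalised c) comparable X" "max_clique (normalised c) comparable X'"
    and F: "F \<subseteq> X" "F \<subseteq> X'" "card X = card F + 1" "card X' = card F + 1"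
    and t: "N \<in> X" "M \<in> X'" "N \<notin> X'" "M \<notin> X" unfolding exchangeable_def by blast
  have cX: "clique (normalised c) comparable X" "clique (normalised c) comparable X'" using X unfolding max_clique_def by blast+
  have XF: "X = insert N F"
  proof (rule card_subset_eq[symmetric])
    show "finite X" using cliqueD(1)[OF cX(1)] .
    show "insert N F \<subseteq> X" using F t by blast
    have "finite F" using \<open>finite X\<close> F(1) finite_subset by blast
    moreover have "N \<notin> F" using F(2) t(3) by blast
    ultimately show "card (insert N F) = card X" using F(3) by simp
  qed
  have MN: "M \<in> normalised c" using cX(2) t(2) cliqueD(2) by blast
  have maxX: "\<not> (\<forall>Y\<in>X. comparable M Y)"
  proof
    assume "\<forall>Y\<in>X. comparable M Y"
    then have "clique (normalised c) comparable (insert M X)" using clique_insert[OF cX(1) MN] by blast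
    then show False using X(1) t(4) unfolding max_clique_def by blast
  qed
  \<comment> \<open>if \<open>M\<close> and \<open>N\<close> were comparable, \<open>M\<close> would be comparable to all of \<open>X\<close>\<close>
  have cF: "comparable M Y" if "Y \<in> F" for Y using cliqueD(3)[OF cX(2) t(2)] that F(2) by blast
  then have nNM: "\<not> N \<subseteq> M" "\<not> M \<subseteq> N" using maxX XF by blast+
  have "max_flag_from c N X" using max_clique_bottom_iff[OF N] X(1) t(1) by blast
  then obtain U where U: "U \<in> lines (dual c N) N" "max_flag_from c U (X - {N})"
    using max_flag_from_remove[OF N(1) c bottom_not_self_dual[OF N c]] by blast
  note l = normalised_line[OF N(1) c U(1)]
  have "U \<in> X - {N}" using U(2) unfolding max_flag_from_def flag_from_def by blast
  then have UF: "U \<in> F" using XF by blast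
  have "M \<noteq> U" using UF F(1) t(4) by blast
  then have "M \<subset> U" using cF[OF UF] l(2) nNM(1) by blast
  then have "M \<in> lines U (dual (\<pi> * c) U)" using middle_between[OF N c U(1) MN _ nNM(2)] by blast
  then show ?r using U(1) nNM by blast
qed

text \<open>Each line \<open>U\<close> contributes the \<open>q + 1\<close> lines below it except
  \<open>N\<close>. The contributions are disjoint: two different \<open>U\<close> meet in
  \<open>N\<close>, and a common \<open>M\<close> would lie in \<open>N\<close>, where
  \<open>N\<close> is minimal.\<close>

lemma card_exchangeable_bottom:
  assumes N: "N \<in> normalised c" "dual (\<pi> * c) N = N" and c: "c \<noteq> 0"
  shows "card {M. exchangeable (normalised c) comparable N M} = (\<Sum>j<2*n. q ^ j) * q"
proof -
  let ?L = "lines (dual c N) N" and ?I = "\<lambda>U. lines U (dual (\<pi> * c) U) - {N}"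
  note latN = normalised_lattice[OF N(1)]
  note cl = card_lines[OF lattice_submodule[OF lattice_dual[OF latN c]] lattice_submodule[OF latN]
      normalised_subset_dual[OF N(1)] normalised_uniformizer_dual[OF N(1)] bottom_index[OF N c]]
  have ci: "finite (?I U)" "card (?I U) = q" if U: "U \<in> ?L" for U
  proof -
    note l = normalised_line[OF N(1) c U] and mi = middle_interval[OF N c U]
    have "dual (\<pi> * c) U \<subseteq> U" using mi(3) l(2) by blast
    note k = card_lines[OF lattice_submodule[OF normalised_lattice[OF l(1)]] lattice_submodule[OF mi(1)] this mi(4,6)]
    have "card (lines U (dual (\<pi> * c) U)) = q + 1" using k(2) by (simp add: numeral_2_eq_2)
    then show "finite (?I U)" "card (?I U) = q" using k(1) bottom_is_middle[OF N c U] by simp_all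
  qed
  have disj: "?I U \<inter> ?I W = {}" if UW: "U \<in> ?L" "W \<in> ?L" "U \<noteq> W" for U W
  proof (rule ccontr)
    assume "\<not> ?thesis"
    then obtain M where M: "M \<in> lines U (dual (\<pi> * c) U)" "M \<in> lines W (dual (\<pi> * c) W)" "M \<noteq> N" by blast
    note u = middle_lattice[OF N c UW(1) M(1)] and w = middle_lattice[OF N c UW(2) M(2)]
    note lu = normalised_line[OF N(1) c UW(1)] and lw = normalised_line[OF N(1) c UW(2)]
    have "submodule (U \<inter> W)"
      using lattice_submodule[OF normalised_lattice[OF lu(1)]] lattice_submodule[OF normalised_lattice[OF lw(1)]]
      unfolding submodule_def by blast
    then have "U \<inter> W = N \<or> U \<inter> W = U" "U \<inter> W = N \<or> U \<inter> W = W"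
      using lu(6)[of "U \<inter> W"] lw(6)[of "U \<inter> W"] lu(2) lw(2) by blast+
    then have "U \<inter> W = N" using UW(3) by blast
    then have "M \<subseteq> N" using u(3) w(3) by blast
    then have "N \<subseteq> M" using bottom_below[OF N(2) u(1)] by blast
    then show False using \<open>M \<subseteq> N\<close> M(3) by blast
  qed
  have "{M. exchangeable (normalised c) comparable N M} = (\<Union>U\<in>?L. ?I U)"
    using exchangeable_bottom_iff[OF N c] by blast
  then have "card {M. exchangeable (normalised c) comparable N M} = (\<Sum>U\<in>?L. card (?I U))"
    using card_UN_disjoint[of ?L ?I] cl(1) ci(1) disj by simp
  then show ?thesis using ci(2) cl(2) by simp
qed

section \<open>Vertices as normalised lattices\<close>

lemma inverse_mult_cancel: "a \<noteq> 0 \<Longrightarrow> inverse a * (a * b) = (b::'k)"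
  by (simp add: mult.assoc[symmetric])

lemma form_maps_into_O_iff: "L \<subseteq> V \<Longrightarrow> form_maps_into L \<O> \<longleftrightarrow> L \<subseteq> dual 1 L"
  unfolding form_maps_into_def by (auto simp: subset_dual_iff)

lemma form_maps_into_maximal_iff: "L \<subseteq> V \<Longrightarrow> form_maps_into L \<pi>\<O> \<longleftrightarrow> L \<subseteq> dual \<pi> L"
  unfolding form_maps_into_def by (auto simp: subset_dual_iff maximal_ideal_iff)

lemma induced_form_coset:
  assumes L: "lattice L" "L \<subseteq> dual 1 L" and xy: "x \<in> L" "y \<in> L"
  shows "induced_form (x +o scaled \<pi> L) (y +o scaled \<pi> L) = \<langle>x, y\<rangle> +o \<pi>\<O>"
proof -
  note sL = lattice_submodule[OF L(1)]
  have O: "\<langle>a, b\<rangle> \<in> \<O>" if "a \<in> L" "b \<in> L" for a b using L(2) that by (auto simp: dual_def)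
  have eq: "\<langle>x + \<pi> *s a, y + \<pi> *s b\<rangle> +o \<pi>\<O> = \<langle>x, y\<rangle> +o \<pi>\<O>" if ab: "a \<in> L" "b \<in> L" for a b
  proof -
    have V: "x \<in> V" "y \<in> V" "a \<in> V" "b \<in> V" using xy ab sL submodule_V by blast+
    have "\<langle>x + \<pi> *s a, y + \<pi> *s b\<rangle> - \<langle>x, y\<rangle> = \<pi> * (\<langle>x, b\<rangle> + \<langle>a, y\<rangle> + \<pi> * \<langle>a, b\<rangle>)"
      using V by (simp add: form_add_left form_add_right form_scale_left form_scale_right V_add V_scale algebra_simps)
    also have "\<dots> \<in> \<pi>\<O>" unfolding maximal_ideal_def
      by (intro imageI add_O mult_O uniformizer_O O xy ab)
    finally show ?thesis using coset_eq_iff[OF add_closed_maximal_ideal] by blast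
  qed
  have c: "z +o scaled \<pi> L = {z + \<pi> *s a | a. a \<in> L}" for z
    unfolding elt_set_plus_def scaled_def by blast
  have "induced_form (x +o scaled \<pi> L) (y +o scaled \<pi> L) =
    (\<Union>a\<in>L. \<Union>b\<in>L. \<langle>x + \<pi> *s a, y + \<pi> *s b\<rangle> +o \<pi>\<O>)"
    unfolding induced_form_def c by blast
  also have "\<dots> = (\<Union>a\<in>L. \<Union>b\<in>L. \<langle>x, y\<rangle> +o \<pi>\<O>)" using eq by simp
  also have "\<dots> = \<langle>x, y\<rangle> +o \<pi>\<O>" using xy by blast
  finally show ?thesis .
qed

text \<open>Nondegeneracy of the reduced form says that a lattice vector whose pairings all lie in the maximal
  ideal is divisible by the uniformizer. Iterating this shows that every vector with integral pairings
  is already in the lattice.\<close>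

lemma primitive_iff: "primitive L \<longleftrightarrow> lattice L \<and> dual 1 L = L"
proof (cases "lattice L \<and> L \<subseteq> dual 1 L")
  case True
  then have L: "lattice L" "L \<subseteq> dual 1 L" by auto
  note sL = lattice_submodule[OF L(1)]
  note acL = submodule_add_closed[OF lattice_submodule[OF lattice_scaled[OF L(1) uniformizer_nonzero]]]
  have V: "L \<subseteq> V" using lattice_subset_V L by blast
  have "primitive L \<longleftrightarrow> (\<forall>x\<in>L. (\<forall>y\<in>L. \<langle>x, y\<rangle> \<in> \<pi>\<O>) \<longrightarrow> x \<in> scaled \<pi> L)"
    unfolding primitive_def reduction_def
    using form_maps_into_O_iff[OF V] L induced_form_coset[OF L] coset_eq_self[OF add_closed_maximal_ideal]
      coset_eq_self[OF acL] by simp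
  also have "\<dots> \<longleftrightarrow> dual 1 L \<subseteq> L"
  proof
    assume r: "\<forall>x\<in>L. (\<forall>y\<in>L. \<langle>x, y\<rangle> \<in> \<pi>\<O>) \<longrightarrow> x \<in> scaled \<pi> L"
    note sd = lattice_submodule[OF lattice_dual[OF L(1) one_neq_zero]]
    \<comment> \<open>descent on \<open>k\<close>: a multiple \<open>\<pi> * \<pi> ^ k\<close> of \<open>x\<close> that lies in \<open>L\<close> belongs to the radical of the reduced
      form, so that \<open>\<pi> ^ k *s x\<close> lies in \<open>L\<close> already\<close>
    have "x \<in> L" if "x \<in> dual 1 L" "\<pi> ^ k *s x \<in> L" for x k
      using that
    proof (induction k)
      case (Suc k)
      let ?y = "\<pi> ^ k *s x"
      have y: "?y \<in> dual 1 L" "\<pi> *s ?y \<in> L"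
        using Suc.prems submodule_scale[OF sd, of "\<pi> ^ k" x] ord_power[of \<pi> k] uniformizer_nonzero
        by (auto simp: valuation_ring_iff ord_uniformizer)
      have "\<langle>\<pi> *s ?y, z\<rangle> \<in> \<pi>\<O>" if "z \<in> L" for z
        using y(1) that V form_scale_left[of ?y z \<pi>] uniformizer_nonzero
        by (auto simp: dual_def maximal_ideal_iff)
      then have "\<pi> *s ?y \<in> scaled \<pi> L" using r y(2) by blast
      then have "?y \<in> L" using mem_scaled_iff[OF uniformizer_nonzero] inverse_mult_cancel[OF uniformizer_nonzero] by simp
      then show ?case using Suc by blast
    qed simp
    then show "dual 1 L \<subseteq> L" using lattice_absorbs[OF L(1)] dual_subset_V by blast
  next
    assume s: "dual 1 L \<subseteq> L"
    show "\<forall>x\<in>L. (\<forall>y\<in>L. \<langle>x, y\<rangle> \<in> \<pi>\<O>) \<longrightarrow> x \<in> scaled \<pi> L"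
    proof (intro ballI impI)
      fix x assume x: "x \<in> L" "\<forall>y\<in>L. \<langle>x, y\<rangle> \<in> \<pi>\<O>"
      then have "inverse \<pi> *s x \<in> dual 1 L"
        using subsetD[OF V] V_scale[of x] form_scale_left[of x]
        by (auto simp: dual_def maximal_ideal_iff divide_inverse mult.commute)
      then show "x \<in> scaled \<pi> L" using s mem_scaled_iff[OF uniformizer_nonzero] by blast
    qed
  qed
  finally show ?thesis using L by blast
next
  case False
  then show ?thesis using form_maps_into_O_iff[OF lattice_subset_V] unfolding primitive_def by blast
qed

text \<open>Since \<open>L0\<close> is its own dual, \<open>\<pi> L0 \<subseteq> L\<close> dualises to the lower
  bound for \<open>L\<close>.\<close>

lemma normalised_of_vertex_representative:
  assumes "lattice L" "form_maps_into L \<pi>\<O>" "primitive L0" "scaled \<pi> L0 \<subseteq> L"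
  shows "L \<in> normalised \<pi>"
proof -
  have L0: "lattice L0" "dual 1 L0 = L0" using assms(3) primitive_iff by auto
  note V0 = lattice_subset_V[OF L0(1)]
  have "dual (\<pi> * \<pi>) L \<subseteq> dual (\<pi> * \<pi>) (scaled \<pi> L0)" by (rule dual_antimono[OF assms(4)])
  also have "\<dots> = scaled (inverse \<pi>) (dual ((\<pi> * \<pi>) * 1) L0)"
    using dual_scaled[OF uniformizer_nonzero V0] by simp
  also have "\<dots> = scaled (inverse \<pi> * (\<pi> * \<pi>)) L0"
    using dual_mult[of "\<pi> * \<pi>" L0 1] V0 uniformizer_nonzero L0(2) by (simp add: scaled_scaled)
  also have "\<dots> = scaled \<pi> L0" unfolding inverse_mult_cancel[OF uniformizer_nonzero] ..
  finally have "dual (\<pi> * \<pi>) L \<subseteq> L" using assms(4) by blast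
  then show ?thesis
    using assms(1,2) form_maps_into_maximal_iff[OF lattice_subset_V] unfolding normalised_def by blast
qed

text \<open>Duality interchanges the two inclusions in the definition and multiplies the factor by the
  uniformizer.\<close>

lemma normalised_dual:
  assumes "L \<in> normalised c" "c \<noteq> 0"
  shows "dual (\<pi> * c) L \<in> normalised (\<pi> * c)"
proof -
  note lat = normalised_lattice[OF assms(1)]
  have pc: "\<pi> * c \<noteq> 0" using assms uniformizer_nonzero by simp
  let ?B = "dual (\<pi> * c) L"
  have B: "lattice ?B" by (rule lattice_dual[OF lat pc])
  have d: "dual (\<pi> * c) ?B = L" by (rule dual_dual[OF lat pc])
  have "dual (\<pi> * (\<pi> * c)) ?B = scaled \<pi> L" using dual_uniformizer_mult[OF B] d by simp
  also have "\<dots> \<subseteq> scaled \<pi> (dual c L)" by (rule scaled_mono[OF normalised_subset_dual[OF assms(1)]])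
  also have "\<dots> = ?B" using dual_uniformizer_mult[OF lat] by simp
  finally show ?thesis using B d normalised_dual_subset[OF assms(1)] unfolding normalised_def by simp
qed

lemma normalised_dual_image:
  assumes "c \<noteq> 0"
  shows "dual (\<pi> * c) ` normalised c = normalised (\<pi> * c)"
proof (intro equalityI subsetI)
  fix M assume M: "M \<in> normalised (\<pi> * c)"
  have pc: "\<pi> * c \<noteq> 0" using assms uniformizer_nonzero by simp
  note lat = normalised_lattice[OF M]
  let ?L = "dual (\<pi> * c) M"
  have L: "lattice ?L" by (rule lattice_dual[OF lat pc])
  have d: "dual (\<pi> * c) ?L = M" by (rule dual_dual[OF lat pc])
  have "scaled \<pi> ?L \<subseteq> scaled \<pi> (dual c ?L)"
    using normalised_dual_subset[OF M] dual_uniformizer_mult[OF lat] dual_uniformizer_mult[OF L, of c] d by simp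
  then have "?L \<subseteq> dual c ?L"
    using scaled_mono[of "scaled \<pi> ?L" "scaled \<pi> (dual c ?L)" "inverse \<pi>"] uniformizer_nonzero
    by (simp add: scaled_scaled scaled_one)
  then have "?L \<in> normalised c" using L d normalised_subset_dual[OF M] unfolding normalised_def by simp
  then show "M \<in> dual (\<pi> * c) ` normalised c" using d by (metis imageI)
qed (use normalised_dual assms in blast)

text \<open>The lattice \<open>dual (\<pi> * \<pi>) L\<close> is self-orthogonal for the factor
  \<open>\<pi> * \<pi>\<close>; a self-dual lattice above it, divided by the uniformizer, is
  primitive.\<close>

lemma primitive_above:
  assumes "L \<in> normalised \<pi>"
  obtains L0 where "primitive L0" "scaled \<pi> L0 \<subseteq> L" "dual \<pi> L \<subseteq> L0"
proof -
  have pp: "\<pi> * \<pi> \<noteq> 0" using uniformizer_nonzero by simp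
  note lat = normalised_lattice[OF assms]
  obtain X where X: "X \<in> normalised (\<pi> * \<pi>)" "dual (\<pi> * \<pi>) L \<subseteq> X" "dual (\<pi> * \<pi>) X = X"
    using self_dual_above[OF normalised_dual[OF assms uniformizer_nonzero] pp] by blast
  note latX = normalised_lattice[OF X(1)]
  let ?L0 = "scaled (inverse \<pi>) X"
  have lat0: "lattice ?L0" using lattice_scaled[OF latX] uniformizer_nonzero by simp
  have "X = scaled (\<pi> * \<pi>) (dual 1 X)" using dual_mult[OF pp lattice_subset_V[OF latX], of 1] X(3) by simp
  then have "scaled (inverse \<pi>) X = scaled (inverse \<pi>) (scaled (\<pi> * \<pi>) (dual 1 X))" by simp
  also have "\<dots> = scaled \<pi> (dual 1 X)"
    unfolding scaled_scaled inverse_mult_cancel[OF uniformizer_nonzero] ..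
  also have "\<dots> = dual 1 ?L0"
    using dual_scaled[of "inverse \<pi>" X 1] lattice_subset_V[OF latX] uniformizer_nonzero by simp
  finally have "primitive ?L0" using lat0 primitive_iff by simp
  moreover have "X \<subseteq> L" using dual_antimono[OF X(2), of "\<pi> * \<pi>"] X(3) dual_dual[OF lat pp] by simp
  then have "scaled \<pi> ?L0 \<subseteq> L" using uniformizer_nonzero by (simp add: scaled_scaled scaled_one)
  moreover have "dual \<pi> L \<subseteq> ?L0"
    using X(2) dual_uniformizer_mult[OF lat, of \<pi>] scaled_subset_swap[OF uniformizer_nonzero] by simp
  ultimately show ?thesis using that by blast
qed

lemma vertices_eq: "vertices = homothety_class ` normalised \<pi>"
proof (intro equalityI subsetI)
  fix t assume "t \<in> vertices"
  then show "t \<in> homothety_class ` normalised \<pi>" unfolding vertices_def using normalised_of_vertex_representative by blast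
next
  fix t assume "t \<in> homothety_class ` normalised \<pi>"
  then obtain L where L: "L \<in> normalised \<pi>" "t = homothety_class L" by blast
  obtain L0 where "primitive L0" "scaled \<pi> L0 \<subseteq> L" "dual \<pi> L \<subseteq> L0" using primitive_above[OF L(1)] .
  moreover have "L \<subseteq> dual \<pi> L" "form_maps_into L \<pi>\<O>"
    using normalised_subset_dual[OF L(1)] form_maps_into_maximal_iff[OF lattice_subset_V[OF normalised_lattice[OF L(1)]]] by auto
  ultimately show "t \<in> vertices" unfolding vertices_def using L normalised_lattice by blast
qed

lemma normalisation_unique:
  assumes c: "c \<noteq> 0" and a: "a \<noteq> 0" and L: "L \<in> normalised c" "scaled a L \<in> normalised c"
  shows "scaled a L = L"
proof -
  \<comment> \<open>rescaling by \<open>b\<close> of positive order would give \<open>M \<subseteq> (b * b / \<pi>) M\<close>, where \<open>b * b / \<pi>\<close> has order at least 1\<close>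
  have no: False if o: "1 \<le> ord b" and b: "b \<noteq> 0" and M: "M \<in> normalised c" "scaled b M \<in> normalised c" for b M
  proof -
    note lat = normalised_lattice[OF M(1)]
    have "scaled (inverse b * \<pi>) M \<subseteq> scaled (inverse b * \<pi>) (dual c M)"
      by (rule scaled_mono[OF normalised_subset_dual[OF M(1)]])
    also have "\<dots> = dual (\<pi> * c) (scaled b M)"
      using dual_scaled[OF b lattice_subset_V[OF lat]] dual_uniformizer_mult[OF lat] by (simp add: scaled_scaled)
    also have "\<dots> \<subseteq> scaled b M" by (rule normalised_dual_subset[OF M(2)])
    finally have "M \<subseteq> scaled (inverse (inverse b * \<pi>) * b) M"
      using scaled_subset_swap[of "inverse b * \<pi>"] b uniformizer_nonzero by (simp add: scaled_scaled)
    then have "M \<subseteq> scaled (b * b / \<pi>) M" using b uniformizer_nonzero by (simp add: field_simps)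
    moreover have "b * b / \<pi> \<in> \<pi>\<O>"
      using o b uniformizer_nonzero ord_divide[of "b * b" \<pi>] ord_mult[of b b]
      by (simp add: maximal_ideal_iff_ord ord_uniformizer)
    ultimately show False using lattice_not_subset_scaled[OF lat] by blast
  qed
  have "\<not> 1 \<le> ord a" using no[OF _ a L] by blast
  moreover have "\<not> 1 \<le> ord (inverse a)"
    using no[of "inverse a" "scaled a L"] a L by (auto simp: scaled_scaled scaled_one)
  ultimately have "ord a = 0" using ord_inverse[OF a] by simp
  then show ?thesis using scaled_unit[OF lattice_submodule[OF normalised_lattice[OF L(1)]] a] by simp
qed

lemma mem_homothety_class: "M \<in> homothety_class L \<longleftrightarrow> (\<exists>a. a \<noteq> 0 \<and> M = scaled a L)"
  unfolding homothety_class_def by blast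

lemma self_homothety_class: "L \<in> homothety_class L"
  unfolding mem_homothety_class by (intro exI[of _ 1]) (simp add: scaled_one)

lemma homothety_class_representative:
  "L \<in> normalised \<pi> \<Longrightarrow> M \<in> normalised \<pi> \<Longrightarrow> M \<in> homothety_class L \<Longrightarrow> M = L"
  using normalisation_unique[OF uniformizer_nonzero] unfolding mem_homothety_class by blast

lemma inj_on_homothety_class: "inj_on homothety_class (normalised \<pi>)"
  by (rule inj_onI) (use homothety_class_representative self_homothety_class in blast)

text \<open>Representatives that witness incidence are normalised, hence they are the two given lattices.
  Conversely, if \<open>A \<subseteq> B\<close>, a primitive lattice above \<open>dual \<pi> A\<close>
  also contains \<open>B\<close>.\<close>

lemma incident_homothety_class_iff:
  assumes L: "L \<in> normalised \<pi>" "L' \<in> normalised \<pi>"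
  shows "incident (homothety_class L) (homothety_class L') \<longleftrightarrow> comparable L L'"
proof
  assume "incident (homothety_class L) (homothety_class L')"
  then obtain M M' L0 where M: "M \<in> homothety_class L" "M' \<in> homothety_class L'" "primitive L0"
    "form_maps_into M \<pi>\<O>" "form_maps_into M' \<pi>\<O>"
    "scaled \<pi> L0 \<subseteq> M \<and> M \<subseteq> M' \<and> M' \<subseteq> L0 \<or> scaled \<pi> L0 \<subseteq> M' \<and> M' \<subseteq> M \<and> M \<subseteq> L0"
    unfolding incident_def by blast
  have "lattice M" "lattice M'"
    using M(1,2) L lattice_scaled normalised_lattice unfolding mem_homothety_class by blast+
  then have "M \<in> normalised \<pi>" "M' \<in> normalised \<pi>"
    using normalised_of_vertex_representative[OF _ M(4,3)] normalised_of_vertex_representative[OF _ M(5,3)] M(6) by blast+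
  then have "M = L" "M' = L'" using homothety_class_representative L M(1,2) by blast+
  then show "comparable L L'" using M(6) by blast
next
  have inc: "\<exists>L0. primitive L0 \<and> form_maps_into A \<pi>\<O> \<and> form_maps_into B \<pi>\<O> \<and>
      scaled \<pi> L0 \<subseteq> A \<and> A \<subseteq> B \<and> B \<subseteq> L0" if AB: "A \<in> normalised \<pi>" "B \<in> normalised \<pi>" "A \<subseteq> B" for A B
  proof -
    obtain L0 where "primitive L0" "scaled \<pi> L0 \<subseteq> A" "dual \<pi> A \<subseteq> L0" using primitive_above[OF AB(1)] .
    moreover have "B \<subseteq> dual \<pi> A" using normalised_subset_dual[OF AB(2)] dual_antimono[OF AB(3), of \<pi>] by blast
    moreover have "form_maps_into A \<pi>\<O>" "form_maps_into B \<pi>\<O>"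
      using normalised_subset_dual AB form_maps_into_maximal_iff[OF lattice_subset_V[OF normalised_lattice]] by blast+
    ultimately show ?thesis using AB(3) by blast
  qed
  assume "comparable L L'"
  then have "\<exists>L0. primitive L0 \<and> form_maps_into L \<pi>\<O> \<and> form_maps_into L' \<pi>\<O> \<and>
        (scaled \<pi> L0 \<subseteq> L \<and> L \<subseteq> L' \<and> L' \<subseteq> L0 \<or> scaled \<pi> L0 \<subseteq> L' \<and> L' \<subseteq> L \<and> L \<subseteq> L0)"
    using inc[OF L(1,2)] inc[OF L(2,1)] by blast
  then show "incident (homothety_class L) (homothety_class L')"
    unfolding incident_def using self_homothety_class vertices_eq L by blast
qed

lemma chamber_iff: "chamber C \<longleftrightarrow> max_clique vertices incident C"
  unfolding chamber_def simplex_def max_clique_def clique_def by blast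

lemma close_iff: "close t t' \<longleftrightarrow> exchangeable vertices incident t t'"
  unfolding close_def adjacent_def exchangeable_def chamber_iff ..

section \<open>Special vertices\<close>

context
  fixes u w :: "nat \<Rightarrow> 'v"
  assumes sb: "symplectic_basis u w"
begin

lemma symplectic_basis_V: "i \<in> {1..n} \<Longrightarrow> u i \<in> V" "i \<in> {1..n} \<Longrightarrow> w i \<in> V"
  using sb span_base[of _ "u ` {1..n} \<union> w ` {1..n}"] unfolding symplectic_basis_def by blast+

lemma symplectic_basis_form:
  assumes "i \<in> {1..n}" "j \<in> {1..n}"
  shows "\<langle>u i, w j\<rangle> = (if i = j then 1 else 0)" "\<langle>u i, u j\<rangle> = 0" "\<langle>w i, w j\<rangle> = 0"
    "\<langle>w i, u j\<rangle> = (if i = j then -1 else 0)"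
proof -
  show "\<langle>u i, w j\<rangle> = (if i = j then 1 else 0)" "\<langle>u i, u j\<rangle> = 0" "\<langle>w i, w j\<rangle> = 0"
    using sb assms unfolding symplectic_basis_def by blast+
  have "\<langle>u j, w i\<rangle> = (if j = i then 1 else 0)" using sb assms unfolding symplectic_basis_def by blast
  then show "\<langle>w i, u j\<rangle> = (if i = j then -1 else 0)"
    unfolding form_swap[OF symplectic_basis_V(1)[OF assms(2)] symplectic_basis_V(2)[OF assms(1)]] by simp
qed

lemma symplectic_combination_V: "(\<Sum>i=1..n. f i *s u i) + (\<Sum>i=1..n. g i *s w i) \<in> V"
  using symplectic_basis_V by (intro V_add V_sum V_scale) auto

lemma symplectic_combination_form:
  assumes "y \<in> V"
  shows "\<langle>(\<Sum>i=1..n. f i *s u i) + (\<Sum>i=1..n. g i *s w i), y\<rangle> =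
    (\<Sum>i=1..n. f i * \<langle>u i, y\<rangle>) + (\<Sum>i=1..n. g i * \<langle>w i, y\<rangle>)"
proof -
  have "\<langle>\<Sum>i=1..n. f i *s u i, y\<rangle> = (\<Sum>i=1..n. f i * \<langle>u i, y\<rangle>)"
    using symplectic_basis_V assms by (subst form_sum_left) (auto simp: V_scale form_scale_left)
  moreover have "\<langle>\<Sum>i=1..n. g i *s w i, y\<rangle> = (\<Sum>i=1..n. g i * \<langle>w i, y\<rangle>)"
    using symplectic_basis_V assms by (subst form_sum_left) (auto simp: V_scale form_scale_left)
  moreover have "(\<Sum>i=1..n. f i *s u i) \<in> V" "(\<Sum>i=1..n. g i *s w i) \<in> V"
    using symplectic_basis_V by (intro V_sum V_scale; simp)+
  ultimately show ?thesis using form_add_left assms by simp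
qed

lemma symplectic_coordinates:
  assumes j: "j \<in> {1..n}"
  shows "\<langle>(\<Sum>i=1..n. f i *s u i) + (\<Sum>i=1..n. g i *s w i), w j\<rangle> = f j"
    "\<langle>(\<Sum>i=1..n. f i *s u i) + (\<Sum>i=1..n. g i *s w i), u j\<rangle> = - g j"
proof -
  have "(\<Sum>i=1..n. f i * \<langle>u i, w j\<rangle>) = (\<Sum>i=1..n. if i = j then f i else 0)"
    "(\<Sum>i=1..n. g i * \<langle>w i, w j\<rangle>) = (\<Sum>i=1..n. 0)"
    "(\<Sum>i=1..n. f i * \<langle>u i, u j\<rangle>) = (\<Sum>i=1..n. 0)"
    "(\<Sum>i=1..n. g i * \<langle>w i, u j\<rangle>) = (\<Sum>i=1..n. if i = j then - g i else 0)"
    by (rule sum.cong; use symplectic_basis_form[OF _ j] in auto)+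
  then show "\<langle>(\<Sum>i=1..n. f i *s u i) + (\<Sum>i=1..n. g i *s w i), w j\<rangle> = f j"
    "\<langle>(\<Sum>i=1..n. f i *s u i) + (\<Sum>i=1..n. g i *s w i), u j\<rangle> = - g j"
    using symplectic_combination_form symplectic_basis_V[OF j] j by simp_all
qed

text \<open>The difference of the two sides is orthogonal to a spanning set.\<close>

lemma symplectic_expand:
  assumes x: "x \<in> V"
  shows "x = (\<Sum>i=1..n. \<langle>x, w i\<rangle> *s u i) + (\<Sum>i=1..n. - \<langle>x, u i\<rangle> *s w i)" (is "x = ?y")
proof -
  have yV: "?y \<in> V" by (rule symplectic_combination_V)
  let ?z = "x - ?y"
  have z: "?z \<in> V" using V_diff[OF x yV] .
  have "\<langle>?z, w j\<rangle> = 0" "\<langle>?z, u j\<rangle> = 0" if j: "j \<in> {1..n}" for j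
    unfolding form_diff_left[OF x yV symplectic_basis_V(2)[OF j]] form_diff_left[OF x yV symplectic_basis_V(1)[OF j]]
      symplectic_coordinates[OF j] by simp_all
  then have "u ` {1..n} \<union> w ` {1..n} \<subseteq> {y \<in> V. \<langle>?z, y\<rangle> = 0}" using symplectic_basis_V by blast
  moreover have "subspace {y \<in> V. \<langle>?z, y\<rangle> = 0}"
    using z by (intro subspaceI) (auto simp: form_zero_right form_add_right form_scale_right V_add V_scale)
  ultimately have "span (u ` {1..n} \<union> w ` {1..n}) \<subseteq> {y \<in> V. \<langle>?z, y\<rangle> = 0}" by (rule span_minimal)
  then have "\<langle>?z, y\<rangle> = 0" if "y \<in> V" for y using sb that unfolding symplectic_basis_def by blast
  then have "?z = 0" using form_nondegenerate[OF z] by blast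
  then show ?thesis by (rule eq_iff_diff_eq_0[THEN iffD2])
qed

text \<open>In the coordinates of the symplectic basis the lattice is given by conditions on the orders of the
  coordinates, and the exponents \<open>a i\<close> and \<open>\<mu> - a i\<close> of paired basis
  vectors add up to \<open>\<mu>\<close>.\<close>

lemma dual_standard_lattice:
  fixes a :: "nat \<Rightarrow> int" and \<mu> :: int
  defines "T \<equiv> {(\<Sum>i=1..n. (c i * \<pi> powi a i) *s u i) + (\<Sum>i=1..n. (d i * \<pi> powi (\<mu> - a i)) *s w i)
               | c d. \<forall>i\<in>{1..n}. c i \<in> \<O> \<and> d i \<in> \<O>}"
  shows "T \<subseteq> V" "dual (\<pi> powi \<mu>) T = T"
proof -
  have nz: "\<pi> powi k \<noteq> 0" for k using uniformizer_nonzero by simp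
  have split: "\<pi> powi \<mu> = \<pi> powi a i * \<pi> powi (\<mu> - a i)" for i
    using power_int_add[of \<pi> "a i" "\<mu> - a i"] uniformizer_nonzero by simp
  have T: "T = {x \<in> V. \<forall>i\<in>{1..n}. \<langle>x, w i\<rangle> / \<pi> powi a i \<in> \<O> \<and> \<langle>x, u i\<rangle> / \<pi> powi (\<mu> - a i) \<in> \<O>}"
    (is "T = ?S")
  proof (intro equalityI subsetI)
    fix x assume "x \<in> T"
    then obtain c d where x: "x = (\<Sum>i=1..n. (c i * \<pi> powi a i) *s u i) + (\<Sum>i=1..n. (d i * \<pi> powi (\<mu> - a i)) *s w i)"
      and cd: "\<forall>i\<in>{1..n}. c i \<in> \<O> \<and> d i \<in> \<O>" unfolding T_def by blast
    have "\<langle>x, w i\<rangle> / \<pi> powi a i \<in> \<O> \<and> \<langle>x, u i\<rangle> / \<pi> powi (\<mu> - a i) \<in> \<O>" if i: "i \<in> {1..n}" for i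
      unfolding x symplectic_coordinates[OF i] using cd i nz minus_O by simp
    moreover have "x \<in> V" unfolding x by (rule symplectic_combination_V)
    ultimately show "x \<in> ?S" by blast
  next
    fix x assume x: "x \<in> ?S"
    let ?c = "\<lambda>i. \<langle>x, w i\<rangle> / \<pi> powi a i" and ?d = "\<lambda>i. - (\<langle>x, u i\<rangle> / \<pi> powi (\<mu> - a i))"
    have "x = (\<Sum>i=1..n. \<langle>x, w i\<rangle> *s u i) + (\<Sum>i=1..n. - \<langle>x, u i\<rangle> *s w i)" using symplectic_expand x by blast
    then have "x = (\<Sum>i=1..n. (?c i * \<pi> powi a i) *s u i) + (\<Sum>i=1..n. (?d i * \<pi> powi (\<mu> - a i)) *s w i)"
      using uniformizer_nonzero by simp
    moreover have "\<forall>i\<in>{1..n}. ?c i \<in> \<O> \<and> ?d i \<in> \<O>" using x minus_O by blast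
    ultimately have "\<exists>c d. x = (\<Sum>i=1..n. (c i * \<pi> powi a i) *s u i) + (\<Sum>i=1..n. (d i * \<pi> powi (\<mu> - a i)) *s w i) \<and>
        (\<forall>i\<in>{1..n}. c i \<in> \<O> \<and> d i \<in> \<O>)"
      by - (rule exI[of _ ?c], rule exI[of _ ?d], rule conjI)
    then show "x \<in> T" unfolding T_def by blast
  qed
  show TV: "T \<subseteq> V" unfolding T by blast
  show "dual (\<pi> powi \<mu>) T = T"
  proof (intro equalityI subsetI)
    fix x assume x: "x \<in> dual (\<pi> powi \<mu>) T"
    then have xV: "x \<in> V" and xT: "\<And>y. y \<in> T \<Longrightarrow> \<langle>x, y\<rangle> / \<pi> powi \<mu> \<in> \<O>" unfolding dual_def by blast+
    have "\<langle>x, w i\<rangle> / \<pi> powi a i \<in> \<O> \<and> \<langle>x, u i\<rangle> / \<pi> powi (\<mu> - a i) \<in> \<O>" if i: "i \<in> {1..n}" for i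
    proof
      note V = symplectic_basis_V[OF i]
      have "\<pi> powi a i *s u i \<in> T" unfolding T
        using V i symplectic_basis_form[OF i] nz by (auto simp: form_scale_left V_scale symplectic_basis_V)
      then have "\<langle>x, \<pi> powi a i *s u i\<rangle> / \<pi> powi \<mu> \<in> \<O>" by (rule xT)
      then show "\<langle>x, u i\<rangle> / \<pi> powi (\<mu> - a i) \<in> \<O>"
        unfolding form_scale_right[OF xV V(1)] split[of i] using uniformizer_nonzero by simp
      have "\<pi> powi (\<mu> - a i) *s w i \<in> T" unfolding T
        using V i symplectic_basis_form[OF i] nz minus_O[OF one_O] by (auto simp: form_scale_left V_scale symplectic_basis_V)
      then have "\<langle>x, \<pi> powi (\<mu> - a i) *s w i\<rangle> / \<pi> powi \<mu> \<in> \<O>" by (rule xT)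
      then show "\<langle>x, w i\<rangle> / \<pi> powi a i \<in> \<O>"
        unfolding form_scale_right[OF xV V(2)] split[of i] using uniformizer_nonzero by simp
    qed
    then show "x \<in> T" unfolding T using xV by blast
  next
    fix x assume x: "x \<in> T"
    have xV: "x \<in> V" using x TV by blast
    have "\<langle>y, x\<rangle> / \<pi> powi \<mu> \<in> \<O>" if y: "y \<in> T" for y
    proof -
      have yV: "y \<in> V" using y TV by blast
      have sw: "\<langle>u i, x\<rangle> = - \<langle>x, u i\<rangle>" "\<langle>w i, x\<rangle> = - \<langle>x, w i\<rangle>" if "i \<in> {1..n}" for i
        using form_swap[OF xV] symplectic_basis_V[OF that] by auto
      have "\<langle>y, x\<rangle> = (\<Sum>i=1..n. \<langle>y, w i\<rangle> * \<langle>u i, x\<rangle>) + (\<Sum>i=1..n. - \<langle>y, u i\<rangle> * \<langle>w i, x\<rangle>)"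
        using symplectic_combination_form[OF xV, of "\<lambda>i. \<langle>y, w i\<rangle>" "\<lambda>i. - \<langle>y, u i\<rangle>"]
        unfolding symplectic_expand[OF yV, symmetric] .
      then have "\<langle>y, x\<rangle> / \<pi> powi \<mu> =
        (\<Sum>i=1..n. \<langle>y, w i\<rangle> * \<langle>u i, x\<rangle> / \<pi> powi \<mu>) + (\<Sum>i=1..n. - \<langle>y, u i\<rangle> * \<langle>w i, x\<rangle> / \<pi> powi \<mu>)"
        by (simp only: add_divide_distrib sum_divide_distrib)
      moreover have "\<langle>y, w i\<rangle> * \<langle>u i, x\<rangle> / \<pi> powi \<mu> \<in> \<O>" "- \<langle>y, u i\<rangle> * \<langle>w i, x\<rangle> / \<pi> powi \<mu> \<in> \<O>"
        if i: "i \<in> {1..n}" for i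
      proof -
        have m: "\<langle>z, w i\<rangle> / \<pi> powi a i \<in> \<O>" "\<langle>z, u i\<rangle> / \<pi> powi (\<mu> - a i) \<in> \<O>" if "z \<in> T" for z
          using that i unfolding T by blast+
        have "\<langle>y, w i\<rangle> * \<langle>u i, x\<rangle> / \<pi> powi \<mu> = - ((\<langle>y, w i\<rangle> / \<pi> powi a i) * (\<langle>x, u i\<rangle> / \<pi> powi (\<mu> - a i)))"
          unfolding sw[OF i] split[of i] by simp
        also have "\<dots> \<in> \<O>" by (intro minus_O mult_O m x y)
        finally show "\<langle>y, w i\<rangle> * \<langle>u i, x\<rangle> / \<pi> powi \<mu> \<in> \<O>" .
        have "- \<langle>y, u i\<rangle> * \<langle>w i, x\<rangle> / \<pi> powi \<mu> = (\<langle>x, w i\<rangle> / \<pi> powi a i) * (\<langle>y, u i\<rangle> / \<pi> powi (\<mu> - a i))"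
          unfolding sw[OF i] split[of i] by simp
        also have "\<dots> \<in> \<O>" by (intro mult_O m x y)
        finally show "- \<langle>y, u i\<rangle> * \<langle>w i, x\<rangle> / \<pi> powi \<mu> \<in> \<O>" .
      qed
      ultimately show ?thesis by (auto intro!: add_O sum_O)
    qed
    then have "\<langle>x, y\<rangle> / \<pi> powi \<mu> \<in> \<O>" if y: "y \<in> T" for y
    proof -
      have "\<langle>x, y\<rangle> / \<pi> powi \<mu> = - (\<langle>y, x\<rangle> / \<pi> powi \<mu>)"
        using y TV unfolding form_swap[OF subsetD[OF TV y] xV] by simp
      then show ?thesis using \<open>\<And>y. y \<in> T \<Longrightarrow> \<langle>y, x\<rangle> / \<pi> powi \<mu> \<in> \<O>\<close>[OF y] minus_O by simp
    qed
    then show "x \<in> dual (\<pi> powi \<mu>) T" using xV unfolding dual_def by blast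
  qed
qed

end

text \<open>The two alternatives are the two kinds of special vertices, the homothety classes of the primitive
  lattices and of the lattices whose residual space is zero.\<close>

lemma special_representative:
  assumes "special t"
  obtains L where "L \<in> normalised \<pi>" "t = homothety_class L" "dual (\<pi> * \<pi>) L = L \<or> dual \<pi> L = L"
proof -
  from assms obtain u w a \<mu> where tv: "t \<in> vertices" and sb: "symplectic_basis u w"
    and t: "t = homothety_class
       {(\<Sum>i=1..n. (c i * \<pi> powi a i) *s u i) + (\<Sum>i=1..n. (d i * \<pi> powi (\<mu> - a i)) *s w i)
               | c d. \<forall>i\<in>{1..n}. c i \<in> \<O> \<and> d i \<in> \<O>}" (is "t = homothety_class ?T")
    unfolding special_def by blast
  note T = dual_standard_lattice[OF sb, where a = a and \<mu> = \<mu>]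
  obtain L where L: "L \<in> normalised \<pi>" "t = homothety_class L" using tv vertices_eq by blast
  have "L \<in> homothety_class ?T" using self_homothety_class[of L] unfolding L(2)[symmetric] t .
  then obtain b where b: "b \<noteq> 0" "L = scaled b ?T" unfolding mem_homothety_class by blast
  \<comment> \<open>the standard lattice is self-dual for \<open>\<pi> powi \<mu>\<close>, and a rescaling by \<open>b\<close> multiplies this by \<open>b * b\<close>; the
      inclusions in \<open>normalised \<pi>\<close> then leave only the orders 1 and 2 for the resulting factor\<close>
  define c where "c = (b * b) * \<pi> powi \<mu>"
  have c: "c \<noteq> 0" using b uniformizer_nonzero by (simp add: c_def)
  have "dual c L = scaled (inverse b) (dual c ?T)" unfolding b(2) by (rule dual_scaled[OF b(1) T(1)])
  also have "dual c ?T = scaled (b * b) ?T"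
    unfolding c_def using dual_mult[of "b * b" ?T "\<pi> powi \<mu>"] T b(1) by simp
  also have "scaled (inverse b) (scaled (b * b) ?T) = L"
    unfolding scaled_scaled mult.assoc inverse_mult_cancel[OF b(1)] b(2) ..
  finally have self: "dual c L = L" .
  note lat = normalised_lattice[OF L(1)]
  have rescale: "dual c' L = scaled (c' / c) L" if "c' \<noteq> 0" for c'
    using dual_mult[of "c' / c" L c] lattice_subset_V[OF lat] c that self by simp
  have "1 \<le> ord c"
  proof (rule ccontr)
    assume "\<not> 1 \<le> ord c"
    then have "\<pi> / c \<in> \<pi>\<O>"
      using ord_divide[OF uniformizer_nonzero c] by (simp add: maximal_ideal_iff_ord ord_uniformizer)
    then show False
      using lattice_not_subset_scaled[OF lat] normalised_subset_dual[OF L(1)] rescale[OF uniformizer_nonzero] by simp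
  qed
  moreover have "ord c \<le> 2"
  proof (rule ccontr)
    assume "\<not> ord c \<le> 2"
    then have "c / (\<pi> * \<pi>) \<in> \<pi>\<O>"
      using ord_divide[OF c, of "\<pi> * \<pi>"] ord_mult[OF uniformizer_nonzero uniformizer_nonzero] uniformizer_nonzero
      by (simp add: maximal_ideal_iff_ord ord_uniformizer)
    moreover have "scaled (\<pi> * \<pi> / c) L \<subseteq> L"
      using normalised_dual_subset[OF L(1)] rescale[of "\<pi> * \<pi>"] uniformizer_nonzero by simp
    then have "L \<subseteq> scaled (c / (\<pi> * \<pi>)) L"
      using scaled_subset_swap[of "\<pi> * \<pi> / c" L L] c uniformizer_nonzero by simp
    ultimately show False using lattice_not_subset_scaled[OF lat] by blast
  qed
  ultimately have "ord c = ord \<pi> \<or> ord c = ord (\<pi> * \<pi>)"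
    using ord_mult[OF uniformizer_nonzero uniformizer_nonzero] ord_uniformizer by auto
  then have "dual (\<pi> * \<pi>) L = L \<or> dual \<pi> L = L"
    using dual_same_ord[OF lat c] self uniformizer_nonzero by (metis mult_eq_0_iff)
  then show ?thesis using that L by blast
qed

section \<open>The two counts\<close>

lemma counts_of_special:
  assumes "special t"
  shows "card {C. chamber C \<and> t \<in> C} = flag_number q n" "\<omega> t = (\<Sum>j<2*n. q ^ j) * q"
proof -
  obtain L where L: "L \<in> normalised \<pi>" "t = homothety_class L" and d: "dual (\<pi> * \<pi>) L = L \<or> dual \<pi> L = L"
    using special_representative[OF assms] .
  have pp: "\<pi> * \<pi> \<noteq> 0" using uniformizer_nonzero by simp
  have "card {X. max_clique (normalised \<pi>) comparable X \<and> L \<in> X} = flag_number q n \<and>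
    card {M. exchangeable (normalised \<pi>) comparable L M} = (\<Sum>j<2*n. q ^ j) * q"
  proof (cases "dual (\<pi> * \<pi>) L = L")
    case True
    then show ?thesis
      using card_max_cliques_bottom[OF L(1) True uniformizer_nonzero]
        card_exchangeable_bottom[OF L(1) True uniformizer_nonzero] by blast
  next
    case False
    then have top: "dual \<pi> L = L" using d by blast
    \<comment> \<open>here \<open>L\<close> is maximal among its neighbours; an inclusion-reversing bijection turns it into a bottom element\<close>
    let ?D = "dual (\<pi> * \<pi>)" and ?P = "normalised (\<pi> * \<pi>)"
    have im: "?D ` normalised \<pi> = ?P" by (rule normalised_dual_image[OF uniformizer_nonzero])
    have inj: "inj_on ?D (normalised \<pi>)"
      by (rule inj_onI) (metis normalised_lattice dual_dual pp)
    have cmp: "\<forall>A\<in>normalised \<pi>. \<forall>B\<in>normalised \<pi>. comparable (?D A) (?D B) \<longleftrightarrow> comparable A B"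
      using dual_subset_iff[OF normalised_lattice normalised_lattice pp] by blast
    note lat = normalised_lattice[OF L(1)]
    have DL: "?D L \<in> ?P" using im L(1) by blast
    have "?D L = scaled \<pi> L" using dual_uniformizer_mult[OF lat, of \<pi>] top by simp
    then have bot: "dual (\<pi> * (\<pi> * \<pi>)) (?D L) = ?D L"
      using dual_uniformizer_mult[OF normalised_lattice[OF DL], of "\<pi> * \<pi>"] dual_dual[OF lat pp] by simp
    show ?thesis
      using card_max_cliques_image[OF inj cmp L(1)] card_exchangeable_image[OF inj cmp L(1)]
        card_max_cliques_bottom[OF DL bot pp] card_exchangeable_bottom[OF DL bot pp] unfolding im by simp
  qed
  moreover have inc: "\<forall>A\<in>normalised \<pi>. \<forall>B\<in>normalised \<pi>. incident (homothety_class A) (homothety_class B) \<longleftrightarrow> comparable A B"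
    using incident_homothety_class_iff by blast
  note im = card_max_cliques_image[OF inj_on_homothety_class inc L(1)]
    card_exchangeable_image[OF inj_on_homothety_class inc L(1)]
  ultimately show "card {C. chamber C \<and> t \<in> C} = flag_number q n" "\<omega> t = (\<Sum>j<2*n. q ^ j) * q"
    using im unfolding chamber_iff \<omega>_def close_iff vertices_eq[symmetric] L(2)[symmetric] by simp_all
qed

text \<open>In rank one, the convention \<open>q + 1\<close> is the value of the product formula.\<close>

lemma r_special:
  assumes "special t"
  shows "r t = flag_number q n"
  unfolding r_def using counts_of_special(1)[OF assms] by (auto simp: flag_number_def numeral_2_eq_2)

end

theorem theorem2p2:
  fixes ord :: "'k::field \<Rightarrow> int" and \<pi> :: 'k and n :: nat
    and scale :: "'k \<Rightarrow> 'v::ab_group_add \<Rightarrow> 'v" and V :: "'v set" and form :: "'v \<Rightarrow> 'v \<Rightarrow> 'k"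
    and scale' :: "'k \<Rightarrow> 'w::ab_group_add \<Rightarrow> 'w" and V' :: "'w set" and form' :: "'w \<Rightarrow> 'w \<Rightarrow> 'k"
    and s t :: "'v set set" and t' :: "'w set set"
  assumes "n \<ge> 2"
    and "symplectic_space ord \<pi> scale V form n"
    and "symplectic_space ord \<pi> scale' V' form' (n - 1)"
    and "symplectic_space.special ord \<pi> scale V form n s"
    and "symplectic_space.special ord \<pi> scale V form n t"
    and "symplectic_space.special ord \<pi> scale' V' form' (n - 1) t'"
  shows "nonarch_local_field.q ord \<pi> * symplectic_space.r ord \<pi> scale V form n s =
    symplectic_space.r ord \<pi> scale' V' form' (n - 1) t' *
    symplectic_space.\<omega> ord \<pi> scale V form n t"
proof -
  obtain m where m: "n = Suc m" using assms(1) by (cases n) auto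
  show ?thesis
    unfolding symplectic_space.r_special[OF assms(2,4)] symplectic_space.r_special[OF assms(3,6)]
      symplectic_space.counts_of_special(2)[OF assms(2,5)]
    by (simp add: m flag_number_def)
qed

end
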